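(* Let $y_1,\dots,y_n,\tau,\beta,b,c,x_1,\dots,x_n$ be complex parameters with $|y_{1}y_{2}\cdots y_{n}\tau|<1$. Suppose that none of the denominators in the following identity vanishes. Then $$\begin{aligned} & \sum_{j_1,\dots,j_n\ge0}\ \prod_{1\leq r<s\leq n}\frac{1-q^{j_{r}-j_{s}}x_{r}/x_{s}}{1-x_{r}/x_{s}}\prod_{r,s=1}^{n}\frac{(x_{r}/(x_{s}y_{s}))_{j_{r}}}{(qx_{r}/x_{s})_{j_{r}}}\\ &\qquad\times(y_{1}\cdots y_{n}\tau)^{|\boldsymbol{j}|}q^{\sum_{r=1}^{n}(r-1)j_{r}}\frac{(q,c)_{|\boldsymbol{j}|}}{(bc)_{|\boldsymbol{j}|}}\prod_{r=1}^{n}\frac{1}{(\beta x_{r})_{j_{r}}}\\ &=\sum_{k_1,\dots,k_n\ge0}\ \prod_{1\leq r<s\leq n}\frac{1-q^{k_{r}-k_{s}}x_{r}/x_{s}}{1-x_{r}/x_{s}}\prod_{r,s=1}^{n}\frac{(x_{r}/(x_{s}y_{s}))_{k_{r}}}{(qx_{r}/x_{s})_{k_{r}}}\\ &\quad\times\frac{(1-\tau q^{2|\boldsymbol{k}|})(q)_{|\boldsymbol{k}|}}{(y_{1}\cdots y_{n}\tau)_{|\boldsymbol{k}|+1}}(y_{1}\cdots y_{n}\beta\tau)^{|\boldsymbol{k}|}q^{\sum_{r=1}^{n}(r-1)k_{r}+\binom{|\boldsymbol{k}|}{2}+\sum_{r=1}^{n}\binom{k_{r}}{2}}\\ &\quad\times\prod_{r=1}^{n}\frac{(q^{1+|\boldsymbol{k}|-k_{r}}\tau/(\beta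 x_{r}))_{k_{r}}}{(\beta x_{r})_{k_{r}}}\prod_{r=1}^{n}x_{r}^{k_{r}}\\ &\quad\times\sum_{\substack{0\leq j_{r}\leq k_{r}\\ r=1,\dots,n}}\ \prod_{1\leq r<s\leq n}\frac{1-q^{k_{s}-k_{r}+j_{r}-j_{s}}x_{s}/x_{r}}{1-q^{k_{s}-k_{r}}x_{s}/x_{r}}\; q^{|\boldsymbol{k}||\boldsymbol{j}|-\sum_{r=1}^{n}k_{r}j_{r}-e_{2}(j_{1},\dots,j_{n})+\sum_{r=1}^{n}rj_{r}}\\ &\qquad\times\prod_{r,s=1}^{n}\frac{(q^{-k_{r}}x_{s}/x_{r})_{j_{r}}}{(q^{1+k_{s}-k_{r}}x_{s}/x_{r})_{j_{r}}}\prod_{r=1}^{n}\frac{x_{r}^{-j_{r}}}{(\tau q^{1-k_{r}+|\boldsymbol{k}|}/(\beta x_{r}))_{j_{r}}}\cdot\Big(\frac{c}{\beta}\Big)^{|\boldsymbol{j}|}\frac{(\tau q^{|\boldsymbol{k}|})_{|\boldsymbol{j}|}(b)_{|\boldsymbol{j}|}}{(bc)_{|\boldsymbol{j}|}}, \end{aligned}$$ where $e_{2}(j_{1},\dots,j_{n})=\sum_{1\le r<s\le n}j_rj_s$ is the second elementary symmetric function of $j_1,\dots,j_n$.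
   Context: $q$ is a complex number with $0<|q|<1$ and $n\ge1$ is an integer. $(z)_k=\prod_{i=0}^{k-1}(1-zq^i)$ for integers $k\ge0$; $(c_1,\dots,c_p)_k=(c_1)_k\cdots(c_p)_k$. Bold letters denote multi-indices of nonnegative integers, $\boldsymbol k=(k_1,\dots,k_n)$, with $|\boldsymbol k|=k_1+\cdots+k_n$. *)

theory Defs
  imports "HOL-Analysis.Analysis"
begin

definition qpoch :: "complex \<Rightarrow> complex \<Rightarrow> nat \<Rightarrow> complex" where
  "qpoch q z k = (\<Prod>i<k. 1 - z * q ^ i)"

text \<open>Multi-indices are functions on \<open>{1..n}\<close>; extensionality (the value is \<open>undefined\<close> outside
  \<open>{1..n}\<close>) ensures that each tuple is counted exactly once in a sum.\<close>

definition multi_indices :: "nat \<Rightarrow> (nat \<Rightarrow> nat) set" where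
  "multi_indices n = {1..n} \<rightarrow>\<^sub>E UNIV"

definition multi_indices_le :: "nat \<Rightarrow> (nat \<Rightarrow> nat) \<Rightarrow> (nat \<Rightarrow> nat) set" where
  "multi_indices_le n k = (\<Pi>\<^sub>E r\<in>{1..n}. {0..k r})"

definition mi_size :: "nat \<Rightarrow> (nat \<Rightarrow> nat) \<Rightarrow> nat" where
  "mi_size n k = (\<Sum>r=1..n. k r)"

definition index_pairs :: "nat \<Rightarrow> (nat \<times> nat) set" where
  "index_pairs n = {(r, s). 1 \<le> r \<and> r < s \<and> s \<le> n}"

definition elem_sym2 :: "nat \<Rightarrow> (nat \<Rightarrow> nat) \<Rightarrow> nat" where
  "elem_sym2 n j = (\<Sum>(r, s)\<in>index_pairs n. j r * j s)"

end

theory Submission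
  imports Defs
begin

text \<open>
  Multivariate summands are built from \<open>wt x a k\<close>, the Vandermonde-type factor of the theorem with
  \<open>1 / y s\<close> replaced by \<open>a s\<close> and the power of \<open>q\<close> included. The inner sum on the right-hand side is a
  multivariate terminating 3-phi-2 series. With \<open>A = \<tau> q ^ |k|\<close> and the polynomial \<open>P k A\<close>, the product
  of all \<open>A - \<beta> x\<^sub>r q ^ i\<close> with \<open>i < k\<^sub>r\<close>, one expands \<open>P k\<close> in the basis \<open>(A)\<^sub>m\<close> and, on the other hand,
  expresses the iterated \<open>q\<close>-derivatives of \<open>P k\<close> through the \<open>P (k - j)\<close>; combining both by
  \<open>q\<close>-Vandermonde turns the inner sum into one over \<open>i \<le> k\<close> whose terms involve \<open>b\<close>, \<open>c\<close>, \<open>\<beta>\<close> only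
  through \<open>i\<close>. The weights attached to \<open>k\<close> and \<open>i\<close> then factor into one for \<open>i\<close> and one for \<open>k - i\<close>, so
  after exchanging the order of summation the sum over \<open>k\<close> reduces, level by level in \<open>|k - i|\<close>, to a
  nonterminating very-well-poised series in one variable, which a WZ pair evaluates. All
  multivariate steps rest on Lagrange interpolation at the points \<open>x\<^sub>r q ^ k\<^sub>r\<close>.
\<close>

section \<open>Lagrange interpolation\<close>

text \<open>The right-hand side is the left-hand side with the number 1 inserted in each summand,
  written as a very-well-poised series. This is why the one-variable sum has the value 1 for every
  \<open>|i|\<close>.

  Two obstacles shape the proof. Exchanging the sums needs absolute summability over the pairs
  \<open>(i, k - i)\<close>. The only decay used is the geometric one of \<open>Y * \<tau>\<close>,
  where \<open>Y\<close> is the product of the \<open>y r\<close>, so every other factor must be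
  bounded uniformly in both indices, although the ratios
  \<open>x r * q ^ i r / (x s * q ^ i s)\<close> are unbounded.

  The multivariate sums are not evaluated by residues but by recursion on \<open>|j|\<close>: the
  change of the weight under a unit step is a quotient of two interpolation summands, so every
  recursion reduces to one interpolation sum. For the Newton coefficients that sum has an additional
  node which may coincide with a given one; hence the first lemma is stated with its denominators
  cleared.\<close>

text \<open>This is \<open>lagrange_sum\<close> for the nodes \<open>z s\<close> and one more node
  \<open>1 / w\<close>, multiplied by all \<open>1 - w * z s\<close>; the subtracted product is the
  contribution of the node \<open>1 / w\<close>. In this form \<open>w * z s = 1\<close> is allowed,
  a case that occurs in \<open>newton_coeff_rec\<close>.\<close>

lemma lagrange_shifted:
  fixes c :: "'b \<Rightarrow> complex" and z :: "'a \<Rightarrow> complex"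
  assumes "finite I" "finite J" "card J = Suc (card I)" "inj_on z I" "\<And>s. s \<in> I \<Longrightarrow> z s \<noteq> 0" "w \<noteq> 0"
  shows "(\<Sum>r\<in>I. (\<Prod>s\<in>J. 1 - c s * z r) * (\<Prod>s\<in>I-{r}. 1 - w * z s) / (\<Prod>s\<in>I-{r}. 1 - z r / z s))
    = (\<Prod>s\<in>I. 1 - w * z s) * (1 - (\<Prod>s\<in>J. c s) * (\<Prod>s\<in>I. z s) / w)
      - (\<Prod>s\<in>J. 1 - c s / w) * (\<Prod>s\<in>I. - (w * z s))"
  using assms(1-5)
proof (induction "card I" arbitrary: I J)
  case 0
  then have "I = {}" "card J = 1" by auto
  then show ?case by (auto simp: card_1_singleton_iff)
next
  case (Suc m)
  note IH = Suc.hyps(1)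
  have wn: "w \<noteq> 0" by fact
  show ?case
  proof (cases "m = 0")
    \<comment> \<open>A single node is computed directly, since the argument for larger
      \<open>I\<close> needs two distinct values \<open>1 / z t\<close> and
      \<open>1 / z u\<close>.\<close>
    case True
    then obtain t where t: "I = {t}" using Suc by (metis One_nat_def card_1_singletonE)
    have "card J = 2" using Suc True by simp
    then obtain p u where pu: "J = {p,u}" "p \<noteq> u" by (auto simp: card_2_iff)
    have zt: "z t \<noteq> 0" using Suc t by auto
    show ?thesis using pu zt wn unfolding t by (simp add: field_simps)
  next
    case False
    obtain t where t: "t \<in> I" using Suc by (metis card.empty ex_in_conv nat.distinct(1))
    have "card (I - {t}) = m" using t Suc by simp
    then obtain u where u: "u \<in> I" "u \<noteq> t" using False
      by (metis DiffE card.empty ex_in_conv insertI1)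
    obtain p where p: "p \<in> J" using Suc by (metis card.empty ex_in_conv nat.distinct(1))
    have fI: "finite I" and fJ: "finite J" and zi: "inj_on z I" using Suc by auto
    have nz: "z t \<noteq> 0" "z u \<noteq> 0" "z t \<noteq> z u"
      using Suc t u by (auto dest: inj_onD)
    \<comment> \<open>Both sides are affine in \<open>c p\<close>; for \<open>c p = 1 / z v\<close> the summand at \<open>v\<close> vanishes and the rest is
      the claim for \<open>I - {v}\<close> and \<open>J - {p}\<close>. Two such values suffice.\<close>
    define l where "l = (c p - 1 / z u) / (1 / z t - 1 / z u)"
    have cp: "c p = l / z t + (1 - l) / z u"
      using nz unfolding l_def by (simp add: divide_simps) algebra
    define J' where "J' = J - {p}"
    have J: "J = insert p J'" "p \<notin> J'" "finite J'" using p fJ unfolding J'_def by auto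
    define X where "X v = (\<Sum>r\<in>I. (1 - z r / z v) * (\<Prod>s\<in>J'. 1 - c s * z r) * (\<Prod>s\<in>I-{r}. 1 - w * z s) / (\<Prod>s\<in>I-{r}. 1 - z r / z s))" for v
    define Q where "Q = (\<Prod>s\<in>I. 1 - w * z s)"
    define C where "C = (\<Prod>s\<in>J'. c s)"
    define Z where "Z = (\<Prod>s\<in>I. z s)"
    define D where "D = (\<Prod>s\<in>J'. 1 - c s / w)"
    define M where "M = (\<Prod>s\<in>I. - (w * z s))"
    have X: "X v = Q * (1 - C * Z / (z v * w)) - (1 - 1 / (z v * w)) * D * M" if v: "v \<in> I" for v
    proof -
      define I' where "I' = I - {v}"
      have I: "I = insert v I'" "v \<notin> I'" "finite I'" using v fI unfolding I'_def by auto
      have zv: "z v \<noteq> 0" using v Suc by auto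
      have cI: "m = card I'" using Suc I by auto
      have "X v = (\<Sum>r\<in>I'. (1 - z r / z v) * (\<Prod>s\<in>J'. 1 - c s * z r) * (\<Prod>s\<in>I-{r}. 1 - w * z s) / (\<Prod>s\<in>I-{r}. 1 - z r / z s))"
        unfolding X_def I(1) using I zv by simp
      also have "\<dots> = (\<Sum>r\<in>I'. (1 - w * z v) * ((\<Prod>s\<in>J'. 1 - c s * z r) * (\<Prod>s\<in>I'-{r}. 1 - w * z s) / (\<Prod>s\<in>I'-{r}. 1 - z r / z s)))"
      proof (rule sum.cong[OF refl])
        fix r assume r: "r \<in> I'"
        then have e: "I - {r} = insert v (I' - {r})" using I by auto
        have "r \<in> I" "r \<noteq> v" using r I by auto
        then have "z r \<noteq> z v" using inj_onD[OF zi] v by blast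
        then have "1 - z r / z v \<noteq> 0" using zv by auto
        then show "(1 - z r / z v) * (\<Prod>s\<in>J'. 1 - c s * z r) * (\<Prod>s\<in>I-{r}. 1 - w * z s) / (\<Prod>s\<in>I-{r}. 1 - z r / z s) =
          (1 - w * z v) * ((\<Prod>s\<in>J'. 1 - c s * z r) * (\<Prod>s\<in>I'-{r}. 1 - w * z s) / (\<Prod>s\<in>I'-{r}. 1 - z r / z s))"
          unfolding e using I zv by simp
      qed
      also have "\<dots> = (1 - w * z v) * (\<Sum>r\<in>I'. (\<Prod>s\<in>J'. 1 - c s * z r) * (\<Prod>s\<in>I'-{r}. 1 - w * z s) / (\<Prod>s\<in>I'-{r}. 1 - z r / z s))"
        by (simp add: sum_distrib_left)
      also have "\<dots> = (1 - w * z v) * ((\<Prod>s\<in>I'. 1 - w * z s) * (1 - (\<Prod>s\<in>J'. c s) * (\<Prod>s\<in>I'. z s) / w)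
      - (\<Prod>s\<in>J'. 1 - c s / w) * (\<Prod>s\<in>I'. - (w * z s)))"
      proof -
        have "card J' = Suc (card I')" using Suc J I by auto
        moreover have "inj_on z I'" using zi I by (auto intro: inj_on_subset)
        ultimately show ?thesis using IH[OF cI I(3) J(3)] I Suc by auto
      qed
      also have "\<dots> = Q * (1 - C * Z / (z v * w)) - (1 - 1 / (z v * w)) * D * M"
        unfolding Q_def C_def Z_def D_def M_def I(1) using I zv wn by (simp add: field_simps)
      finally show ?thesis .
    qed
    have "(\<Sum>r\<in>I. (\<Prod>s\<in>J. 1 - c s * z r) * (\<Prod>s\<in>I-{r}. 1 - w * z s) / (\<Prod>s\<in>I-{r}. 1 - z r / z s))
      = (\<Sum>r\<in>I. l * ((1 - z r / z t) * (\<Prod>s\<in>J'. 1 - c s * z r) * (\<Prod>s\<in>I-{r}. 1 - w * z s) / (\<Prod>s\<in>I-{r}. 1 - z r / z s))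
       + (1 - l) * ((1 - z r / z u) * (\<Prod>s\<in>J'. 1 - c s * z r) * (\<Prod>s\<in>I-{r}. 1 - w * z s) / (\<Prod>s\<in>I-{r}. 1 - z r / z s)))"
    proof (rule sum.cong[OF refl])
      fix r
      have e: "1 - c p * z r = l * (1 - z r / z t) + (1 - l) * (1 - z r / z u)"
        unfolding cp by (simp add: algebra_simps)
      have "(\<Prod>s\<in>J. 1 - c s * z r) = (l * (1 - z r / z t) + (1 - l) * (1 - z r / z u)) * (\<Prod>s\<in>J'. 1 - c s * z r)"
        using J by (simp add: e)
      then show "(\<Prod>s\<in>J. 1 - c s * z r) * (\<Prod>s\<in>I-{r}. 1 - w * z s) / (\<Prod>s\<in>I-{r}. 1 - z r / z s)
      = l * ((1 - z r / z t) * (\<Prod>s\<in>J'. 1 - c s * z r) * (\<Prod>s\<in>I-{r}. 1 - w * z s) / (\<Prod>s\<in>I-{r}. 1 - z r / z s))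
       + (1 - l) * ((1 - z r / z u) * (\<Prod>s\<in>J'. 1 - c s * z r) * (\<Prod>s\<in>I-{r}. 1 - w * z s) / (\<Prod>s\<in>I-{r}. 1 - z r / z s))"
        by (simp only: times_divide_eq_right add_divide_distrib [symmetric]) (simp add: algebra_simps)
    qed
    also have "\<dots> = l * X t + (1 - l) * X u"
      unfolding X_def by (simp add: sum.distrib sum_distrib_left)
    also have "\<dots> = Q * (1 - c p * C * Z / w) - (1 - c p / w) * D * M"
      unfolding X[OF t] X[OF u(1)] cp using nz wn by (simp add: divide_simps) algebra
    also have "\<dots> = (\<Prod>s\<in>I. 1 - w * z s) * (1 - (\<Prod>s\<in>J. c s) * (\<Prod>s\<in>I. z s) / w)
      - (\<Prod>s\<in>J. 1 - c s / w) * (\<Prod>s\<in>I. - (w * z s))"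
      unfolding Q_def C_def Z_def D_def M_def using J by (simp add: ac_simps)
    finally show ?thesis .
  qed
qed

lemma lagrange_sum:
  fixes c :: "'a \<Rightarrow> complex" and z :: "'a \<Rightarrow> complex"
  assumes "finite I" "inj_on z I" "\<And>s. s \<in> I \<Longrightarrow> z s \<noteq> 0"
  shows "(\<Sum>r\<in>I. (\<Prod>s\<in>I. 1 - c s * z r) / (\<Prod>s\<in>I-{r}. 1 - z r / z s))
    = 1 - (\<Prod>s\<in>I. c s) * (\<Prod>s\<in>I. z s)"
proof -
  have "infinite (UNIV - insert 0 ((\<lambda>s. 1 / z s) ` I))"
    using assms(1) by (simp add: infinite_UNIV_char_0)
  then obtain w where w: "w \<notin> insert 0 ((\<lambda>s. 1 / z s) ` I)"
    by (metis Diff_iff finite.emptyI ex_in_conv)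
  have w0: "w \<noteq> 0" and wz: "\<And>s. s \<in> I \<Longrightarrow> 1 - w * z s \<noteq> 0"
    using w assms(3) by (auto simp: field_simps image_iff)
  define J where "J = insert None (Some ` I)"
  \<comment> \<open>The additional index gets the coefficient \<open>w\<close>: then
    \<open>1 - c' None / w\<close> vanishes, and the factor \<open>1 - w * z r\<close> completes the
    product over \<open>I - {r}\<close>.\<close>
  define c' where "c' = case_option w c"
  have J: "finite J" "card J = Suc (card I)"
    using assms(1) by (auto simp: J_def card_image)
  have pr: "(\<Prod>s\<in>J. f s) = f None * (\<Prod>s\<in>I. f (Some s))" for f :: "'a option \<Rightarrow> complex"
    using assms(1) by (simp add: J_def prod.reindex)
  have "(\<Prod>s\<in>I. 1 - w * z s) * (\<Sum>r\<in>I. (\<Prod>s\<in>I. 1 - c s * z r) / (\<Prod>s\<in>I-{r}. 1 - z r / z s)) =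
     (\<Sum>r\<in>I. (\<Prod>s\<in>J. 1 - c' s * z r) * (\<Prod>s\<in>I-{r}. 1 - w * z s) / (\<Prod>s\<in>I-{r}. 1 - z r / z s))"
    unfolding sum_distrib_left
    by (rule sum.cong) (use assms(1) in \<open>simp_all add: pr c'_def prod.remove[of I]\<close>)
  also have "\<dots> = (\<Prod>s\<in>I. 1 - w * z s) * (1 - (\<Prod>s\<in>I. c s) * (\<Prod>s\<in>I. z s))"
    by (subst lagrange_shifted[OF assms(1) J assms(2,3) w0]) (use w0 in \<open>simp_all add: pr c'_def\<close>)
  finally show ?thesis using wz assms(1) by simp
qed

section \<open>Weights and their level sums\<close>

lemma qpoch_0 [simp]: "qpoch q z 0 = 1"
  by (simp add: qpoch_def)

lemma qpoch_Suc: "qpoch q z (Suc k) = qpoch q z k * (1 - z * q ^ k)"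
  by (simp add: qpoch_def)

lemma qpoch_Suc_left: "qpoch q z (Suc k) = (1 - z) * qpoch q (z * q) k"
  by (simp add: qpoch_def prod.lessThan_Suc_shift ac_simps del: prod.lessThan_Suc)

lemma qpoch_add: "qpoch q z (i + m) = qpoch q z i * qpoch q (z * q ^ i) m"
  by (induction m) (simp_all add: qpoch_Suc power_add ac_simps)

lemma qpoch_eq_0_iff: "qpoch q z k = 0 \<longleftrightarrow> (\<exists>i<k. z * q ^ i = 1)"
  by (auto simp: qpoch_def)

lemma choose_2_Suc: "Suc l choose 2 = l + (l choose 2)"
  by (simp add: numeral_2_eq_2)

lemma choose_2_add: "(a + b) choose 2 = (a choose 2) + (b choose 2) + a * b"
  by (induction a) (auto simp: choose_2_Suc numeral_2_eq_2)

locale q_base =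
  fixes q :: complex and n :: nat
  assumes q_nz [simp]: "q \<noteq> 0" and q_lt_1: "norm q < 1"
begin

lemma q_power_inj: "q ^ i = q ^ j \<longleftrightarrow> i = j"
proof
  assume "q ^ i = q ^ j"
  then have "norm q ^ i = norm q ^ j" by (metis norm_power)
  moreover have "0 < norm q" by simp
  ultimately show "i = j" using q_lt_1
    by (metis linorder_neqE_nat order_less_irrefl power_strict_decreasing)
qed simp

lemma q_power_eq_1: "q ^ i = 1 \<longleftrightarrow> i = 0"
  using q_power_inj[of i 0] by simp

lemma qpoch_q_nz [simp]: "qpoch q q k \<noteq> 0"
  using q_power_eq_1[of "Suc _"] by (auto simp: qpoch_eq_0_iff)

text \<open>With natural exponents on both sides this says that \<open>x r / x s\<close> is no
  integral power of \<open>q\<close>. The condition is stable under shifting the points by powers of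
  \<open>q\<close> and under inversion.\<close>

definition generic :: "(nat \<Rightarrow> complex) \<Rightarrow> bool" where
  "generic x \<longleftrightarrow> (\<forall>r\<in>{1..n}. x r \<noteq> 0) \<and>
    (\<forall>r\<in>{1..n}. \<forall>s\<in>{1..n}. r \<noteq> s \<longrightarrow> (\<forall>i j. x r * q ^ i \<noteq> x s * q ^ j))"

lemma generic_nz: "generic x \<Longrightarrow> r \<in> {1..n} \<Longrightarrow> x r \<noteq> 0"
  by (auto simp: generic_def)

lemma generic_neq: "generic x \<Longrightarrow> r \<in> {1..n} \<Longrightarrow> s \<in> {1..n} \<Longrightarrow> r \<noteq> s \<Longrightarrow> x r * q ^ i \<noteq> x s * q ^ j"
  by (auto simp: generic_def)

lemma generic_shift: "generic x \<Longrightarrow> generic (\<lambda>r. x r * q ^ i r)"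
  by (auto simp: generic_def mult.assoc simp flip: power_add)

lemma generic_inverse:
  assumes "generic x" shows "generic (\<lambda>r. 1 / (x r * q ^ k r))"
proof -
  have "1 / (x r * q ^ k r) * q ^ i \<noteq> 1 / (x s * q ^ k s) * q ^ j"
    if "r \<in> {1..n}" "s \<in> {1..n}" "r \<noteq> s" for r s i j
  proof
    assume "1 / (x r * q ^ k r) * q ^ i = 1 / (x s * q ^ k s) * q ^ j"
    then have "x s * q ^ (k s + i) = x r * q ^ (k r + j)"
      using that assms by (simp add: field_simps generic_nz power_add)
    then show False using generic_neq[OF assms that(1,2,3)] by metis
  qed
  then show ?thesis using assms by (simp add: generic_def)
qed

lemma generic_shift_nz:
  assumes "generic x" "r \<in> {1..n}" "s \<in> {1..n}" "r \<noteq> s"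
  shows "1 - x r * q ^ i / (x s * q ^ j) \<noteq> 0"
  using generic_neq[OF assms, of i j] generic_nz[OF assms(1,3)] by auto

lemma generic_inj: "generic x \<Longrightarrow> inj_on (\<lambda>r. x r * q ^ j r) {1..n}"
  by (rule inj_onI) (use generic_neq in blast)

lemma generic_qpoch_nz:
  assumes "generic x" "r \<in> {1..n}" "s \<in> {1..n}"
  shows "qpoch q (x r / (x s * q ^ k s)) (k r) \<noteq> 0"
proof (cases "r = s")
  case True
  then show ?thesis using generic_nz[OF assms(1,2)] q_power_inj[of _ "k s"]
    by (auto simp: qpoch_eq_0_iff field_simps)
next
  case False
  then show ?thesis using generic_shift_nz[OF assms(1,2,3) False, of _ "k s"]
    by (force simp: qpoch_eq_0_iff)
qed

text \<open>In this form of the weight, shifting the index is transparent; lemma \<open>wt_eq_vdm\<close> below identifies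
  it with the form used in the theorem.\<close>

definition wt :: "(nat \<Rightarrow> complex) \<Rightarrow> (nat \<Rightarrow> complex) \<Rightarrow> (nat \<Rightarrow> nat) \<Rightarrow> complex" where
  "wt x a k = (-1) ^ mi_size n k / q ^ (Suc (mi_size n k) choose 2) *
     ((\<Prod>r=1..n. \<Prod>s=1..n. qpoch q (a s * x r / x s) (k r)) /
      (\<Prod>r=1..n. \<Prod>s=1..n. qpoch q (x r / (x s * q ^ k s)) (k r)))"

text \<open>The summand of \<open>lagrange_sum\<close> for the nodes \<open>x r * q ^ j r\<close>
  and the coefficients \<open>a s / x s\<close>. Its numerator consists of the factors that the
  numerator of \<open>wt x a j\<close> gains when \<open>j r\<close> is raised by one.\<close>

definition lag :: "(nat \<Rightarrow> complex) \<Rightarrow> (nat \<Rightarrow> complex) \<Rightarrow> (nat \<Rightarrow> nat) \<Rightarrow> nat \<Rightarrow> complex" where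
  "lag x a j r = (\<Prod>s=1..n. 1 - a s / x s * (x r * q ^ j r)) /
     (\<Prod>s\<in>{1..n}-{r}. 1 - x r * q ^ j r / (x s * q ^ j s))"

abbreviation bump :: "nat \<Rightarrow> (nat \<Rightarrow> nat) \<Rightarrow> nat \<Rightarrow> nat" where
  "bump p j \<equiv> j(p := Suc (j p))"

lemma mi_size_bump: "p \<in> {1..n} \<Longrightarrow> mi_size n (bump p j) = Suc (mi_size n j)"
  unfolding mi_size_def by (subst (1 2) sum.remove[of _ p]) auto

lemma prod_bump: "p \<in> {1..n} \<Longrightarrow> (\<Prod>r=1..n. f r (bump p j r)) = f p (Suc (j p)) * (\<Prod>r\<in>{1..n}-{p}. f r (j r) :: complex)"
  by (subst prod.remove[of _ p]) auto

lemma qpoch_div_q: "qpoch q (v / q) m * (1 - v / q * q ^ m) = (1 - v / q) * qpoch q v m"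
  using qpoch_Suc[of q "v/q" m] qpoch_Suc_left[of q "v/q" m] by simp

text \<open>Raising \<open>j p\<close> lengthens the products in row \<open>p\<close> and divides
  the arguments in column \<open>p\<close> by \<open>q\<close>; the entry at \<open>(p, p)\<close>
  undergoes both changes. By \<open>qpoch_div_q\<close>, a column entry only exchanges one end
  factor for another.\<close>

lemma wt_denominator_bump:
  assumes x: "generic x" and p: "p \<in> {1..n}"
  shows "(\<Prod>r=1..n. \<Prod>s=1..n. qpoch q (x r / (x s * q ^ bump p j s)) (bump p j r)) *
      (\<Prod>s\<in>{1..n}-{p}. 1 - x s * q ^ j s / (x p * q ^ Suc (j p))) =
    (\<Prod>r=1..n. \<Prod>s=1..n. qpoch q (x r / (x s * q ^ j s)) (j r)) *
      (\<Prod>s\<in>{1..n}-{p}. 1 - x p * q ^ j p / (x s * q ^ j s)) *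
      (\<Prod>s=1..n. 1 - x s / (x p * q ^ Suc (j p)))"
proof -
  let ?I = "{1..n} - {p}"
  define E where "E r = (\<Prod>s\<in>?I. qpoch q (x r / (x s * q ^ j s)) (j r))" for r
  have xp: "x p \<noteq> 0" using generic_nz[OF x p] .
  have split: "(\<Prod>s=1..n. f s) = f p * (\<Prod>s\<in>?I. f s)" for f :: "nat \<Rightarrow> complex"
    using p by (simp add: prod.remove)
  have 1: "(\<Prod>r=1..n. \<Prod>s=1..n. qpoch q (x r / (x s * q ^ bump p j s)) (bump p j r)) =
     (qpoch q (x p / (x p * q ^ Suc (j p))) (Suc (j p)) * (\<Prod>s\<in>?I. qpoch q (x p / (x s * q ^ j s)) (Suc (j p)))) *
     ((\<Prod>r\<in>?I. qpoch q (x r / (x p * q ^ Suc (j p))) (j r)) * (\<Prod>r\<in>?I. E r))"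
    unfolding split E_def by (simp add: prod.distrib)
  have 2: "(\<Prod>r=1..n. \<Prod>s=1..n. qpoch q (x r / (x s * q ^ j s)) (j r)) =
     (qpoch q (x p / (x p * q ^ j p)) (j p) * (\<Prod>s\<in>?I. qpoch q (x p / (x s * q ^ j s)) (j p))) *
     ((\<Prod>r\<in>?I. qpoch q (x r / (x p * q ^ j p)) (j r)) * (\<Prod>r\<in>?I. E r))"
    unfolding split E_def by (simp add: prod.distrib)
  have 3: "qpoch q (x p / (x p * q ^ Suc (j p))) (Suc (j p)) =
      (1 - x p / (x p * q ^ Suc (j p))) * qpoch q (x p / (x p * q ^ j p)) (j p)"
    using xp by (simp add: qpoch_Suc_left)
  have 4: "(\<Prod>s\<in>?I. qpoch q (x p / (x s * q ^ j s)) (Suc (j p))) =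
     (\<Prod>s\<in>?I. qpoch q (x p / (x s * q ^ j s)) (j p)) * (\<Prod>s\<in>?I. 1 - x p * q ^ j p / (x s * q ^ j s))"
    by (simp add: qpoch_Suc prod.distrib)
  have 5: "(\<Prod>r\<in>?I. qpoch q (x r / (x p * q ^ Suc (j p))) (j r)) * (\<Prod>s\<in>?I. 1 - x s * q ^ j s / (x p * q ^ Suc (j p)))
     = (\<Prod>s\<in>?I. 1 - x s / (x p * q ^ Suc (j p))) * (\<Prod>r\<in>?I. qpoch q (x r / (x p * q ^ j p)) (j r))"
    unfolding prod.distrib [symmetric]
  proof (rule prod.cong[OF refl])
    fix r
    show "qpoch q (x r / (x p * q ^ Suc (j p))) (j r) * (1 - x r * q ^ j r / (x p * q ^ Suc (j p))) =
         (1 - x r / (x p * q ^ Suc (j p))) * qpoch q (x r / (x p * q ^ j p)) (j r)"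
      using qpoch_div_q[of "x r / (x p * q ^ j p)" "j r"] by (simp add: ac_simps)
  qed
  have 6: "(\<Prod>s=1..n. 1 - x s / (x p * q ^ Suc (j p))) = (1 - x p / (x p * q ^ Suc (j p))) * (\<Prod>s\<in>?I. 1 - x s / (x p * q ^ Suc (j p)))"
    by (rule split)
  show ?thesis unfolding 1 2 3 4 6 using 5 by algebra
qed

text \<open>A balance relation between a step up from \<open>j\<close> and the step back down from
  \<open>bump p j\<close>. The sign and the power of \<open>q\<close> in \<open>wt\<close> are
  chosen so that it holds without a correction factor.\<close>

lemma wt_bump:
  assumes x: "generic x" and p: "p \<in> {1..n}"
  shows "wt x a (bump p j) * lag x (\<lambda>_. 1) (bump p j) p = wt x a j * lag x a j p"
proof -
  let ?I = "{1..n} - {p}"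
  define zp where "zp = x p * q ^ Suc (j p)"
  have nz: "x s \<noteq> 0" if "s \<in> {1..n}" for s using generic_nz[OF x that] .
  have zp: "zp \<noteq> 0" using nz[OF p] by (simp add: zp_def)
  define N N' where "N = (\<Prod>r=1..n. \<Prod>s=1..n. qpoch q (a s * x r / x s) (j r))"
    and "N' = (\<Prod>r=1..n. \<Prod>s=1..n. qpoch q (a s * x r / x s) (bump p j r))"
  define D D' where "D = (\<Prod>r=1..n. \<Prod>s=1..n. qpoch q (x r / (x s * q ^ j s)) (j r))"
    and "D' = (\<Prod>r=1..n. \<Prod>s=1..n. qpoch q (x r / (x s * q ^ bump p j s)) (bump p j r))"
  define G where "G = (\<Prod>s=1..n. 1 - a s / x s * (x p * q ^ j p))"
  define V where "V = (\<Prod>s\<in>?I. 1 - x p * q ^ j p / (x s * q ^ j s))"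
  define V' where "V' = (\<Prod>s\<in>?I. 1 - x s * q ^ j s / zp)"
  define X where "X = (\<Prod>s=1..n. 1 - x s / zp)"
  define m where "m = mi_size n j"
  have gen: "(\<Prod>r=1..n. \<Prod>s=1..n. qpoch q (x r / (x s * q ^ k s)) (k r)) \<noteq> 0" for k
    using generic_qpoch_nz[OF x] by simp
  have D'0: "D' \<noteq> 0" and D0: "D \<noteq> 0"
    unfolding D_def D'_def by (rule gen)+
  have V0: "V \<noteq> 0" unfolding V_def using generic_shift_nz[OF x p] by auto
  have "1 - x s * q ^ j s / zp \<noteq> 0" if "s \<in> ?I" for s
    using generic_shift_nz[OF x _ p] that unfolding zp_def by blast
  then have V'0: "V' \<noteq> 0" unfolding V'_def
    by (metis (no_types, lifting) prod_zero_iff finite_Diff finite_atLeastAtMost)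
  have D: "D' * V' = D * V * X"
    unfolding D_def D'_def V_def V'_def X_def zp_def by (rule wt_denominator_bump[OF x p])
  have N: "N' = N * G"
  proof -
    have "N' = (\<Prod>s=1..n. qpoch q (a s * x p / x s) (Suc (j p))) * (\<Prod>r\<in>?I. \<Prod>s=1..n. qpoch q (a s * x r / x s) (j r))"
      unfolding N'_def by (rule prod_bump[OF p])
    moreover have "N = (\<Prod>s=1..n. qpoch q (a s * x p / x s) (j p)) * (\<Prod>r\<in>?I. \<Prod>s=1..n. qpoch q (a s * x r / x s) (j r))"
      unfolding N_def using p by (rule prod.remove[OF finite_atLeastAtMost])
    ultimately show ?thesis unfolding G_def by (simp add: qpoch_Suc prod.distrib mult.assoc)
  qed
  \<comment> \<open>The factors of \<open>lag x (\<lambda>_. 1) (bump p j) p\<close> are reversed by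
    \<open>1 - z = - z * (1 - 1 / z)\<close>. The monomials left over combine to
    \<open>- (q ^ Suc m)\<close>, the quotient of the prefactors of the two weights.\<close>
  have H1: "(\<Prod>s=1..n. 1 - 1 / x s * zp) = (\<Prod>s=1..n. - zp / x s) * X"
    unfolding X_def prod.distrib [symmetric] by (rule prod.cong) (use nz zp in \<open>auto simp: field_simps\<close>)
  have H2: "(\<Prod>s\<in>?I. 1 - zp / (x s * q ^ j s)) = (\<Prod>s\<in>?I. - zp / (x s * q ^ j s)) * V'"
    unfolding V'_def prod.distrib [symmetric] by (rule prod.cong) (use nz zp in \<open>auto simp: field_simps\<close>)
  have H3: "(\<Prod>s=1..n. - zp / x s) = - (q ^ Suc m) * (\<Prod>s\<in>?I. - zp / (x s * q ^ j s))"
  proof -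
    have "(\<Prod>s=1..n. - zp / x s) = (\<Prod>s=1..n. q ^ j s) * (\<Prod>s=1..n. - zp / (x s * q ^ j s))"
      unfolding prod.distrib [symmetric] by (rule prod.cong) auto
    also have "(\<Prod>s=1..n. - zp / (x s * q ^ j s)) = - q * (\<Prod>s\<in>?I. - zp / (x s * q ^ j s))"
      using p nz[OF p] by (simp add: prod.remove[of _ p] zp_def)
    also have "(\<Prod>s=1..n. q ^ j s) = q ^ m" by (simp add: m_def mi_size_def power_sum)
    finally show ?thesis by simp
  qed
  have M0: "(\<Prod>s\<in>?I. - zp / (x s * q ^ j s)) \<noteq> 0" using nz zp by auto
  have L': "lag x (\<lambda>_. 1) (bump p j) p = - (q ^ Suc m) * X / V'"
  proof -
    have "lag x (\<lambda>_. 1) (bump p j) p = (\<Prod>s=1..n. 1 - 1 / x s * zp) / (\<Prod>s\<in>?I. 1 - zp / (x s * q ^ j s))"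
      unfolding lag_def zp_def by (intro arg_cong2[where f="(/)"] prod.cong) auto
    then show ?thesis unfolding H1 H2 H3 using M0 V'0 by simp
  qed
  have L: "lag x a j p = G / V" by (simp add: lag_def G_def V_def)
  have C: "Suc (Suc m) choose 2 = Suc m + (Suc m choose 2)" by (simp add: numeral_2_eq_2)
  have W: "wt x a j = (-1) ^ m / q ^ (Suc m choose 2) * (N / D)"
    by (simp add: wt_def N_def D_def m_def)
  have W': "wt x a (bump p j) = (-1) ^ Suc m / q ^ (Suc (Suc m) choose 2) * (N' / D')"
    unfolding wt_def mi_size_bump[OF p] N'_def D'_def m_def by simp
  have "N' / D' * (X / V') = N / D * (G / V)"
  proof -
    have "N * G * X * (D * V) = N * G * (D' * V')" unfolding D by simp
    then show ?thesis using D'0 D0 V0 V'0 unfolding N by (simp add: frac_eq_eq ac_simps)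
  qed
  then have "(-1) ^ m / q ^ (Suc m choose 2) * (N' / D' * (X / V')) = (-1) ^ m / q ^ (Suc m choose 2) * (N / D * (G / V))" by simp
  then show ?thesis unfolding W W' L L' C by (simp add: power_add mult.assoc)
qed

definition level :: "nat \<Rightarrow> (nat \<Rightarrow> nat) set" where
  "level l = {k \<in> multi_indices n. mi_size n k = l}"

lemma le_mi_size: "r \<in> {1..n} \<Longrightarrow> k r \<le> mi_size n k"
  unfolding mi_size_def by (rule member_le_sum) auto

lemma finite_level: "finite (level l)"
proof (rule finite_subset)
  show "level l \<subseteq> (\<Pi>\<^sub>E r\<in>{1..n}. {..l})"
    using le_mi_size by (force simp: level_def multi_indices_def PiE_def Pi_def)
qed (auto intro: finite_PiE)

lemma bump_multi_index: "j \<in> multi_indices n \<Longrightarrow> p \<in> {1..n} \<Longrightarrow> bump p j \<in> multi_indices n"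
  by (auto simp: multi_indices_def PiE_def extensional_def)

lemma lag_one_eq_0: "generic x \<Longrightarrow> r \<in> {1..n} \<Longrightarrow> j r = 0 \<Longrightarrow> lag x (\<lambda>_. 1) j r = 0"
  using generic_nz[of x r] by (auto simp: lag_def prod_zero_iff intro!: bexI[of _ r])

text \<open>Both sides count steps from one level to the next, labelled by the lower end on the left
  and by the upper end on the right; \<open>wt_bump\<close> equates the summands. A pair with
  \<open>j r = 0\<close> on the right has no lower end, but there
  \<open>lag x (\<lambda>_. 1) j r\<close> vanishes. The freedom in \<open>F\<close> makes this the
  common source of all recursions below.\<close>

lemma level_step:
  assumes x: "generic x"
  shows "(\<Sum>j\<in>level l. wt x a j * (\<Sum>r=1..n. lag x a j r * F (bump r j) r)) =
    (\<Sum>j\<in>level (Suc l). wt x a j * (\<Sum>r=1..n. lag x (\<lambda>_. 1) j r * F j r))"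
proof -
  let ?S = "{(j, r). j \<in> level (Suc l) \<and> r \<in> {1..n} \<and> j r > 0}"
  have "(\<Sum>j\<in>level l. wt x a j * (\<Sum>r=1..n. lag x a j r * F (bump r j) r)) =
    (\<Sum>(j,r)\<in>level l \<times> {1..n}. wt x a (bump r j) * lag x (\<lambda>_. 1) (bump r j) r * F (bump r j) r)"
    unfolding sum.cartesian_product [symmetric] sum_distrib_left
    by (intro sum.cong refl) (simp add: wt_bump[OF x])
  also have "\<dots> = (\<Sum>(j,r)\<in>?S. wt x a j * lag x (\<lambda>_. 1) j r * F j r)"
  proof (rule sum.reindex_bij_witness[where i = "\<lambda>(j,r). (j(r := j r - 1), r)" and j = "\<lambda>(j,r). (bump r j, r)"])
    fix b assume "b \<in> ?S"
    then obtain j r where b: "b = (j,r)" "j \<in> level (Suc l)" "r \<in> {1..n}" "j r > 0" by auto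
    have "bump r (j(r := j r - 1)) = j" using b by auto
    then have "mi_size n (j(r := j r - 1)) = l"
      using mi_size_bump[OF b(3), of "j(r := j r - 1)"] b by (simp add: level_def)
    moreover have "j(r := j r - 1) \<in> multi_indices n" using b
      by (auto simp: level_def multi_indices_def PiE_def extensional_def)
    ultimately show "(case b of (j,r) \<Rightarrow> (j(r := j r - 1), r)) \<in> level l \<times> {1..n}"
      using b by (simp add: level_def)
    show "(case (case b of (j,r) \<Rightarrow> (j(r := j r - 1), r)) of (j,r) \<Rightarrow> (bump r j, r)) = b" using b by auto
  qed (auto simp: level_def bump_multi_index mi_size_bump)
  also have "\<dots> = (\<Sum>(j,r)\<in>level (Suc l) \<times> {1..n}. wt x a j * lag x (\<lambda>_. 1) j r * F j r)"
  proof (rule sum.mono_neutral_left, goal_cases)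
    case 3
    show ?case
    proof
      fix b assume "b \<in> level (Suc l) \<times> {1..n} - ?S"
      then obtain j r where b: "b = (j, r)" "r \<in> {1..n}" "j r = 0" by force
      show "(case b of (j, r) \<Rightarrow> wt x a j * lag x (\<lambda>_. 1) j r * F j r) = 0"
        using lag_one_eq_0[OF x b(2), of j] b(3) b(1) by simp
    qed
  qed (auto simp: finite_level)
  also have "\<dots> = (\<Sum>j\<in>level (Suc l). wt x a j * (\<Sum>r=1..n. lag x (\<lambda>_. 1) j r * F j r))"
    unfolding sum.cartesian_product [symmetric] sum_distrib_left by (intro sum.cong refl) (simp add: mult.assoc)
  finally show ?thesis .
qed

lemma sum_lag:
  assumes "generic x"
  shows "(\<Sum>r=1..n. lag x a j r) = 1 - (\<Prod>s=1..n. a s) * q ^ mi_size n j"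
proof -
  have "(\<Sum>r=1..n. lag x a j r) = 1 - (\<Prod>s=1..n. a s / x s) * (\<Prod>s=1..n. x s * q ^ j s)"
    unfolding lag_def by (rule lagrange_sum) (use generic_inj[OF assms] generic_nz[OF assms] in auto)
  also have "(\<Prod>s=1..n. a s / x s) * (\<Prod>s=1..n. x s * q ^ j s) = (\<Prod>s=1..n. a s * q ^ j s)"
    unfolding prod.distrib [symmetric] by (rule prod.cong) (use generic_nz[OF assms] in auto)
  finally show ?thesis by (simp add: prod.distrib mi_size_def power_sum)
qed

lemma level_0: "level 0 = {\<lambda>r\<in>{1..n}. 0}"
  by (auto simp: level_def multi_indices_def mi_size_def PiE_def extensional_def restrict_def fun_eq_iff)

lemma wt_0: "mi_size n j = 0 \<Longrightarrow> wt x a j = 1"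
  by (auto simp: wt_def mi_size_def numeral_2_eq_2)

text \<open>A multivariate extension of the coefficients of the q-binomial series. With
  \<open>F = 1\<close> in \<open>level_step\<close>, \<open>sum_lag\<close> closes both inner sums
  and gives the ratio of consecutive level sums.\<close>

lemma sum_wt_level:
  assumes x: "generic x"
  shows "(\<Sum>j\<in>level l. wt x a j) = qpoch q (\<Prod>s=1..n. a s) l / qpoch q q l"
proof (induction l)
  case 0
  show ?case by (simp add: level_0 wt_0 mi_size_def)
next
  case (Suc l)
  have "(1 - q ^ Suc l) * (\<Sum>j\<in>level (Suc l). wt x a j) = (\<Sum>j\<in>level (Suc l). wt x a j * (\<Sum>r=1..n. lag x (\<lambda>_. 1) j r * 1))"
    unfolding sum_distrib_left by (intro sum.cong refl) (simp add: level_def sum_lag[OF x, unfolded One_nat_def] flip: sum_distrib_left)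
  also have "\<dots> = (\<Sum>j\<in>level l. wt x a j * (\<Sum>r=1..n. lag x a j r * 1))"
    by (rule level_step[OF x, symmetric])
  also have "\<dots> = (1 - (\<Prod>s=1..n. a s) * q ^ l) * (\<Sum>j\<in>level l. wt x a j)"
    unfolding sum_distrib_left by (intro sum.cong refl) (simp add: level_def sum_lag[OF x, unfolded One_nat_def] flip: sum_distrib_left)
  finally have *: "(1 - q ^ Suc l) * (\<Sum>j\<in>level (Suc l). wt x a j) = (1 - (\<Prod>s=1..n. a s) * q ^ l) * (qpoch q (\<Prod>s=1..n. a s) l / qpoch q q l)"
    unfolding Suc .
  have "1 - q ^ Suc l \<noteq> 0" using q_power_eq_1[of "Suc l"] by auto
  then show ?case using * qpoch_q_nz[of l] by (simp add: qpoch_Suc field_simps)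
qed


text \<open>Index ranges \<open>{1..n}\<close> should survive simplification.\<close>

declare One_nat_def [simp del]

section \<open>Newton expansion of the node polynomial\<close>

text \<open>As parameters of \<open>wt\<close> these make the weight of \<open>j\<close> vanish
  unless \<open>j \<le> k\<close>.\<close>

definition qinv :: "(nat \<Rightarrow> nat) \<Rightarrow> nat \<Rightarrow> complex" where
  "qinv k s = 1 / q ^ k s"

definition node_poly :: "(nat \<Rightarrow> complex) \<Rightarrow> complex \<Rightarrow> (nat \<Rightarrow> nat) \<Rightarrow> complex \<Rightarrow> complex" where
  "node_poly x \<beta> k A = (\<Prod>r=1..n. \<Prod>i<k r. A - \<beta> * x r * q ^ i)"

text \<open>The value of \<open>node_poly x \<beta> k\<close> at \<open>A = 1\<close>.\<close>

definition node_qpoch :: "(nat \<Rightarrow> complex) \<Rightarrow> complex \<Rightarrow> (nat \<Rightarrow> nat) \<Rightarrow> complex" where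
  "node_qpoch x \<beta> k = (\<Prod>r=1..n. qpoch q (\<beta> * x r) (k r))"

lemma node_poly_bump:
  "p \<in> {1..n} \<Longrightarrow> node_poly x \<beta> (bump p k) A = node_poly x \<beta> k A * (A - \<beta> * x p * q ^ k p)"
  unfolding node_poly_def prod_bump[where f = "\<lambda>r m. \<Prod>i<m. A - \<beta> * x r * q ^ i"]
  by (simp add: prod.remove[of "{1..n}" p])

lemma node_qpoch_bump:
  "p \<in> {1..n} \<Longrightarrow> node_qpoch x \<beta> (bump p k) = node_qpoch x \<beta> k * (1 - \<beta> * x p * q ^ k p)"
  unfolding node_qpoch_def prod_bump[where f = "\<lambda>r m. qpoch q (\<beta> * x r) m"]
  by (simp add: prod.remove[of "{1..n}" p] qpoch_Suc)

lemma wt_qinv_eq_0: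
  assumes "generic x" "r \<in> {1..n}" "k r < j r"
  shows "wt x (qinv k) j = 0"
proof -
  have "qpoch q (qinv k r * x r / x r) (j r) = 0"
    using assms generic_nz[OF assms(1,2)] by (auto simp: qpoch_eq_0_iff qinv_def intro!: exI[of _ "k r"])
  then have "(\<Prod>s=1..n. qpoch q (qinv k s * x r / x s) (j r)) = 0"
    by (rule prod_zero[OF finite_atLeastAtMost bexI[OF _ assms(2)]])
  then have "(\<Prod>r=1..n. \<Prod>s=1..n. qpoch q (qinv k s * x r / x s) (j r)) = 0"
    by (rule prod_zero[OF finite_atLeastAtMost bexI[OF _ assms(2)]])
  then show ?thesis by (simp add: wt_def)
qed

lemma wt_qinv_eq_0_size:
  assumes "generic x" "mi_size n k < mi_size n j"
  shows "wt x (qinv k) j = 0"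
proof -
  have "\<exists>r\<in>{1..n}. k r < j r"
    using assms(2) unfolding mi_size_def by (meson linorder_not_le sum_mono)
  then show ?thesis using wt_qinv_eq_0[OF assms(1)] by blast
qed

text \<open>The coefficient of \<open>q ^ m * qpoch q A m\<close> in
  \<open>node_poly x \<beta> k A / node_qpoch x \<beta> k\<close>. For \<open>n = 1\<close> that
  expansion is the q-Chu-Vandermonde sum of a 2-phi-1 with argument \<open>q\<close>.\<close>

definition newton_coeff :: "(nat \<Rightarrow> complex) \<Rightarrow> complex \<Rightarrow> (nat \<Rightarrow> nat) \<Rightarrow> nat \<Rightarrow> complex" where
  "newton_coeff x \<beta> k m = (\<Sum>j\<in>level m. wt x (qinv k) j / node_qpoch x \<beta> j)"

lemma newton_coeff_eq_0: "generic x \<Longrightarrow> mi_size n k < m \<Longrightarrow> newton_coeff x \<beta> k m = 0"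
  by (auto simp: newton_coeff_def level_def wt_qinv_eq_0_size intro!: sum.neutral)

lemma newton_coeff_0: "newton_coeff x \<beta> k 0 = 1"
  by (simp add: newton_coeff_def level_0 wt_0 mi_size_def node_qpoch_def)

lemma sum_shifted_lag:
  fixes x j
  assumes x: "generic x" and w: "w \<noteq> 0"
  defines "z \<equiv> \<lambda>s. x s * q ^ j s"
  shows "(\<Sum>r=1..n. lag x (\<lambda>_. 1) j r * ((\<Prod>s\<in>{1..n}-{r}. 1 - w * z s) * (1 - \<beta> / q * z r))) =
    (\<Prod>s=1..n. 1 - w * z s) * (1 - \<beta> / (q * w) * q ^ mi_size n j)
    - (1 - \<beta> / (q * w)) * q ^ mi_size n j * (\<Prod>s=1..n. 1 - w * x s)"
proof -
  \<comment> \<open>The index 0 lies outside \<open>{1..n}\<close> and carries the one extra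
    coefficient that \<open>lagrange_shifted\<close> asks for.\<close>
  define c where "c s = (if s = 0 then \<beta> / q else 1 / x s)" for s :: nat
  have pr: "(\<Prod>s\<in>{0..n}. f s) = f 0 * (\<Prod>s=1..n. f s)" for f :: "nat \<Rightarrow> complex"
    by (simp add: prod.atLeast_Suc_atMost One_nat_def)
  have z: "z s \<noteq> 0" if "s \<in> {1..n}" for s using generic_nz[OF x that] by (simp add: z_def)
  have "(\<Sum>r=1..n. lag x (\<lambda>_. 1) j r * ((\<Prod>s\<in>{1..n}-{r}. 1 - w * z s) * (1 - \<beta> / q * z r))) =
    (\<Sum>r=1..n. (\<Prod>s\<in>{0..n}. 1 - c s * z r) * (\<Prod>s\<in>{1..n}-{r}. 1 - w * z s) / (\<Prod>s\<in>{1..n}-{r}. 1 - z r / z s))"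
    unfolding pr lag_def z_def by (intro sum.cong refl) (simp add: c_def)
  also have "\<dots> = (\<Prod>s\<in>{1..n}. 1 - w * z s) * (1 - (\<Prod>s\<in>{0..n}. c s) * (\<Prod>s\<in>{1..n}. z s) / w)
      - (\<Prod>s\<in>{0..n}. 1 - c s / w) * (\<Prod>s\<in>{1..n}. - (w * z s))"
    by (rule lagrange_shifted) (use z w generic_inj[OF x] in \<open>auto simp: z_def\<close>)
  also have "(\<Prod>s\<in>{0..n}. c s) * (\<Prod>s\<in>{1..n}. z s) = \<beta> / q * (\<Prod>s=1..n. 1 / x s * z s)"
    unfolding pr prod.distrib by (simp add: c_def)
  also have "(\<Prod>s=1..n. 1 / x s * z s) = (\<Prod>s=1..n. q ^ j s)"
    by (rule prod.cong) (use generic_nz[OF x] in \<open>auto simp: z_def\<close>)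
  also have "\<dots> = q ^ mi_size n j" by (simp add: mi_size_def power_sum)
  also have "(\<Prod>s\<in>{0..n}. 1 - c s / w) * (\<Prod>s\<in>{1..n}. - (w * z s)) =
     (1 - \<beta> / (q * w)) * (\<Prod>s=1..n. (1 - 1 / (x s * w)) * - (w * z s))"
    unfolding pr prod.distrib by (simp add: c_def)
  also have "(\<Prod>s=1..n. (1 - 1 / (x s * w)) * - (w * z s)) = (\<Prod>s=1..n. q ^ j s * (1 - w * x s))"
    by (rule prod.cong) (use generic_nz[OF x] w in \<open>auto simp: z_def field_simps\<close>)
  also have "\<dots> = q ^ mi_size n j * (\<Prod>s=1..n. 1 - w * x s)"
    by (simp add: mi_size_def power_sum prod.distrib)
  finally show ?thesis by (simp add: mult.assoc)
qed

text \<open>The level step is applied to the weight of \<open>bump p k\<close>, because the weight of \<open>k\<close> is obtained from it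
  by multiplication with a polynomial, whereas the quotient in the other direction may have a zero
  denominator at \<open>j p = k p + 1\<close>.\<close>

lemma newton_coeff_rec:
  fixes k :: "nat \<Rightarrow> nat"
  assumes x: "generic x" and p: "p \<in> {1..n}"
    and nz: "\<And>j. node_qpoch x \<beta> j \<noteq> 0"
  defines "g \<equiv> \<beta> * x p * q ^ k p"
  shows "newton_coeff x \<beta> k l = (1 - g * q ^ Suc l) * newton_coeff x \<beta> k (Suc l)
    - (1 - g) * q ^ Suc l * newton_coeff x \<beta> (bump p k) (Suc l)"
proof -
  \<comment> \<open>\<open>w\<close> equals \<open>qinv (bump p k) p / x p\<close>, so
    \<open>1 - w * z\<close> is the factor that belongs to \<open>p\<close> in the interpolation
    summands for \<open>bump p k\<close>.\<close>
  define w where "w = 1 / (x p * q ^ Suc (k p))"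
  have xp: "x p \<noteq> 0" using generic_nz[OF x p] .
  have w: "w \<noteq> 0" using xp by (simp add: w_def)
  have g: "\<beta> / (q * w) = g" by (simp add: g_def w_def)
  define C where "C = (\<Prod>s=1..n. 1 - w * x s)"
  \<comment> \<open>The parameter 0 removes the factor for \<open>p\<close> and makes the product of
    all parameters vanish, so that \<open>sum_lag\<close> yields 1.\<close>
  define a where "a = (qinv k)(p := 0)"
  define Q where "Q j = (\<Prod>s=1..n. 1 - w * (x s * q ^ j s))" for j
  \<comment> \<open>\<open>F\<close> is fitted to \<open>level_step\<close>: on a step up, its
    factor with \<open>\<beta> / q\<close> cancels the factor gained by \<open>node_qpoch\<close>,
    while the product over \<open>s\<close> supplies all of \<open>Q j\<close> except the factor
    contained in \<open>lag\<close>.\<close>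
  define F where "F j r = (\<Prod>s\<in>{1..n}-{r}. 1 - w * (x s * q ^ j s)) * (1 - \<beta> / q * (x r * q ^ j r)) / node_qpoch x \<beta> j" for j r
  have "1 - w * x s \<noteq> 0" if s: "s \<in> {1..n}" for s
  proof (cases "s = p")
    case True then show ?thesis using xp q_power_eq_1[of "Suc (k p)"] by (auto simp: w_def field_simps)
  next
    case False
    then show ?thesis using generic_shift_nz[OF x s p False, of 0 "Suc (k p)"] by (simp add: w_def field_simps)
  qed
  then have C: "C \<noteq> 0" unfolding C_def by (metis (no_types, lifting) prod_zero_iff finite_atLeastAtMost)
  have sw: "a' * R' * u = a * R * v" if "a' * u = a * v" "R' = R" for a' R' u a R v :: complex
    using that by (metis mult.assoc mult.commute)
  have wt: "wt x (qinv (bump p k)) j * Q j = wt x (qinv k) j * C" for j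
  proof -
    have num: "(\<Prod>s=1..n. qpoch q (qinv (bump p k) s * x r / x s) (j r)) * (1 - w * (x r * q ^ j r)) =
       (\<Prod>s=1..n. qpoch q (qinv k s * x r / x s) (j r)) * (1 - w * x r)" for r
    proof -
      have "qpoch q (qinv (bump p k) p * x r / x p) (j r) * (1 - w * (x r * q ^ j r)) =
         qpoch q (qinv k p * x r / x p) (j r) * (1 - w * x r)"
        using qpoch_div_q[of "qinv k p * x r / x p" "j r"] by (simp add: qinv_def w_def ac_simps)
      moreover have "(\<Prod>s\<in>{1..n}-{p}. qpoch q (qinv (bump p k) s * x r / x s) (j r)) =
         (\<Prod>s\<in>{1..n}-{p}. qpoch q (qinv k s * x r / x s) (j r))"
        by (rule prod.cong) (auto simp: qinv_def)
      ultimately show ?thesis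
        unfolding prod.remove[OF finite_atLeastAtMost p, where g = "\<lambda>s. qpoch q (qinv k s * x r / x s) (j r)"]
          prod.remove[OF finite_atLeastAtMost p, where g = "\<lambda>s. qpoch q (qinv (bump p k) s * x r / x s) (j r)"]
        by (intro sw)
    qed
    have "(\<Prod>r=1..n. \<Prod>s=1..n. qpoch q (qinv (bump p k) s * x r / x s) (j r)) * Q j =
      (\<Prod>r=1..n. \<Prod>s=1..n. qpoch q (qinv k s * x r / x s) (j r)) * C"
      unfolding Q_def C_def prod.distrib [symmetric] by (rule prod.cong[OF refl]) (rule num)
    then show ?thesis unfolding wt_def times_divide_eq_right times_divide_eq_left mult.assoc by simp
  qed
  have F1: "lag x (qinv (bump p k)) j r * F (bump r j) r = lag x a j r * Q j / node_qpoch x \<beta> j"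
    if r: "r \<in> {1..n}" for j r
  proof -
    have b: "node_qpoch x \<beta> (bump r j) = node_qpoch x \<beta> j * (1 - \<beta> * (x r * q ^ j r))"
      using node_qpoch_bump[OF r] by (simp add: mult.assoc)
    have b0: "1 - \<beta> * (x r * q ^ j r) \<noteq> 0" using nz[of "bump r j"] unfolding b by auto
    have "(\<Prod>s\<in>{1..n}-{r}. 1 - w * (x s * q ^ bump r j s)) = (\<Prod>s\<in>{1..n}-{r}. 1 - w * (x s * q ^ j s))"
      by (rule prod.cong) auto
    then have F: "F (bump r j) r = (\<Prod>s\<in>{1..n}-{r}. 1 - w * (x s * q ^ j s)) / node_qpoch x \<beta> j"
      unfolding F_def b using b0 by (simp add: mult.assoc)
    have "(\<Prod>s=1..n. 1 - qinv (bump p k) s / x s * (x r * q ^ j r)) = (1 - w * (x r * q ^ j r)) * (\<Prod>s=1..n. 1 - a s / x s * (x r * q ^ j r))"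
      unfolding prod.remove[OF finite_atLeastAtMost p]
      by (simp add: a_def qinv_def w_def)
    then have "lag x (qinv (bump p k)) j r = (1 - w * (x r * q ^ j r)) * lag x a j r"
      by (simp add: lag_def)
    then show ?thesis unfolding F Q_def prod.remove[OF finite_atLeastAtMost r] by simp
  qed
  have a0: "(\<Prod>s=1..n. a s) = 0" using p by (auto simp: a_def intro!: prod_zero)
  have eL: "(\<Sum>j\<in>level l. wt x (qinv (bump p k)) j * (\<Sum>r=1..n. lag x (qinv (bump p k)) j r * F (bump r j) r)) = C * newton_coeff x \<beta> k l"
    unfolding newton_coeff_def sum_distrib_left[where r = C]
  proof (intro sum.cong refl)
    fix j
    have "(\<Sum>r=1..n. lag x (qinv (bump p k)) j r * F (bump r j) r) = (\<Sum>r=1..n. lag x a j r) * (Q j / node_qpoch x \<beta> j)"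
      unfolding sum_distrib_right by (rule sum.cong) (use F1 in auto)
    also have "\<dots> = Q j / node_qpoch x \<beta> j" unfolding sum_lag[OF x] a0 by simp
    finally show "wt x (qinv (bump p k)) j * (\<Sum>r=1..n. lag x (qinv (bump p k)) j r * F (bump r j) r) = C * (wt x (qinv k) j / node_qpoch x \<beta> j)"
      using wt[of j] by simp
  qed
  define R where "R j = (\<Sum>r=1..n. lag x (\<lambda>_. 1) j r * F j r)" for j
  have eR: "(\<Sum>j\<in>level (Suc l). wt x (qinv (bump p k)) j * R j) =
     C * ((1 - g * q ^ Suc l) * newton_coeff x \<beta> k (Suc l)
    - (1 - g) * q ^ Suc l * newton_coeff x \<beta> (bump p k) (Suc l))"
    unfolding newton_coeff_def sum_distrib_left sum_subtractf [symmetric]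
  proof (intro sum.cong refl)
    fix j assume j: "j \<in> level (Suc l)"
    have "R j = (\<Sum>r=1..n. lag x (\<lambda>_. 1) j r * ((\<Prod>s\<in>{1..n}-{r}. 1 - w * (x s * q ^ j s)) * (1 - \<beta> / q * (x r * q ^ j r)))) / node_qpoch x \<beta> j"
      unfolding sum_divide_distrib F_def R_def by simp
    also have "\<dots> = (Q j * (1 - g * q ^ Suc l) - (1 - g) * q ^ Suc l * C) / node_qpoch x \<beta> j"
      unfolding sum_shifted_lag[OF x w] g using j by (simp add: Q_def C_def level_def)
    finally have "wt x (qinv (bump p k)) j * R j =
       (wt x (qinv (bump p k)) j * Q j * (1 - g * q ^ Suc l) - wt x (qinv (bump p k)) j * (1 - g) * q ^ Suc l * C) / node_qpoch x \<beta> j"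
      by (simp add: algebra_simps)
    then show "wt x (qinv (bump p k)) j * R j =
      C * ((1 - g * q ^ Suc l) * (wt x (qinv k) j / node_qpoch x \<beta> j) - (1 - g) * q ^ Suc l * (wt x (qinv (bump p k)) j / node_qpoch x \<beta> j))"
      unfolding wt by (simp add: diff_divide_distrib add_divide_distrib algebra_simps)
  qed
  have CC: "C * newton_coeff x \<beta> k l = C * ((1 - g * q ^ Suc l) * newton_coeff x \<beta> k (Suc l)
    - (1 - g) * q ^ Suc l * newton_coeff x \<beta> (bump p k) (Suc l))"
    unfolding eL [symmetric] eR [symmetric] R_def by (rule level_step[OF x])
  show ?thesis by (rule mult_left_cancel[OF C, THEN iffD1]) (rule CC)
qed

text \<open>Raising \<open>k p\<close> multiplies the polynomial by \<open>A - g\<close>, and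
  \<open>(A - g) * q ^ m * qpoch q A m = (1 - g * q ^ m) * qpoch q A m - qpoch q A (Suc m)\<close>.
  Comparing coefficients of \<open>qpoch q A (Suc m)\<close> gives exactly
  \<open>newton_coeff_rec\<close>.\<close>

lemma newton_expansion:
  assumes x: "generic x" and nz: "\<And>j. node_qpoch x \<beta> j \<noteq> 0" and M: "mi_size n k \<le> M"
  shows "node_poly x \<beta> k A = node_qpoch x \<beta> k * (\<Sum>m\<le>M. newton_coeff x \<beta> k m * q ^ m * qpoch q A m)"
proof -
  have ext: "(\<Sum>m\<le>M. newton_coeff x \<beta> k m * q ^ m * qpoch q A m) = (\<Sum>m\<le>mi_size n k. newton_coeff x \<beta> k m * q ^ m * qpoch q A m)"
    if "mi_size n k \<le> M" for k M
    by (rule sum.mono_neutral_right) (use that newton_coeff_eq_0[OF x] in auto)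
  have "node_poly x \<beta> k A = node_qpoch x \<beta> k * (\<Sum>m\<le>N. newton_coeff x \<beta> k m * q ^ m * qpoch q A m)"
    if "mi_size n k = N" for N
    using that
  proof (induction N arbitrary: k)
    case 0
    then have "\<And>r. r \<in> {1..n} \<Longrightarrow> k r = 0" by (auto simp: mi_size_def)
    then show ?case by (simp add: node_poly_def node_qpoch_def newton_coeff_0)
  next
    case (Suc N)
    have "\<exists>p\<in>{1..n}. k p > 0"
    proof (rule ccontr)
      assume "\<not> ?thesis"
      then have "mi_size n k = 0" by (auto simp: mi_size_def)
      then show False using Suc.prems by simp
    qed
    then obtain p where p: "p \<in> {1..n}" "k p > 0" by blast
    define k0 where "k0 = k(p := k p - 1)"
    have k: "k = bump p k0" using p by (auto simp: k0_def)
    then have N: "mi_size n k0 = N" by (metis Suc.prems mi_size_bump[OF p(1)] nat.inject)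
    define g where "g = \<beta> * x p * q ^ k0 p"
    define S where "S = (\<Sum>m\<le>N. newton_coeff x \<beta> k0 m * q ^ m * qpoch q A m)"
    let ?u = "newton_coeff x \<beta> k0"
    have "(1 - g) * (\<Sum>m\<le>Suc N. newton_coeff x \<beta> k m * q ^ m * qpoch q A m) =
       (1 - g) + (\<Sum>m\<le>N. qpoch q A (Suc m) * ((1 - g) * q ^ Suc m * newton_coeff x \<beta> (bump p k0) (Suc m)))"
      unfolding sum.atMost_Suc_shift newton_coeff_0 distrib_left sum_distrib_left k [symmetric]
      by (simp add: algebra_simps newton_coeff_0)
    also have "\<dots> = (1 - g) + (\<Sum>m\<le>N. qpoch q A (Suc m) * ((1 - g * q ^ Suc m) * ?u (Suc m) - ?u m))"
      using newton_coeff_rec[OF x p(1) nz, of k0, folded g_def]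
      by (intro arg_cong2[where f = "(+)"] sum.cong refl arg_cong2[where f = "(*)"]) (simp add: algebra_simps)
    also have "\<dots> = (\<Sum>m\<le>Suc N. qpoch q A m * ((1 - g * q ^ m) * ?u m)) - (\<Sum>m\<le>N. qpoch q A (Suc m) * ?u m)"
      unfolding sum.atMost_Suc_shift by (simp add: newton_coeff_0 right_diff_distrib sum_subtractf)
    also have "(\<Sum>m\<le>Suc N. qpoch q A m * ((1 - g * q ^ m) * ?u m)) = (\<Sum>m\<le>N. qpoch q A m * ((1 - g * q ^ m) * ?u m))"
      using newton_coeff_eq_0[OF x] N by simp
    also have "\<dots> - (\<Sum>m\<le>N. qpoch q A (Suc m) * ?u m) = (A - g) * S"
      unfolding S_def sum_distrib_left sum_subtractf [symmetric]
      by (intro sum.cong refl) (simp add: qpoch_Suc algebra_simps)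
    finally have *: "(1 - g) * (\<Sum>m\<le>Suc N. newton_coeff x \<beta> k m * q ^ m * qpoch q A m) = (A - g) * S" .
    have "node_poly x \<beta> k A = node_qpoch x \<beta> k0 * S * (A - g)"
      unfolding k node_poly_bump[OF p(1)] g_def S_def Suc.IH[OF N] by simp
    also have "\<dots> = node_qpoch x \<beta> k0 * ((1 - g) * (\<Sum>m\<le>Suc N. newton_coeff x \<beta> k m * q ^ m * qpoch q A m))"
      unfolding * by simp
    also have "\<dots> = node_qpoch x \<beta> k * (\<Sum>m\<le>Suc N. newton_coeff x \<beta> k m * q ^ m * qpoch q A m)"
      unfolding k node_qpoch_bump[OF p(1)] g_def by simp
    finally show ?case .
  qed
  then show ?thesis unfolding ext[OF M] by simp
qed

end

section \<open>The transformation of the inner sum\<close>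

text \<open>Stands in for the identity theorem for polynomials in \<open>A\<close>: arguments may
  divide by \<open>A\<close> or by factors with finitely many zeros.\<close>

lemma eq_if_eq_off_finite:
  fixes f g :: "complex \<Rightarrow> complex"
  assumes "continuous_on UNIV f" "continuous_on UNIV g" "finite B" "\<And>A. A \<notin> B \<Longrightarrow> f A = g A"
  shows "f A = g A"
proof -
  have "closed {A. f A = g A}" using assms(1,2) by (rule closed_Collect_eq)
  moreover have "- B \<subseteq> {A. f A = g A}" using assms(4) by auto
  moreover have "closure (- B) = UNIV"
    using assms(3) by (simp add: closure_complement empty_interior_finite)
  ultimately have "UNIV \<subseteq> {A. f A = g A}" by (metis closure_minimal)
  then show ?thesis by auto
qed

context q_base
begin

lemma continuous_node_poly [continuous_intros]:
  "continuous_on S f \<Longrightarrow> continuous_on S (\<lambda>A. node_poly x \<beta> k (f A))"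
  unfolding node_poly_def by (intro continuous_intros)

lemma continuous_qpoch [continuous_intros]:
  "continuous_on S f \<Longrightarrow> continuous_on S (\<lambda>A. qpoch q (f A) m)"
  unfolding qpoch_def by (intro continuous_intros)

section \<open>The q-derivatives of the node polynomial\<close>

text \<open>Inverses of the end points \<open>x r * q ^ k r\<close>. Seen from there, lowering
  \<open>k\<close> is raising \<open>j\<close>: for \<open>j \<le> k\<close>,
  \<open>dual x k r * q ^ j r\<close> is the dual point that belongs to
  \<open>k - j\<close>.\<close>

definition dual :: "(nat \<Rightarrow> complex) \<Rightarrow> (nat \<Rightarrow> nat) \<Rightarrow> nat \<Rightarrow> complex" where
  "dual x k r = 1 / (x r * q ^ k r)"

lemma generic_dual: "generic x \<Longrightarrow> generic (dual x k)"
  unfolding dual_def[abs_def] by (rule generic_inverse)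

text \<open>This is \<open>lag (dual x k) (qinv k)\<close> at the index 0, in a form that can also
  be read for \<open>k - j\<close>.\<close>

definition dual_coeff :: "(nat \<Rightarrow> complex) \<Rightarrow> (nat \<Rightarrow> nat) \<Rightarrow> nat \<Rightarrow> complex" where
  "dual_coeff x k r = (\<Prod>s=1..n. 1 - x s * dual x k r) / (\<Prod>s\<in>{1..n}-{r}. 1 - dual x k r / dual x k s)"

lemma lag_dual:
  assumes "generic x" "\<And>s. s \<in> {1..n} \<Longrightarrow> j s \<le> k s" and r: "r \<in> {1..n}"
  shows "lag (dual x k) (qinv k) j r = dual_coeff x (\<lambda>s. k s - j s) r"
proof -
  have 1: "dual x k s * q ^ j s = dual x (\<lambda>s. k s - j s) s" if "s \<in> {1..n}" for s
    using assms(2)[OF that] generic_nz[OF assms(1) that] by (simp add: dual_def power_diff)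
  have 2: "qinv k s / dual x k s = x s" for s by (simp add: qinv_def dual_def)
  show ?thesis unfolding lag_def dual_coeff_def 2 1[OF r]
    by (intro arg_cong2[where f = "(/)"] prod.cong refl) (use 1 in auto)
qed

lemma dual_coeff_eq_0:
  assumes "generic x" and r: "r \<in> {1..n}" "k r = 0"
  shows "dual_coeff x k r = 0"
proof -
  have "1 - x r * dual x k r = 0" using generic_nz[OF assms(1) r(1)] r by (simp add: dual_def)
  then have "(\<Prod>s=1..n. 1 - x s * dual x k r) = 0"
    by (rule prod_zero[OF finite_atLeastAtMost bexI[OF _ r(1)]])
  then show ?thesis by (simp add: dual_coeff_def)
qed

text \<open>Passing from \<open>A\<close> to \<open>q * A\<close> shifts each run of zeros by one
  step, so only the two ends of every run change.\<close>

lemma node_poly_q_mult: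
  "node_poly x \<beta> k (q * A) * (\<Prod>r=1..n. A - \<beta> * x r * q ^ k r / q) =
    q ^ mi_size n k * node_poly x \<beta> k A * (\<Prod>r=1..n. A - \<beta> * x r / q)"
proof -
  have "(\<Prod>i<m. q * A - u * q ^ i) * (A - u * q ^ m / q) = q ^ m * (\<Prod>i<m. A - u * q ^ i) * (A - u / q)" for m u
  proof (induction m)
    case (Suc m)
    have "(\<Prod>i<Suc m. q * A - u * q ^ i) * (A - u * q ^ Suc m / q) =
       q * (A - u * q ^ m) * ((\<Prod>i<m. q * A - u * q ^ i) * (A - u * q ^ m / q))"
      by (simp add: field_simps)
    also have "\<dots> = q ^ Suc m * (\<Prod>i<Suc m. A - u * q ^ i) * (A - u / q)" unfolding Suc by simp
    finally show ?case .
  qed simp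
  then show ?thesis
    unfolding node_poly_def mi_size_def power_sum prod.distrib [symmetric] by (intro prod.cong refl) blast
qed

lemma sum_dual_coeff_shifted:
  assumes x: "generic x" and w: "w \<noteq> 0"
  shows "(\<Sum>r=1..n. dual_coeff x k r * (\<Prod>s\<in>{1..n}-{r}. 1 - w * dual x k s)) =
    (\<Prod>s=1..n. 1 - w * dual x k s) - (\<Prod>s=1..n. (x s - w) * dual x k s)"
proof -
  let ?z = "dual x k"
  define c where "c s = (if s = 0 then 0 else x s)" for s :: nat
  have pr: "(\<Prod>s\<in>{0..n}. f s) = f 0 * (\<Prod>s=1..n. f s)" for f :: "nat \<Rightarrow> complex"
    by (simp add: prod.atLeast_Suc_atMost One_nat_def)
  have z: "?z s \<noteq> 0" if "s \<in> {1..n}" for s using generic_nz[OF generic_dual[OF x] that] .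
  have "(\<Sum>r=1..n. dual_coeff x k r * (\<Prod>s\<in>{1..n}-{r}. 1 - w * ?z s)) =
    (\<Sum>r=1..n. (\<Prod>s\<in>{0..n}. 1 - c s * ?z r) * (\<Prod>s\<in>{1..n}-{r}. 1 - w * ?z s) / (\<Prod>s\<in>{1..n}-{r}. 1 - ?z r / ?z s))"
    unfolding pr dual_coeff_def by (intro sum.cong refl) (simp add: c_def)
  also have "\<dots> = (\<Prod>s\<in>{1..n}. 1 - w * ?z s) * (1 - (\<Prod>s\<in>{0..n}. c s) * (\<Prod>s\<in>{1..n}. ?z s) / w)
      - (\<Prod>s\<in>{0..n}. 1 - c s / w) * (\<Prod>s\<in>{1..n}. - (w * ?z s))"
    by (rule lagrange_shifted) (use z w generic_inj[OF generic_dual[OF x, of k], of "\<lambda>_. 0"] in auto)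
  also have "(\<Prod>s\<in>{0..n}. c s) = 0" unfolding pr by (simp add: c_def)
  also have "(\<Prod>s\<in>{0..n}. 1 - c s / w) * (\<Prod>s\<in>{1..n}. - (w * ?z s)) = (\<Prod>s=1..n. (1 - x s / w) * - (w * ?z s))"
    unfolding pr prod.distrib by (simp add: c_def)
  also have "(\<Prod>s=1..n. (1 - x s / w) * - (w * ?z s)) = (\<Prod>s=1..n. (x s - w) * ?z s)"
    by (rule prod.cong) (use w in \<open>auto simp: field_simps\<close>)
  finally show ?thesis by simp
qed

lemma sum_dual_coeff:
  assumes x: "generic x"
  shows "(\<Sum>r=1..n. dual_coeff x k r) = 1 - 1 / q ^ mi_size n k"
proof -
  have "(\<Sum>r=1..n. dual_coeff x k r) = 1 - (\<Prod>s=1..n. x s) * (\<Prod>s=1..n. dual x k s)"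
    unfolding dual_coeff_def
    by (rule lagrange_sum) (use generic_inj[OF generic_dual[OF x, of k], of "\<lambda>_. 0"] generic_nz[OF generic_dual[OF x]] in auto)
  also have "(\<Prod>s=1..n. x s) * (\<Prod>s=1..n. dual x k s) = (\<Prod>s=1..n. 1 / q ^ k s)"
    unfolding prod.distrib [symmetric] by (rule prod.cong) (use generic_nz[OF x] in \<open>auto simp: dual_def\<close>)
  finally show ?thesis by (simp add: prod_dividef mi_size_def power_sum)
qed

text \<open>After division by \<open>node_poly x \<beta> k A\<close> this is a partial fraction
  decomposition in \<open>A\<close>: the quotient of the values at \<open>q * A\<close> and
  \<open>A\<close> has its poles at the last zero \<open>\<beta> * x r * q ^ k r / q\<close> of each
  run, and lowering \<open>k r\<close> removes that zero.\<close>

lemma node_poly_qdiff: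
  assumes x: "generic x" and \<beta>: "\<beta> \<noteq> 0"
  shows "node_poly x \<beta> k A - node_poly x \<beta> k (q * A) =
    - A * q ^ mi_size n k * (\<Sum>r=1..n. dual_coeff x k r * node_poly x \<beta> (k(r := k r - 1)) A)"
proof (rule eq_if_eq_off_finite[where B = "insert 0 ((\<lambda>r. \<beta> * x r * q ^ k r / q) ` {1..n})" and A = A], goal_cases)
  case (4 A)
  then have A: "A \<noteq> 0" and Ax: "\<And>r. r \<in> {1..n} \<Longrightarrow> A \<noteq> \<beta> * x r * q ^ k r / q" by auto
  \<comment> \<open>With this choice \<open>1 - w * dual x k r\<close> vanishes exactly at the pole
    for \<open>r\<close>, and \<open>Q\<close> and \<open>R\<close> are the two end products of
    \<open>node_poly_q_mult\<close> up to the common monomial \<open>B\<close>.\<close>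
  define w where "w = q * A / \<beta>"
  have w: "w \<noteq> 0" using A \<beta> by (simp add: w_def)
  let ?z = "dual x k"
  define P where "P = node_poly x \<beta> k A"
  define Q where "Q = (\<Prod>s=1..n. 1 - w * ?z s)"
  define R where "R = (\<Prod>s=1..n. (x s - w) * ?z s)"
  have nz: "\<And>r. r \<in> {1..n} \<Longrightarrow> x r \<noteq> 0" using generic_nz[OF x] .
  have wz: "1 - w * ?z r \<noteq> 0" if "r \<in> {1..n}" for r
    using Ax[OF that] nz[OF that] \<beta> by (auto simp: w_def dual_def field_simps)
  then have Q: "Q \<noteq> 0" unfolding Q_def by (metis (no_types, lifting) prod_zero_iff finite_atLeastAtMost)
  have each: "dual_coeff x k r * node_poly x \<beta> (k(r := k r - 1)) A * A =
      P * (dual_coeff x k r - dual_coeff x k r * (\<Prod>s\<in>{1..n}-{r}. 1 - w * ?z s) / Q)" if r: "r \<in> {1..n}" for r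
  proof (cases "k r = 0")
    case True
    then show ?thesis using dual_coeff_eq_0[OF x r] by simp
  next
    case False
    then have k: "k = bump r (k(r := k r - 1))" by auto
    define N where "N = node_poly x \<beta> (k(r := k r - 1)) A"
    have "P = N * (A - \<beta> * x r * q ^ (k r - 1))"
      unfolding P_def by (subst k, subst node_poly_bump[OF r]) (simp add: N_def)
    also have "A - \<beta> * x r * q ^ (k r - 1) = A * (1 - 1 / (w * ?z r))"
      using False A \<beta> nz[OF r] by (simp add: w_def dual_def power_diff field_simps)
    finally have P: "P = N * (A * (1 - 1 / (w * ?z r)))" .
    have z: "?z r \<noteq> 0" using generic_nz[OF generic_dual[OF x] r] .
    have "(\<Prod>s\<in>{1..n}-{r}. 1 - w * ?z s) / Q = 1 / (1 - w * ?z r)"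
      using wz[OF r] Q unfolding Q_def prod.remove[OF finite_atLeastAtMost r] by simp
    then have "P * (dual_coeff x k r - dual_coeff x k r * (\<Prod>s\<in>{1..n}-{r}. 1 - w * ?z s) / Q) =
      P * dual_coeff x k r * (1 - 1 / (1 - w * ?z r))" by (simp add: algebra_simps times_divide_eq_right [symmetric] del: times_divide_eq_right)
    also have "\<dots> = N * A * dual_coeff x k r * ((1 - 1 / (w * ?z r)) * (1 - 1 / (1 - w * ?z r)))"
      unfolding P by simp
    also have "(1 - 1 / (w * ?z r)) * (1 - 1 / (1 - w * ?z r)) = 1"
      using wz[OF r] w z by (simp add: field_simps)
    finally show ?thesis unfolding N_def by simp
  qed
  have "(\<Sum>r=1..n. dual_coeff x k r * node_poly x \<beta> (k(r := k r - 1)) A) * A =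
     P * ((\<Sum>r=1..n. dual_coeff x k r) - (\<Sum>r=1..n. dual_coeff x k r * (\<Prod>s\<in>{1..n}-{r}. 1 - w * ?z s)) / Q)"
    unfolding sum_distrib_right sum_divide_distrib sum_subtractf [symmetric]
    unfolding sum_distrib_left by (intro sum.cong refl) (rule each)
  also have "\<dots> = P * (R / Q - 1 / q ^ mi_size n k)"
    unfolding sum_dual_coeff[OF x] sum_dual_coeff_shifted[OF x w] using Q by (simp add: Q_def R_def field_simps)
  finally have S: "(\<Sum>r=1..n. dual_coeff x k r * node_poly x \<beta> (k(r := k r - 1)) A) * A = P * (R / Q - 1 / q ^ mi_size n k)" .
  define B where "B = (\<Prod>s=1..n. - (\<beta> * x s * q ^ k s) / q)"
  have B: "B \<noteq> 0" using \<beta> nz by (auto simp: B_def)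
  have e1: "(\<Prod>r=1..n. A - \<beta> * x r * q ^ k r / q) = B * Q"
    unfolding B_def Q_def prod.distrib [symmetric]
    by (intro prod.cong refl) (use \<beta> nz in \<open>auto simp: w_def dual_def field_simps\<close>)
  have e2: "(\<Prod>r=1..n. A - \<beta> * x r / q) = B * R"
    unfolding B_def R_def prod.distrib [symmetric]
    by (intro prod.cong refl) (use \<beta> nz in \<open>auto simp: w_def dual_def field_simps\<close>)
  have "node_poly x \<beta> k (q * A) * Q = q ^ mi_size n k * P * R"
    using node_poly_q_mult[of x \<beta> k A, folded P_def] B unfolding e1 e2 by simp
  then have "node_poly x \<beta> k (q * A) = q ^ mi_size n k * P * R / Q" using Q by (simp add: field_simps)
  moreover define T where "T = (\<Sum>r=1..n. dual_coeff x k r * node_poly x \<beta> (k(r := k r - 1)) A)"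
  ultimately show ?case using S unfolding P_def [symmetric] T_def [symmetric] by (simp add: field_simps)
qed (auto intro!: continuous_intros)

text \<open>\<open>qfall m l / qpoch q q l\<close> is the Gaussian binomial coefficient. For
  \<open>l > m\<close> the truncated subtraction yields a factor \<open>1 - q ^ 0\<close>, so the
  value is 0, as it should be.\<close>

definition qfall :: "nat \<Rightarrow> nat \<Rightarrow> complex" where
  "qfall m l = (\<Prod>i<l. 1 - q ^ (m - i))"

lemma qfall_Suc: "qfall m (Suc l) = qfall m l * (1 - q ^ (m - l))"
  by (simp add: qfall_def)

lemma qfall_0 [simp]: "qfall m 0 = 1"
  by (simp add: qfall_def)

lemma qfall_eq_0: "m < l \<Longrightarrow> qfall m l = 0"
  by (auto simp: qfall_def intro!: bexI[of _ m])

lemma qfall_Suc_Suc: "qfall (Suc m) (Suc l) = (1 - q ^ Suc m) * qfall m l"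
  by (simp add: qfall_def prod.lessThan_Suc_shift del: prod.lessThan_Suc)

lemma mi_size_diff:
  assumes "\<And>s. s \<in> {1..n} \<Longrightarrow> j s \<le> k s"
  shows "mi_size n k = mi_size n (\<lambda>s. k s - j s) + mi_size n j"
  using assms by (simp add: mi_size_def sum.distrib [symmetric])

text \<open>Both sides of the following identity are the \<open>l\<close>-th \<open>q\<close>-derivative in \<open>A\<close> of the node polynomial.\<close>

lemma node_poly_qderiv:
  assumes x: "generic x" and \<beta>: "\<beta> \<noteq> 0"
    and f: "\<And>A. node_poly x \<beta> k A = (\<Sum>m\<le>M. f m * qpoch q A m)"
  shows "(\<Sum>m\<le>M. f m * ((-1) ^ l * q ^ (l choose 2) * qfall m l * qpoch q (A * q ^ l) (m - l))) =
    qpoch q q l * (-1) ^ l * q ^ (mi_size n k * l) / q ^ (l choose 2) *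
      (\<Sum>j\<in>level l. wt (dual x k) (qinv k) j * node_poly x \<beta> (\<lambda>s. k s - j s) A)"
    (is "?G l A = ?K l * ?H l A")
proof (induction l arbitrary: A)
  case 0
  have "node_poly x \<beta> (\<lambda>s. k s - (\<lambda>r\<in>{1..n}. 0) s) A = node_poly x \<beta> k A"
    unfolding node_poly_def by (intro prod.cong) auto
  then show ?case by (simp add: f level_0 wt_0 mi_size_def numeral_2_eq_2)
next
  case (Suc l)
  have xd: "generic (dual x k)" by (rule generic_dual[OF x])
  have G: "?G l A - ?G l (q * A) = A * ?G (Suc l) A" for A
    unfolding sum_distrib_left sum_subtractf [symmetric]
  proof (intro sum.cong refl)
    fix m
    have "qfall m l * (qpoch q (A * q ^ l) (m - l) - qpoch q (q * A * q ^ l) (m - l)) =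
      qfall m l * (- A * q ^ l * (1 - q ^ (m - l)) * qpoch q (A * q ^ Suc l) (m - Suc l))"
    proof (cases "m - l")
      case (Suc t)
      then have "m - Suc l = t" by simp
      then have "qpoch q (A * q ^ l) (m - l) - qpoch q (q * A * q ^ l) (m - l) = - A * q ^ l * (1 - q ^ (m - l)) * qpoch q (A * q ^ Suc l) (m - Suc l)"
        using Suc qpoch_Suc_left[of q "A * q ^ l" t] qpoch_Suc[of q "q * A * q ^ l" t]
        by (simp add: algebra_simps)
      then show ?thesis by simp
    qed auto
    then have "f m * (-1) ^ l * q ^ (l choose 2) * (qfall m l * (qpoch q (A * q ^ l) (m - l) - qpoch q (q * A * q ^ l) (m - l))) =
      f m * (-1) ^ l * q ^ (l choose 2) * (qfall m l * (- A * q ^ l * (1 - q ^ (m - l)) * qpoch q (A * q ^ Suc l) (m - Suc l)))" by simp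
    then show "f m * ((-1) ^ l * q ^ (l choose 2) * qfall m l * qpoch q (A * q ^ l) (m - l)) -
         f m * ((-1) ^ l * q ^ (l choose 2) * qfall m l * qpoch q (q * A * q ^ l) (m - l)) =
         A * (f m * ((-1) ^ Suc l * q ^ (Suc l choose 2) * qfall m (Suc l) * qpoch q (A * q ^ Suc l) (m - Suc l)))"
      unfolding choose_2_Suc qfall_Suc by (simp add: algebra_simps power_add)
  qed
  \<comment> \<open>\<open>node_poly_qdiff\<close> lowers \<open>k - j\<close> by a unit vector,
    which is a step up for \<open>j\<close>; \<open>level_step\<close> at the dual points collects
    these terms on the next level.\<close>
  have H: "?H l A - ?H l (q * A) = - A * q ^ mi_size n k / q ^ l * (1 - q ^ Suc l) * ?H (Suc l) A" for A
  proof -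
    define F where "F j r = node_poly x \<beta> (\<lambda>s. k s - j s) A" for j :: "nat \<Rightarrow> nat" and r :: nat
    define L where "L j = (\<Sum>r=1..n. lag (dual x k) (qinv k) j r * F (bump r j) r)" for j
    define L' where "L' j = (\<Sum>r=1..n. lag (dual x k) (\<lambda>_. 1) j r * F j r)" for j
    have "?H l A - ?H l (q * A) = (- A * q ^ mi_size n k / q ^ l) * (\<Sum>j\<in>level l. wt (dual x k) (qinv k) j * L j)"
      unfolding sum_distrib_left sum_subtractf [symmetric]
    proof (intro sum.cong refl)
      fix j assume j: "j \<in> level l"
      show "wt (dual x k) (qinv k) j * node_poly x \<beta> (\<lambda>s. k s - j s) A - wt (dual x k) (qinv k) j * node_poly x \<beta> (\<lambda>s. k s - j s) (q * A)
        = (- A * q ^ mi_size n k / q ^ l) * (wt (dual x k) (qinv k) j * L j)"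
      proof (cases "\<forall>s\<in>{1..n}. j s \<le> k s")
        \<comment> \<open>Here \<open>k s - j s\<close> is truncated and carries no meaning, but the
          weight of \<open>j\<close> is 0.\<close>
        case False
        then obtain s where "s \<in> {1..n}" "k s < j s" by auto
        then show ?thesis using wt_qinv_eq_0[OF xd] by simp
      next
        case True
        then have sz: "mi_size n k = mi_size n (\<lambda>s. k s - j s) + l"
          using mi_size_diff[of j k] j by (simp add: level_def)
        have "L j = (\<Sum>r=1..n. dual_coeff x (\<lambda>s. k s - j s) r * node_poly x \<beta> ((\<lambda>s. k s - j s)(r := k r - j r - 1)) A)"
          unfolding L_def
        proof (intro sum.cong refl arg_cong2[where f = "(*)"])
          fix r assume "r \<in> {1..n}"
          then show "lag (dual x k) (qinv k) j r = dual_coeff x (\<lambda>s. k s - j s) r"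
            using lag_dual[OF x] True by blast
          have "(\<lambda>s. k s - bump r j s) = (\<lambda>s. k s - j s)(r := k r - j r - 1)" by (auto simp: fun_eq_iff)
          then show "F (bump r j) r = node_poly x \<beta> ((\<lambda>s. k s - j s)(r := k r - j r - 1)) A"
            by (simp add: F_def)
        qed
        then have "node_poly x \<beta> (\<lambda>s. k s - j s) A - node_poly x \<beta> (\<lambda>s. k s - j s) (q * A) = (- A * q ^ mi_size n k / q ^ l) * L j"
          using node_poly_qdiff[OF x \<beta>, of "\<lambda>s. k s - j s" A] by (simp add: sz power_add)
        then have "wt (dual x k) (qinv k) j * (node_poly x \<beta> (\<lambda>s. k s - j s) A - node_poly x \<beta> (\<lambda>s. k s - j s) (q * A))
          = wt (dual x k) (qinv k) j * ((- A * q ^ mi_size n k / q ^ l) * L j)" by simp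
        then show ?thesis by (simp add: algebra_simps)
      qed
    qed
    also have "(\<Sum>j\<in>level l. wt (dual x k) (qinv k) j * L j) = (\<Sum>j\<in>level (Suc l). wt (dual x k) (qinv k) j * L' j)"
      unfolding L_def L'_def by (rule level_step[OF xd])
    also have "\<dots> = (1 - q ^ Suc l) * ?H (Suc l) A"
      unfolding sum_distrib_left
    proof (intro sum.cong refl)
      fix j assume j: "j \<in> level (Suc l)"
      have "L' j = (1 - q ^ Suc l) * node_poly x \<beta> (\<lambda>s. k s - j s) A"
        unfolding L'_def F_def sum_distrib_right [symmetric] sum_lag[OF xd] using j by (simp add: level_def)
      then show "wt (dual x k) (qinv k) j * L' j = (1 - q ^ Suc l) * (wt (dual x k) (qinv k) j * node_poly x \<beta> (\<lambda>s. k s - j s) A)"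
        by simp
    qed
    finally show ?thesis by (simp add: mult.assoc)
  qed
  have K: "?K (Suc l) = - (?K l * q ^ mi_size n k / q ^ l * (1 - q ^ Suc l))"
    unfolding choose_2_Suc by (simp add: qpoch_Suc power_add ac_simps)
  show ?case
  \<comment> \<open>The recursion gives the next derivative only after division by \<open>A\<close>;
    the value at \<open>A = 0\<close> follows by continuity.\<close>
  proof (rule eq_if_eq_off_finite[where B = "{0}" and A = A], goal_cases)
    case (4 A)
    have "A * ?G (Suc l) A = ?K l * (?H l A - ?H l (q * A))"
      unfolding G [symmetric] Suc.IH right_diff_distrib ..
    also have "\<dots> = A * (?K (Suc l) * ?H (Suc l) A)"
      unfolding H K by simp
    finally have *: "A * ?G (Suc l) A = A * (?K (Suc l) * ?H (Suc l) A)" .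
    have A: "A \<noteq> 0" using 4 by simp
    show ?case by (rule mult_left_cancel[OF A, THEN iffD1]) (rule *)
  qed (auto intro!: continuous_intros)
qed


text \<open>The q-Chu-Vandermonde sum of the 2-phi-1 with upper parameters \<open>q ^ (- m)\<close>
  and \<open>b\<close>, lower parameter \<open>b * c\<close> and argument \<open>c * q ^ m\<close>,
  cleared of denominators. The q-Pascal rule splits the sum for \<open>Suc m\<close> into two parts
  that recombine to \<open>1 - c\<close> times the sum for \<open>m\<close> and
  \<open>c * q\<close>.\<close>

lemma q_vandermonde:
  "qpoch q c m = (\<Sum>l\<le>m. qfall m l / qpoch q q l * (-c) ^ l * q ^ (l choose 2) * qpoch q b l * qpoch q (b * c * q ^ l) (m - l))"
proof (induction m arbitrary: c)
  case 0
  show ?case by (simp add: numeral_2_eq_2)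
next
  case (Suc m)
  define e where "e l = (-c) ^ l * q ^ (l choose 2) * qpoch q b l" for l
  define h where "h l = qfall m l / qpoch q q l" for l
  have e0: "e 0 = 1" "h 0 = 1" by (simp_all add: e_def h_def numeral_2_eq_2)
  have pascal: "qfall (Suc m) (Suc l) / qpoch q q (Suc l) = q ^ Suc l * h (Suc l) + h l" for l
  proof -
    have nz: "qpoch q q (Suc l) \<noteq> 0" "1 - q * q ^ l \<noteq> 0" using q_power_eq_1[of "Suc l"] by auto
    have "qfall m l * (1 - q ^ Suc m) = q ^ Suc l * (qfall m l * (1 - q ^ (m - l))) + qfall m l * (1 - q ^ Suc l)"
    proof (cases "l \<le> m")
      case True
      then have "q ^ Suc m = q ^ Suc l * q ^ (m - l)" by (simp flip: power_add)
      then show ?thesis by (simp add: algebra_simps)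
    qed (simp add: qfall_eq_0)
    moreover have "h l = qfall m l * (1 - q ^ Suc l) / qpoch q q (Suc l)"
      unfolding h_def using nz by (simp add: qpoch_Suc)
    ultimately show ?thesis
      unfolding h_def[of "Suc l"] qfall_Suc_Suc qfall_Suc[of m l] using nz(1) by (simp add: field_simps)
  qed
  have "(\<Sum>l\<le>Suc m. qfall (Suc m) l / qpoch q q l * (-c) ^ l * q ^ (l choose 2) * qpoch q b l * qpoch q (b * c * q ^ l) (Suc m - l))
    = qpoch q (b * c) (Suc m) + (\<Sum>l\<le>m. (q ^ Suc l * h (Suc l) + h l) * (e (Suc l) * qpoch q (b * c * q ^ Suc l) (m - l)))"
    unfolding sum.atMost_Suc_shift pascal e_def by (simp add: numeral_2_eq_2 mult.assoc)
  also have "\<dots> = (\<Sum>l\<le>Suc m. q ^ l * h l * e l * qpoch q (b * c * q ^ l) (Suc m - l)) + (\<Sum>l\<le>m. h l * (e (Suc l) * qpoch q (b * c * q ^ Suc l) (m - l)))"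
    unfolding sum.atMost_Suc_shift by (simp add: sum.distrib distrib_right e0 mult.assoc)
  also have "(\<Sum>l\<le>Suc m. q ^ l * h l * e l * qpoch q (b * c * q ^ l) (Suc m - l)) = (\<Sum>l\<le>m. q ^ l * h l * e l * qpoch q (b * c * q ^ l) (Suc m - l))"
    by (simp add: h_def qfall_eq_0)
  also have "\<dots> + (\<Sum>l\<le>m. h l * (e (Suc l) * qpoch q (b * c * q ^ Suc l) (m - l))) =
     (1 - c) * (\<Sum>l\<le>m. qfall m l / qpoch q q l * (-(c * q)) ^ l * q ^ (l choose 2) * qpoch q b l * qpoch q (b * (c * q) * q ^ l) (m - l))"
    unfolding sum_distrib_left sum.distrib [symmetric]
  proof (intro sum.cong refl)
    fix l assume "l \<in> {..m}"
    then have l: "Suc m - l = Suc (m - l)" by auto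
    have "(-(c * q)) ^ l = q ^ l * (-c) ^ l" by (metis mult.commute mult_minus_left power_mult_distrib)
    then show "q ^ l * h l * e l * qpoch q (b * c * q ^ l) (Suc m - l) + h l * (e (Suc l) * qpoch q (b * c * q ^ Suc l) (m - l)) =
       (1 - c) * (qfall m l / qpoch q q l * (-(c * q)) ^ l * q ^ (l choose 2) * qpoch q b l * qpoch q (b * (c * q) * q ^ l) (m - l))"
      unfolding l qpoch_Suc_left[of q "b * c * q ^ l"] e_def choose_2_Suc qpoch_Suc[of q b] h_def [symmetric]
      by (simp add: algebra_simps power_add)
  qed
  also have "\<dots> = (1 - c) * qpoch q (c * q) m"
    using Suc.IH[of "c * q"] by simp
  also have "\<dots> = qpoch q c (Suc m)" by (simp add: qpoch_Suc_left)
  finally show ?case by simp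
qed

lemma multi_indices_le_iff: "j \<in> multi_indices_le n k \<longleftrightarrow> j \<in> multi_indices n \<and> (\<forall>r\<in>{1..n}. j r \<le> k r)"
  by (auto simp: multi_indices_le_def multi_indices_def PiE_def Pi_def)

lemma finite_multi_indices_le: "finite (multi_indices_le n k)"
  unfolding multi_indices_le_def by (rule finite_PiE) auto

lemma mi_size_mono: "j \<in> multi_indices_le n k \<Longrightarrow> mi_size n j \<le> mi_size n k"
  unfolding mi_size_def multi_indices_le_iff by (intro sum_mono) auto

lemma sum_levels:
  fixes g :: "(nat \<Rightarrow> nat) \<Rightarrow> complex"
  assumes "\<And>j r. j \<in> multi_indices n \<Longrightarrow> r \<in> {1..n} \<Longrightarrow> k r < j r \<Longrightarrow> g j = 0"
  shows "(\<Sum>l\<le>mi_size n k. \<Sum>j\<in>level l. g j) = (\<Sum>j\<in>multi_indices_le n k. g j)"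
proof -
  define S where "S = (\<Union>l\<le>mi_size n k. level l)"
  have "finite S" unfolding S_def using finite_level by auto
  have "(\<Sum>l\<le>mi_size n k. \<Sum>j\<in>level l. g j) = (\<Sum>j\<in>S. g j)"
    unfolding S_def by (rule sum.UNION_disjoint [symmetric]) (auto simp: finite_level, auto simp: level_def)
  also have "\<dots> = (\<Sum>j\<in>multi_indices_le n k. g j)"
  proof (rule sum.mono_neutral_right[OF \<open>finite S\<close>])
    show "multi_indices_le n k \<subseteq> S"
      using mi_size_mono by (auto simp: S_def level_def multi_indices_le_iff)
    show "\<forall>i\<in>S - multi_indices_le n k. g i = 0"
    proof
      fix i assume "i \<in> S - multi_indices_le n k"
      then have "i \<in> multi_indices n" "\<not> (\<forall>r\<in>{1..n}. i r \<le> k r)" by (auto simp: S_def level_def multi_indices_le_iff)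
      then show "g i = 0" using assms[of i] by (auto simp: not_le)
    qed
  qed
  finally show ?thesis .
qed

text \<open>For \<open>n = 1\<close> the left side contains the 3-phi-2 with upper parameters
  \<open>q ^ (- k)\<close>, \<open>A\<close>, \<open>c\<close> and argument \<open>q\<close>. On the
  left \<open>b\<close> and \<open>c\<close> enter only through \<open>|i|\<close>; the right side
  is the inner sum of the theorem up to a prefactor.\<close>

lemma transformation_3phi2:
  assumes x: "generic x" and \<beta>: "\<beta> \<noteq> 0" and nz: "\<And>j. node_qpoch x \<beta> j \<noteq> 0"
    and bc: "\<And>m. qpoch q (b * c) m \<noteq> 0"
  shows "node_qpoch x \<beta> k * (\<Sum>i\<in>multi_indices_le n k. wt x (qinv k) i / node_qpoch x \<beta> i * q ^ mi_size n i *
      qpoch q A (mi_size n i) * (qpoch q c (mi_size n i) / qpoch q (b * c) (mi_size n i)))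
    = (\<Sum>j\<in>multi_indices_le n k. wt (dual x k) (qinv k) j * node_poly x \<beta> (\<lambda>s. k s - j s) A *
      ((-1) ^ mi_size n j * q ^ (mi_size n k * mi_size n j) / q ^ (mi_size n j choose 2) * c ^ mi_size n j *
       qpoch q A (mi_size n j) * qpoch q b (mi_size n j) / qpoch q (b * c) (mi_size n j)))"
proof -
  define K where "K = mi_size n k"
  define f where "f m = node_qpoch x \<beta> k * (newton_coeff x \<beta> k m * q ^ m)" for m
  define C where "C l = c ^ l * qpoch q b l * qpoch q A l / (qpoch q q l * qpoch q (b * c) l)" for l
  define G where "G m l = (-1) ^ l * q ^ (l choose 2) * qfall m l * qpoch q (A * q ^ l) (m - l)" for m l
  have f: "node_poly x \<beta> k A = (\<Sum>m\<le>K. f m * qpoch q A m)" for A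
    unfolding newton_expansion[OF x nz order.refl] K_def f_def sum_distrib_left by (simp add: mult.assoc)
  have "(\<Sum>i\<in>multi_indices_le n k. wt x (qinv k) i / node_qpoch x \<beta> i * q ^ mi_size n i *
      qpoch q A (mi_size n i) * (qpoch q c (mi_size n i) / qpoch q (b * c) (mi_size n i))) =
     (\<Sum>m\<le>K. \<Sum>i\<in>level m. wt x (qinv k) i / node_qpoch x \<beta> i * q ^ mi_size n i *
      qpoch q A (mi_size n i) * (qpoch q c (mi_size n i) / qpoch q (b * c) (mi_size n i)))"
    unfolding K_def by (rule sum_levels [symmetric]) (auto simp: wt_qinv_eq_0[OF x])
  also have "\<dots> = (\<Sum>m\<le>K. newton_coeff x \<beta> k m * q ^ m * qpoch q A m * (qpoch q c m / qpoch q (b * c) m))"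
    unfolding newton_coeff_def sum_distrib_right by (intro sum.cong refl) (auto simp: level_def)
  finally have "node_qpoch x \<beta> k * (\<Sum>i\<in>multi_indices_le n k. wt x (qinv k) i / node_qpoch x \<beta> i * q ^ mi_size n i *
      qpoch q A (mi_size n i) * (qpoch q c (mi_size n i) / qpoch q (b * c) (mi_size n i))) =
     (\<Sum>m\<le>K. f m * (qpoch q A m * (qpoch q c m / qpoch q (b * c) m)))"
    by (simp only:) (simp add: sum_distrib_left f_def mult.assoc)
  also have "\<dots> = (\<Sum>m\<le>K. f m * (\<Sum>l\<le>K. C l * G m l))"
  proof (intro sum.cong refl arg_cong2[where f = "(*)"])
    fix m assume m: "m \<in> {..K}"
    \<comment> \<open>Since \<open>qfall\<close> kills \<open>l > m\<close>, the range of
      \<open>l\<close> can be made independent of \<open>m\<close>, which permits exchanging the two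
      sums.\<close>
    have "(\<Sum>l\<le>K. C l * G m l) = (\<Sum>l\<le>m. C l * G m l)"
      by (rule sum.mono_neutral_right) (use m in \<open>auto simp: G_def qfall_eq_0\<close>)
    also have "\<dots> = qpoch q A m / qpoch q (b * c) m * qpoch q c m"
      unfolding q_vandermonde[of c m b] sum_distrib_left
    proof (intro sum.cong refl)
      fix l assume "l \<in> {..m}"
      then have m: "m = l + (m - l)" by auto
      have A: "qpoch q A m = qpoch q A l * qpoch q (A * q ^ l) (m - l)"
        by (subst m, subst qpoch_add) simp
      have B: "qpoch q (b * c) m = qpoch q (b * c) l * qpoch q (b * c * q ^ l) (m - l)"
        by (subst m, subst qpoch_add) simp
      have "qpoch q (b * c * q ^ l) (m - l) \<noteq> 0" "qpoch q (b * c) l \<noteq> 0" using bc[of m] unfolding B by auto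
      moreover have "(-c) ^ l = (-1) ^ l * c ^ l" by (rule power_minus)
      ultimately show "C l * G m l = qpoch q A m / qpoch q (b * c) m *
         (qfall m l / qpoch q q l * (-c) ^ l * q ^ (l choose 2) * qpoch q b l * qpoch q (b * c * q ^ l) (m - l))"
        unfolding A B C_def G_def by (simp add: ac_simps)
    qed
    finally show "qpoch q A m * (qpoch q c m / qpoch q (b * c) m) = (\<Sum>l\<le>K. C l * G m l)" by simp
  qed
  also have "\<dots> = (\<Sum>l\<le>K. C l * (\<Sum>m\<le>K. f m * G m l))"
    unfolding sum_distrib_left by (subst sum.swap) (simp add: mult.left_commute)
  also have "\<dots> = (\<Sum>l\<le>K. \<Sum>j\<in>level l. wt (dual x k) (qinv k) j * node_poly x \<beta> (\<lambda>s. k s - j s) A *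
      ((-1) ^ mi_size n j * q ^ (mi_size n k * mi_size n j) / q ^ (mi_size n j choose 2) * c ^ mi_size n j *
       qpoch q A (mi_size n j) * qpoch q b (mi_size n j) / qpoch q (b * c) (mi_size n j)))"
    unfolding G_def node_poly_qderiv[OF x \<beta> f] sum_distrib_left
    by (intro sum.cong refl) (simp add: level_def C_def ac_simps)
  also have "\<dots> = (\<Sum>j\<in>multi_indices_le n k. wt (dual x k) (qinv k) j * node_poly x \<beta> (\<lambda>s. k s - j s) A *
      ((-1) ^ mi_size n j * q ^ (mi_size n k * mi_size n j) / q ^ (mi_size n j choose 2) * c ^ mi_size n j *
       qpoch q A (mi_size n j) * qpoch q b (mi_size n j) / qpoch q (b * c) (mi_size n j)))"
    unfolding K_def by (rule sum_levels) (auto simp: wt_qinv_eq_0[OF generic_dual[OF x]])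
  finally show ?thesis .
qed

text \<open>The first \<open>i r\<close> factors in the denominator of \<open>wt x a k\<close> are
  the numerator of \<open>wt x (qinv k) i\<close> and cancel. The later factors form the denominator
  of a weight at the points \<open>x r * q ^ i r\<close>. The prefactors do not match; their
  quotient is recorded.\<close>

lemma wt_mult:
  fixes i m :: "nat \<Rightarrow> nat"
  assumes x: "generic x"
  defines "k \<equiv> \<lambda>r. i r + m r"
  shows "wt x a k * wt x (qinv k) i = wt x a i * wt (\<lambda>r. x r * q ^ i r) (\<lambda>s. a s * q ^ i s) m *
    ((-1) ^ mi_size n i * q ^ (Suc (mi_size n m) choose 2) / q ^ (Suc (mi_size n i + mi_size n m) choose 2))"
proof -
  have sz: "mi_size n k = mi_size n i + mi_size n m" by (simp add: mi_size_def k_def sum.distrib)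
  define Ni where "Ni = (\<Prod>r=1..n. \<Prod>s=1..n. qpoch q (a s * x r / x s) (i r))"
  define Nm where "Nm = (\<Prod>r=1..n. \<Prod>s=1..n. qpoch q (a s * q ^ i s * (x r * q ^ i r) / (x s * q ^ i s)) (m r))"
  define Nk where "Nk = (\<Prod>r=1..n. \<Prod>s=1..n. qpoch q (qinv k s * x r / x s) (i r))"
  define Dm where "Dm = (\<Prod>r=1..n. \<Prod>s=1..n. qpoch q (x r * q ^ i r / (x s * q ^ i s * q ^ m s)) (m r))"
  have N: "(\<Prod>r=1..n. \<Prod>s=1..n. qpoch q (a s * x r / x s) (k r)) = Ni * Nm"
    unfolding Ni_def Nm_def prod.distrib [symmetric] k_def qpoch_add
    by (intro prod.cong refl) (simp add: ac_simps)
  have D: "(\<Prod>r=1..n. \<Prod>s=1..n. qpoch q (x r / (x s * q ^ k s)) (k r)) = Nk * Dm"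
    unfolding Nk_def Dm_def prod.distrib [symmetric] k_def qpoch_add
    by (intro prod.cong refl) (simp add: ac_simps qinv_def power_add)
  have "(\<Prod>r=1..n. \<Prod>s=1..n. qpoch q (x r / (x s * q ^ k s)) (k r)) \<noteq> 0"
    using generic_qpoch_nz[OF x, of _ _ k] by simp
  then have nz: "Nk \<noteq> 0" unfolding D by auto
  define Di where "Di = (\<Prod>r=1..n. \<Prod>s=1..n. qpoch q (x r / (x s * q ^ i s)) (i r))"
  show ?thesis
    unfolding wt_def N D sz Nk_def [symmetric] Ni_def [symmetric] Nm_def [symmetric] Dm_def [symmetric] Di_def [symmetric]
    using nz by (simp add: power_add ac_simps)
qed

lemma wt_cong: "(\<And>r. r \<in> {1..n} \<Longrightarrow> k r = k' r) \<Longrightarrow> (\<And>r. r \<in> {1..n} \<Longrightarrow> a r = a' r) \<Longrightarrow> wt x a k = wt x a' k'"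
  by (simp add: wt_def mi_size_def)

end

section \<open>Bounds and the one-variable series\<close>

lemma bounded_range_mult:
  fixes f g :: "'a \<Rightarrow> complex"
  assumes "bounded (range f)" "bounded (range g)"
  shows "bounded (range (\<lambda>t. f t * g t))"
proof -
  obtain C D where "\<And>t. norm (f t) \<le> C" "\<And>t. norm (g t) \<le> D"
    using assms by (auto simp: bounded_iff)
  moreover from this have "0 \<le> C" by (meson norm_ge_zero order_trans)
  ultimately have "norm (f t * g t) \<le> C * D" for t unfolding norm_mult by (intro mult_mono) auto
  then show ?thesis by (auto simp: bounded_iff)
qed

lemma bounded_range_prod:
  fixes f :: "'b \<Rightarrow> 'a \<Rightarrow> complex"
  assumes "\<And>s. s \<in> S \<Longrightarrow> bounded (range (f s))"
  shows "bounded (range (\<lambda>t. \<Prod>s\<in>S. f s t))"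
  using assms by (induction S rule: infinite_finite_induct) (auto intro!: bounded_range_mult)

lemma bounded_range_comp: "bounded (range f) \<Longrightarrow> bounded (range (\<lambda>t. f (g t)))"
  by (rule bounded_subset[of "range f"]) auto

context q_base
begin

lemma norm_prod_le_exp:
  assumes U: "0 \<le> U" and f: "\<And>i. norm (f i :: complex) \<le> 1 + U * norm q ^ i"
  shows "norm (\<Prod>i<m. f i) \<le> exp (U / (1 - norm q))"
proof -
  have "norm (\<Prod>i<m. f i) = (\<Prod>i<m. norm (f i))" by (simp add: prod_norm)
  also have "\<dots> \<le> (\<Prod>i<m. exp (U * norm q ^ i))"
    by (intro prod_mono conjI norm_ge_zero order_trans[OF f] exp_ge_add_one_self)
  also have "\<dots> = exp (U * (\<Sum>i<m. norm q ^ i))" by (simp add: exp_sum sum_distrib_left)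
  also have "\<dots> \<le> exp (U / (1 - norm q))"
  proof -
    have "(\<Sum>i<m. norm q ^ i) \<le> (\<Sum>i. norm q ^ i)"
      using q_lt_1 by (intro sum_le_suminf summable_geometric) auto
    also have "\<dots> = 1 / (1 - norm q)" using q_lt_1 by (intro suminf_geometric) auto
    finally show ?thesis using U mult_left_mono by fastforce
  qed
  finally show ?thesis .
qed

lemma qpoch_bounded:
  assumes z: "norm z \<le> U"
  shows "norm (qpoch q z m) \<le> exp (U / (1 - norm q))"
  unfolding qpoch_def
proof (rule norm_prod_le_exp)
  show "0 \<le> U" using z norm_ge_zero order_trans by blast
  fix i
  have "norm (1 - z * q ^ i) \<le> 1 + norm z * norm q ^ i"
    using norm_triangle_ineq4[of 1 "z * q ^ i"] by (simp add: norm_mult norm_power)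
  also have "\<dots> \<le> 1 + U * norm q ^ i" using z by (simp add: mult_right_mono)
  finally show "norm (1 - z * q ^ i) \<le> 1 + U * norm q ^ i" .
qed

lemma bounded_qpoch:
  assumes "bounded (range z)"
  shows "bounded (range (\<lambda>t. qpoch q (z t) (m t)))"
proof -
  obtain U where "\<And>t. norm (z t) \<le> U" using assms by (auto simp: bounded_iff)
  then show ?thesis using qpoch_bounded by (auto simp: bounded_iff intro!: exI[of _ "exp (U / (1 - norm q))"])
qed

text \<open>A product of factors \<open>1 - t\<close> has modulus at least 1 minus the sum of the
  \<open>norm t\<close> if these are at most 1. The bound \<open>(1 - norm q) / 2\<close> keeps that
  sum below \<open>1 / 2\<close>.\<close>

lemma qpoch_lower:
  assumes "norm z \<le> (1 - norm q) / 2"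
  shows "1 / 2 \<le> norm (qpoch q z m)"
proof -
  have "1 - norm z * (\<Sum>i<m. norm q ^ i) \<le> norm (qpoch q z m)" if "norm z \<le> 1"
  proof (induction m)
    case (Suc m)
    define a where "a = norm z * norm q ^ m"
    have a: "0 \<le> a" "a \<le> 1" using that q_lt_1 unfolding a_def by (auto simp: mult_le_one power_le_one)
    define S where "S = norm z * (\<Sum>i<m. norm q ^ i)"
    have S: "0 \<le> S" unfolding S_def by (intro mult_nonneg_nonneg sum_nonneg) auto
    have "1 - norm z * (\<Sum>i<Suc m. norm q ^ i) = 1 - S - a" by (simp add: S_def a_def algebra_simps)
    also have "\<dots> \<le> (1 - S) * (1 - a)" using S a by (simp add: algebra_simps)
    also have "\<dots> \<le> norm (qpoch q z m) * (1 - a)"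
      using Suc.IH a by (intro mult_right_mono) (auto simp: S_def)
    also have "\<dots> \<le> norm (qpoch q z m) * norm (1 - z * q ^ m)"
      using norm_triangle_ineq2[of 1 "z * q ^ m"] by (intro mult_left_mono) (auto simp: a_def norm_mult norm_power)
    finally show ?case by (simp add: qpoch_Suc norm_mult)
  qed simp
  moreover have "norm z \<le> 1"
  proof -
    have "(1 - norm q) / 2 \<le> 1 / 2" by (intro divide_right_mono) auto
    also have "\<dots> \<le> (1 :: real)" by simp
    finally show ?thesis using assms by (rule order_trans[rotated])
  qed
  moreover have "norm z * (\<Sum>i<m. norm q ^ i) \<le> (1 - norm q) / 2 * (1 / (1 - norm q))"
  proof (rule mult_mono[OF assms])
    have "(\<Sum>i<m. norm q ^ i) \<le> (\<Sum>i. norm q ^ i)"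
      using q_lt_1 by (intro sum_le_suminf summable_geometric) auto
    also have "\<dots> = 1 / (1 - norm q)" using q_lt_1 by (intro suminf_geometric) auto
    finally show "(\<Sum>i<m. norm q ^ i) \<le> 1 / (1 - norm q)" .
  qed (use q_lt_1 in \<open>auto intro: sum_nonneg\<close>)
  ultimately show ?thesis using q_lt_1 by (simp add: field_simps)
qed

text \<open>From some \<open>N\<close> on \<open>qpoch_lower\<close> applies; the factors before it
  form the fixed nonzero number \<open>qpoch q z N\<close>.\<close>

lemma bounded_inverse_qpoch:
  assumes "\<And>m. qpoch q z m \<noteq> 0"
  shows "bounded (range (\<lambda>m. 1 / qpoch q z m))"
proof -
  have "(\<lambda>N. norm z * norm q ^ N) \<longlonglongrightarrow> norm z * 0"
    using q_lt_1 by (intro tendsto_intros) auto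
  then have "eventually (\<lambda>N. norm z * norm q ^ N < (1 - norm q) / 2) sequentially"
    by (rule order_tendstoD) (use q_lt_1 in simp)
  then obtain N where N: "norm (z * q ^ N) \<le> (1 - norm q) / 2"
    by (auto simp: eventually_sequentially norm_mult norm_power intro: less_imp_le)
  have "norm (1 / qpoch q z (m + N)) \<le> 2 / norm (qpoch q z N)" for m
  proof -
    have "qpoch q z (m + N) = qpoch q z N * qpoch q (z * q ^ N) m" by (subst add.commute) (rule qpoch_add)
    moreover have "norm (1 / qpoch q (z * q ^ N) m) \<le> 2" using qpoch_lower[OF N, of m] by (simp add: norm_divide divide_simps)
    ultimately have "norm (1 / qpoch q z (m + N)) = norm (1 / qpoch q (z * q ^ N) m) / norm (qpoch q z N)"
      by (simp add: norm_divide norm_mult)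
    also have "\<dots> \<le> 2 / norm (qpoch q z N)"
      by (rule divide_right_mono) (use \<open>norm (1 / qpoch q (z * q ^ N) m) \<le> 2\<close> in auto)
    finally show ?thesis .
  qed
  then have "Bseq (\<lambda>m. 1 / qpoch q z (m + N))" by (intro BseqI')
  then have "Bseq (\<lambda>m. 1 / qpoch q z m)" by (rule Bseq_offset)
  then show ?thesis by (simp add: Bseq_eq_bounded)
qed

lemma qpoch_reflect:
  assumes "z \<noteq> 0" "m \<le> d"
  shows "(\<Prod>i<m. 1 - q ^ (d - i) / z) * qpoch q (q / z) (d - m) = qpoch q (q / z) d"
  using assms(2)
proof (induction m)
  case (Suc m)
  then have d: "d - m = Suc (d - Suc m)" by simp
  have "qpoch q (q / z) (d - m) = qpoch q (q / z) (d - Suc m) * (1 - q ^ (d - m) / z)"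
    unfolding d qpoch_Suc by (simp add: d)
  then show ?case using Suc by (simp add: ac_simps)
qed simp

text \<open>For uniformity in \<open>i\<close> and \<open>j\<close>, normalise \<open>z\<close> by a power of \<open>q\<close> to \<open>|w| \<ge> 1\<close>; then factors at negative powers of
  \<open>q\<close> are reflected, which only makes them smaller.\<close>

lemma bounded_inverse_qpoch_shift:
  assumes z: "z \<noteq> 0" and zq: "\<And>i j. z * q ^ i \<noteq> q ^ j"
  shows "bounded (range (\<lambda>(i, j, m). 1 / qpoch q (z * q ^ i / q ^ j) m))"
proof -
  have "LIM N sequentially. norm z * inverse (norm q ^ N) :> at_top"
  proof (rule filterlim_tendsto_pos_mult_at_top[OF tendsto_const])
    show "LIM N sequentially. inverse (norm q ^ N) :> at_top"
      by (rule filterlim_inverse_at_top)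
        (use q_lt_1 in \<open>auto intro!: LIMSEQ_realpow_zero always_eventually\<close>)
  qed (use z in auto)
  then have "eventually (\<lambda>N. 1 \<le> norm z * inverse (norm q ^ N)) sequentially"
    unfolding filterlim_at_top by blast
  then obtain N where N: "1 \<le> norm z * inverse (norm q ^ N)" by (auto simp: eventually_sequentially)
  define w where "w = z / q ^ N"
  have w1: "1 \<le> norm w" using N by (simp add: w_def norm_divide norm_power divide_inverse norm_mult norm_inverse)
  then have w0: "w \<noteq> 0" by auto
  have wz: "z * q ^ i / q ^ j = w * q ^ (i + N) / q ^ j" for i j by (simp add: w_def power_add)
  have wq: "w * q ^ i \<noteq> q ^ j" for i j
    using zq[of i "j + N"] by (simp add: w_def power_add field_simps)
  have nz1: "qpoch q w m \<noteq> 0" for m using wq[of _ 0] by (auto simp: qpoch_eq_0_iff)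
  have nz2: "qpoch q (q / w) m \<noteq> 0" for m using wq[of 0 "Suc _"] w0 by (auto simp: qpoch_eq_0_iff field_simps)
  obtain E1 where E1: "\<And>m. norm (qpoch q w m) \<le> E1" using qpoch_bounded[of w "norm w"] by blast
  obtain E2 where E2: "\<And>m. norm (1 / qpoch q w m) \<le> E2" using bounded_inverse_qpoch[OF nz1] by (auto simp: bounded_iff)
  obtain E3 where E3: "\<And>m. norm (qpoch q (q / w) m) \<le> E3" using qpoch_bounded[of "q / w" "norm (q / w)"] by blast
  obtain E4 where E4: "\<And>m. norm (1 / qpoch q (q / w) m) \<le> E4" using bounded_inverse_qpoch[OF nz2] by (auto simp: bounded_iff)
  have pos: "0 \<le> E1" "0 \<le> E2" "0 \<le> E3" "0 \<le> E4" using E1 E2 E3 E4 by (meson norm_ge_zero order_trans)+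
  \<comment> \<open>Nonnegative exponents: the shifted product is a quotient of two products that
    start at \<open>w\<close>.\<close>
  have A: "norm (1 / qpoch q (w * q ^ e) m) \<le> E1 * E2" for e m
  proof -
    have "1 / qpoch q (w * q ^ e) m = qpoch q w e * (1 / qpoch q w (e + m))"
      using nz1[of e] unfolding qpoch_add by simp
    then show ?thesis using E1[of e] E2[of "e + m"] pos by (simp only: norm_mult) (intro mult_mono, auto)
  qed
  \<comment> \<open>Negative exponents: because of \<open>1 \<le> norm w\<close>, each factor
    dominates its reflection, and the reflected product is a quotient of two products that start at
    \<open>q / w\<close>.\<close>
  have B: "norm (1 / qpoch q (w / q ^ d) m) \<le> E3 * E4" if "m \<le> d" for d m
  proof -
    have "norm (qpoch q (w / q ^ d) m) = (\<Prod>i<m. norm (1 - w / q ^ d * q ^ i))" by (simp add: qpoch_def prod_norm)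
    also have "\<dots> \<ge> (\<Prod>i<m. norm (1 - q ^ (d - i) / w))"
    proof (intro prod_mono conjI norm_ge_zero)
      fix i assume "i \<in> {..<m}"
      then have i: "i \<le> d" using that by auto
      have "q ^ d = q ^ (d - i) * q ^ i" using i by (simp flip: power_add)
      then have "1 - w / q ^ d * q ^ i = - (w / q ^ (d - i)) * (1 - q ^ (d - i) / w)"
        using w0 by (simp add: field_simps)
      moreover have "1 \<le> norm (- (w / q ^ (d - i)))"
      proof -
        have "norm q ^ (d - i) \<le> 1" using q_lt_1 by (simp add: power_le_one)
        then show ?thesis using w1 by (simp add: norm_divide norm_power)
      qed
      ultimately show "norm (1 - q ^ (d - i) / w) \<le> norm (1 - w / q ^ d * q ^ i)"
        by (simp only: norm_mult) (metis mult_right_mono mult_1 norm_ge_zero)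
    qed
    finally have ge: "norm (\<Prod>i<m. 1 - q ^ (d - i) / w) \<le> norm (qpoch q (w / q ^ d) m)" by (simp add: prod_norm)
    have r: "(\<Prod>i<m. 1 - q ^ (d - i) / w) = qpoch q (q / w) d / qpoch q (q / w) (d - m)"
      using qpoch_reflect[OF w0 that] nz2[of "d - m"] by (simp add: field_simps)
    have pr: "0 < norm (\<Prod>i<m. 1 - q ^ (d - i) / w)" using nz2[of d] nz2[of "d - m"] unfolding r by simp
    have "norm (1 / qpoch q (w / q ^ d) m) \<le> 1 / norm (\<Prod>i<m. 1 - q ^ (d - i) / w)"
      using frac_le[OF zero_le_one order.refl pr ge] by (simp add: norm_divide)
    also have "\<dots> = norm (qpoch q (q / w) (d - m) * (1 / qpoch q (q / w) d))" unfolding r by (simp add: norm_divide)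
    also have "\<dots> \<le> E3 * E4" using E3[of "d - m"] E4[of d] pos by (simp only: norm_mult) (intro mult_mono, auto)
    finally show ?thesis .
  qed
  \<comment> \<open>The maxima with 1 let one constant cover either bound alone as well as their
    product, which arises when the exponents pass from negative to nonnegative.\<close>
  define E where "E = max 1 (E1 * E2) * max 1 (E3 * E4)"
  have "norm (1 / qpoch q (z * q ^ i / q ^ j) m) \<le> E" for i j m
  proof (cases "j \<le> i + N")
    case True
    then have "z * q ^ i / q ^ j = w * q ^ (i + N - j)" unfolding wz by (simp add: power_diff)
    then show ?thesis using A[of "i + N - j" m] pos unfolding E_def
      by (simp only:) (smt (verit) mult_le_cancel_left1 max.cobounded1 max.cobounded2 mult_nonneg_nonneg)
  next
    case False
    define d where "d = j - (i + N)"
    have "q ^ j = q ^ d * q ^ (i + N)" using False by (simp add: d_def flip: power_add)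
    then have e: "z * q ^ i / q ^ j = w / q ^ d" unfolding wz by simp
    show ?thesis
    proof (cases "m \<le> d")
      case True
      then show ?thesis using B[OF True] pos unfolding E_def e
        by (smt (verit) mult_le_cancel_right1 max.cobounded1 max.cobounded2 mult_nonneg_nonneg)
    next
      case False
      then have m: "m = d + (m - d)" by simp
      have "qpoch q (w / q ^ d) m = qpoch q (w / q ^ d) d * qpoch q w (m - d)"
        by (subst m, subst qpoch_add) simp
      then have "norm (1 / qpoch q (w / q ^ d) m) = norm (1 / qpoch q w (m - d)) * norm (1 / qpoch q (w / q ^ d) d)"
        by (simp add: norm_divide norm_mult)
      also have "\<dots> \<le> max 1 (E1 * E2) * max 1 (E3 * E4)"
        using A[of 0 "m - d"] B[of d d] by (intro mult_mono) (auto simp: le_max_iff_disj)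
      finally show ?thesis unfolding e E_def .
    qed
  qed
  then show ?thesis by (auto simp: bounded_iff)
qed

end

section \<open>The weight in the form used by the theorem\<close>

lemma sum_index_pairs:
  fixes g :: "nat \<Rightarrow> nat \<Rightarrow> 'a::comm_monoid_add"
  shows "(\<Sum>(r, s)\<in>index_pairs n. g r s) = (\<Sum>s=1..n. \<Sum>r\<in>{1..<s}. g r s)"
proof -
  have "(\<Sum>s=1..n. \<Sum>r\<in>{1..<s}. g r s) = (\<Sum>(s, r)\<in>Sigma {1..n} (\<lambda>s. {1..<s}). g r s)"
    by (rule sum.Sigma) auto
  also have "\<dots> = (\<Sum>(r, s)\<in>index_pairs n. g r s)"
    by (rule sum.reindex_bij_witness[where i = prod.swap and j = prod.swap]) (auto simp: index_pairs_def)
  finally show ?thesis ..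
qed

lemma finite_index_pairs: "finite (index_pairs n)"
  by (rule finite_subset[of _ "{1..n} \<times> {1..n}"]) (auto simp: index_pairs_def)

lemma prod_square:
  fixes f :: "nat \<Rightarrow> nat \<Rightarrow> 'a::comm_monoid_mult"
  shows "(\<Prod>r=1..n. \<Prod>s=1..n. f r s) = (\<Prod>r=1..n. f r r) * (\<Prod>(r, s)\<in>index_pairs n. f r s * f s r)"
proof -
  let ?D = "(\<lambda>r. (r, r)) ` {1..n}" and ?U = "prod.swap ` index_pairs n"
  have S: "{1..n} \<times> {1..n} = ?D \<union> (index_pairs n \<union> ?U)" by (force simp: index_pairs_def)
  have "(\<Prod>r=1..n. \<Prod>s=1..n. f r s) = (\<Prod>(r, s)\<in>?D \<union> (index_pairs n \<union> ?U). f r s)"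
    by (simp only: prod.cartesian_product S)
  also have "\<dots> = (\<Prod>(r, s)\<in>?D. f r s) * ((\<Prod>(r, s)\<in>index_pairs n. f r s) * (\<Prod>(r, s)\<in>?U. f r s))"
  proof -
    have "?D \<inter> (index_pairs n \<union> ?U) = {}" "index_pairs n \<inter> ?U = {}" by (auto simp: index_pairs_def)
    then show ?thesis by (simp add: prod.union_disjoint finite_index_pairs)
  qed
  also have "(\<Prod>(r, s)\<in>?D. f r s) = (\<Prod>r=1..n. f r r)" by (subst prod.reindex) (auto simp: inj_on_def)
  also have "(\<Prod>(r, s)\<in>?U. f r s) = (\<Prod>(r, s)\<in>index_pairs n. f s r)"
    by (subst prod.reindex) (auto simp: inj_on_def case_prod_unfold)
  finally show ?thesis by (simp add: case_prod_unfold prod.distrib)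
qed

text \<open>This is how \<open>elem_sym2\<close> enters the exponents of the theorem.\<close>

lemma mi_size_choose_2: "mi_size n k choose 2 = (\<Sum>r=1..n. k r choose 2) + elem_sym2 n k"
proof (induction n)
  case (Suc n)
  show ?case using Suc unfolding elem_sym2_def sum_index_pairs
    by (simp add: mi_size_def choose_2_add sum_distrib_right atLeastLessThanSuc_atLeastAtMost)
qed (simp add: mi_size_def elem_sym2_def sum_index_pairs)

lemma sum_pairs_snd: "(\<Sum>(r, s)\<in>index_pairs n. k s) = (\<Sum>r=1..n. (r - 1) * k r :: nat)"
  unfolding sum_index_pairs by simp

context q_base
begin

text \<open>To be read with \<open>u = x r / x s\<close>, \<open>A = k r\<close>,
  \<open>B = k s\<close>: two opposite off-diagonal denominators of \<open>wt\<close>, together with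
  one Vandermonde factor, become the corresponding denominators of the theorem.\<close>

lemma qpoch_pair:
  assumes u: "u \<noteq> 0" and uq: "\<And>i j. u * q ^ i \<noteq> q ^ j"
  shows "qpoch q (u / q ^ B) A * qpoch q (1 / (u * q ^ A)) B * ((1 - u * q ^ A / q ^ B) / (1 - u)) * q ^ (B + A * B)
    = qpoch q (q * u) A * qpoch q (q / u) B"
proof (induction A)
  case 0
  have 1: "1 - u \<noteq> 0" using uq[of 0 0] by auto
  have "qpoch q (1 / u) B * (1 - q ^ B / u) = (1 - 1 / u) * qpoch q (q / u) B"
    using qpoch_Suc[of q "1 / u" B] qpoch_Suc_left[of q "1 / u" B] by simp
  then have "qpoch q (1 / u) B * (1 - q ^ B / u) * (- u) = (1 - 1 / u) * (- u) * qpoch q (q / u) B" by simp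
  moreover have "(1 - q ^ B / u) * (- u) = (1 - u / q ^ B) * q ^ B" using u by (simp add: field_simps)
  moreover have "(1 - 1 / u) * (- u) = 1 - u" using u by (simp add: field_simps)
  ultimately have "qpoch q (1 / u) B * ((1 - u / q ^ B) * q ^ B) = (1 - u) * qpoch q (q / u) B"
    by (simp only: mult.assoc)
  then show ?case using 1 by (simp add: field_simps)
next
  case (Suc A)
  let ?t = "1 / (u * q ^ Suc A)"
  have 1: "1 - u * q ^ A / q ^ B \<noteq> 0" using uq[of A B] by auto
  have 2: "1 - ?t * q ^ B \<noteq> 0" using uq[of "Suc A" B] u by (auto simp: field_simps)
  have "qpoch q ?t B * (1 - ?t * q ^ B) = (1 - ?t) * qpoch q (?t * q) B"
    using qpoch_Suc[of q ?t B] qpoch_Suc_left[of q ?t B] by simp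
  moreover have "?t * q = 1 / (u * q ^ A)" by simp
  ultimately have t: "qpoch q ?t B * (1 - ?t * q ^ B) = (1 - ?t) * qpoch q (1 / (u * q ^ A)) B" by simp
  define X where "X = qpoch q (u / q ^ B) A"
  define Z where "Z = qpoch q (1 / (u * q ^ A)) B"
  define Z' where "Z' = qpoch q ?t B"
  have e1: "(1 - u * q ^ Suc A / q ^ B) * q ^ B = - (u * q ^ Suc A) * (1 - ?t * q ^ B)"
    using u by (simp add: field_simps)
  have e2: "- (u * q ^ Suc A) * (1 - ?t) = 1 - q * u * q ^ A"
    using u by (simp add: field_simps)
  have p: "q ^ (B + Suc A * B) = q ^ B * q ^ (B + A * B)" by (simp add: power_add)
  have X': "qpoch q (u / q ^ B) (Suc A) = X * (1 - u * q ^ A / q ^ B)" by (simp add: qpoch_Suc X_def)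
  have "X * (1 - u * q ^ A / q ^ B) * Z' * ((1 - u * q ^ Suc A / q ^ B) / (1 - u)) * (q ^ B * q ^ (B + A * B))
     = X * (1 - u * q ^ A / q ^ B) * Z' * (((1 - u * q ^ Suc A / q ^ B) * q ^ B) / (1 - u)) * q ^ (B + A * B)"
    by simp
  also have "\<dots> = X * (1 - u * q ^ A / q ^ B) * (Z' * (1 - ?t * q ^ B)) * (- (u * q ^ Suc A)) / (1 - u) * q ^ (B + A * B)"
    unfolding e1 by simp
  also have "Z' * (1 - ?t * q ^ B) = (1 - ?t) * Z" using t by (simp add: Z_def Z'_def)
  also have "X * (1 - u * q ^ A / q ^ B) * ((1 - ?t) * Z) * (- (u * q ^ Suc A)) / (1 - u) * q ^ (B + A * B) =
     (- (u * q ^ Suc A) * (1 - ?t)) * (X * Z * ((1 - u * q ^ A / q ^ B) / (1 - u)) * q ^ (B + A * B))" by simp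
  also have "\<dots> = (1 - q * u * q ^ A) * (qpoch q (q * u) A * qpoch q (q / u) B)"
    unfolding e2 Suc.IH[folded X_def Z_def] ..
  also have "\<dots> = qpoch q (q * u) (Suc A) * qpoch q (q / u) B" by (simp add: qpoch_Suc)
  finally show ?case unfolding X' p Z'_def .
qed

lemma qpoch_diag: "qpoch q (1 / q ^ k) k * ((-1) ^ k * q ^ (Suc k choose 2)) = qpoch q q k"
proof (induction k)
  case (Suc k)
  have "qpoch q (1 / q ^ Suc k) (Suc k) = (1 - 1 / q ^ Suc k) * qpoch q (1 / q ^ k) k"
    by (simp add: qpoch_Suc_left)
  moreover have "(-1) ^ Suc k * q ^ (Suc (Suc k) choose 2) = ((-1) ^ k * q ^ (Suc k choose 2)) * (- (q ^ Suc k))"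
    unfolding choose_2_Suc[of "Suc k"] by (simp add: power_add)
  ultimately have "qpoch q (1 / q ^ Suc k) (Suc k) * ((-1) ^ Suc k * q ^ (Suc (Suc k) choose 2)) =
     (1 - 1 / q ^ Suc k) * (- (q ^ Suc k)) * (qpoch q (1 / q ^ k) k * ((-1) ^ k * q ^ (Suc k choose 2)))"
    by (simp only: ac_simps)
  also have "\<dots> = (1 - q ^ Suc k) * qpoch q q k" unfolding Suc by (simp add: field_simps)
  finally show ?case by (simp add: qpoch_Suc)
qed (simp add: numeral_2_eq_2)

definition vdm :: "(nat \<Rightarrow> complex) \<Rightarrow> (nat \<Rightarrow> nat) \<Rightarrow> complex" where
  "vdm x k = (\<Prod>(r, s)\<in>index_pairs n. (1 - x r * q ^ k r / (x s * q ^ k s)) / (1 - x r / x s))"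

lemma generic_ratio:
  assumes "generic x" "r \<in> {1..n}" "s \<in> {1..n}" "r \<noteq> s"
  shows "x r / x s \<noteq> 0" "x r / x s * q ^ i \<noteq> q ^ j"
  using generic_neq[OF assms, of i j] generic_nz[OF assms(1,2)] generic_nz[OF assms(1,3)]
  by (auto simp: field_simps)

lemma index_pairsD: "(r, s) \<in> index_pairs n \<Longrightarrow> r \<in> {1..n} \<and> s \<in> {1..n} \<and> r \<noteq> s"
  by (auto simp: index_pairs_def)

text \<open>Diagonal entries are converted by \<open>qpoch_diag\<close>, pairs of opposite entries
  by \<open>qpoch_pair\<close>. The exponents produced, \<open>Suc (k r) choose 2\<close> and
  \<open>k s + k r * k s\<close>, add up to \<open>Suc (mi_size n k) choose 2\<close> plus the sum
  of the \<open>(r - 1) * k r\<close>.\<close>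

lemma wt_eq_vdm:
  assumes x: "generic x"
  shows "wt x a k = vdm x k * (\<Prod>r=1..n. \<Prod>s=1..n. qpoch q (a s * x r / x s) (k r) / qpoch q (q * x r / x s) (k r)) *
    q ^ (\<Sum>r=1..n. (r - 1) * k r)"
proof -
  define D where "D = (\<Prod>r=1..n. \<Prod>s=1..n. qpoch q (x r / (x s * q ^ k s)) (k r))"
  define D' where "D' = (\<Prod>r=1..n. \<Prod>s=1..n. qpoch q (q * x r / x s) (k r))"
  define E where "E = (-1) ^ mi_size n k * q ^ (Suc (mi_size n k) choose 2) * q ^ (\<Sum>r=1..n. (r - 1) * k r)"
  have pairs: "qpoch q (x r / (x s * q ^ k s)) (k r) * qpoch q (x s / (x r * q ^ k r)) (k s) *
      ((1 - x r * q ^ k r / (x s * q ^ k s)) / (1 - x r / x s)) * q ^ (k s + k r * k s) =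
      qpoch q (q * x r / x s) (k r) * qpoch q (q * x s / x r) (k s)" if "(r, s) \<in> index_pairs n" for r s
    using qpoch_pair[OF generic_ratio[OF x, of r s], of "k s" "k r"] index_pairsD[OF that] by simp
  have diag: "qpoch q (x r / (x r * q ^ k r)) (k r) * ((-1) ^ k r * q ^ (Suc (k r) choose 2)) = qpoch q (q * x r / x r) (k r)"
    if "r \<in> {1..n}" for r
    using qpoch_diag[of "k r"] generic_nz[OF x that] by simp
  have E: "E = (\<Prod>r=1..n. (-1) ^ k r * q ^ (Suc (k r) choose 2)) * (\<Prod>(r, s)\<in>index_pairs n. q ^ (k s + k r * k s))"
  proof -
    have "(\<Prod>(r, s)\<in>index_pairs n. q ^ (k s + k r * k s)) = q ^ ((\<Sum>r=1..n. (r - 1) * k r) + elem_sym2 n k)"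
      unfolding sum_pairs_snd [symmetric] elem_sym2_def by (simp add: case_prod_unfold power_sum sum.distrib [symmetric])
    moreover have "(\<Prod>r=1..n. (-1) ^ k r * q ^ (Suc (k r) choose 2)) = (-1) ^ mi_size n k * q ^ (mi_size n k + (\<Sum>r=1..n. k r choose 2))"
      unfolding prod.distrib choose_2_Suc by (simp add: mi_size_def power_sum power_add prod.distrib)
    ultimately show ?thesis unfolding E_def choose_2_Suc mi_size_choose_2 by (simp add: power_add)
  qed
  have DV: "D * vdm x k * E = D'"
  proof -
    have "D * vdm x k * E = (\<Prod>r=1..n. qpoch q (x r / (x r * q ^ k r)) (k r) * ((-1) ^ k r * q ^ (Suc (k r) choose 2))) *
      (\<Prod>(r, s)\<in>index_pairs n. qpoch q (x r / (x s * q ^ k s)) (k r) * qpoch q (x s / (x r * q ^ k r)) (k s) *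
      ((1 - x r * q ^ k r / (x s * q ^ k s)) / (1 - x r / x s)) * q ^ (k s + k r * k s))"
      unfolding D_def E vdm_def prod_square case_prod_unfold prod.distrib by (simp only: ac_simps)
    also have "\<dots> = D'"
      unfolding D'_def prod_square
      by (intro arg_cong2[where f = "(*)"] prod.cong refl) (use diag pairs in auto)
    finally show ?thesis .
  qed
  have D: "D \<noteq> 0" unfolding D_def using generic_qpoch_nz[OF x] by simp
  have E0: "E \<noteq> 0" by (simp add: E_def)
  have V0: "vdm x k \<noteq> 0"
  proof -
    have "(1 - x r * q ^ k r / (x s * q ^ k s)) / (1 - x r / x s) \<noteq> 0" if "(r, s) \<in> index_pairs n" for r s
      using generic_shift_nz[OF x, of r s "k r" "k s"] generic_shift_nz[OF x, of r s 0 0] index_pairsD[OF that] by auto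
    then show ?thesis unfolding vdm_def using finite_index_pairs by (auto simp: prod_zero_iff case_prod_unfold)
  qed
  define N where "N = (\<Prod>r=1..n. \<Prod>s=1..n. qpoch q (a s * x r / x s) (k r))"
  have "wt x a k = (-1) ^ mi_size n k / q ^ (Suc (mi_size n k) choose 2) * (N / D)" by (simp add: wt_def N_def D_def)
  also have "\<dots> = vdm x k * (N / D') * q ^ (\<Sum>r=1..n. (r - 1) * k r)"
    unfolding DV [symmetric] using D E0 V0 by (simp add: E_def field_simps flip: power_mult_distrib)
  also have "N / D' = (\<Prod>r=1..n. \<Prod>s=1..n. qpoch q (a s * x r / x s) (k r) / qpoch q (q * x r / x s) (k r))"
    by (simp add: N_def D'_def prod_dividef)
  finally show ?thesis .
qed

section \<open>The very-well-poised series in one variable\<close>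

text \<open>What is left of a summand with \<open>|i| = p\<close> and \<open>|k - i| = m\<close>
  after the weights and the powers of \<open>v\<close> are split off. The division by
  \<open>qpoch q q p\<close> compensates for the same factor kept in the summand for
  \<open>i\<close>.\<close>

definition vwp_coeff :: "complex \<Rightarrow> complex \<Rightarrow> nat \<Rightarrow> nat \<Rightarrow> complex" where
  "vwp_coeff \<tau> v p m = (1 - \<tau> * q ^ (2 * (p + m))) * qpoch q (\<tau> * q ^ (p + m)) p * qpoch q q (p + m) / qpoch q q p *
     ((-1) ^ m * q ^ (m choose 2)) / qpoch q v (Suc (p + m))"

lemma q_choose_2_tendsto_0:
  fixes g :: "nat \<Rightarrow> complex"
  assumes "bounded (range g)"
  shows "(\<lambda>m. q ^ (m choose 2) * g m) \<longlonglongrightarrow> 0"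
proof -
  have "m - 1 \<le> m choose 2" for m by (cases m) (auto simp: choose_2_Suc)
  then have "filterlim (\<lambda>m. m choose 2) at_top sequentially"
    by (intro filterlim_at_top_mono[OF filterlim_minus_const_nat_at_top[of 1]] always_eventually) auto
  then have "(\<lambda>m. q ^ (m choose 2)) \<longlonglongrightarrow> 0"
    by (rule filterlim_compose[rotated]) (use q_lt_1 in \<open>auto intro: LIMSEQ_power_zero\<close>)
  moreover obtain B where "\<And>m. norm (g m) \<le> B" using assms by (auto simp: bounded_iff)
  ultimately show ?thesis by (intro lim_null_mult_right_bounded[of _ _ g B]) auto
qed

lemma bounded_prod_linear:
  assumes "norm v \<le> 1"
  shows "bounded (range (\<lambda>m. \<Prod>i<m. v - \<tau> * q ^ (p + i)))"
proof -
  have "norm (v - \<tau> * q ^ (p + i)) \<le> 1 + norm \<tau> * norm q ^ i" for i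
  proof -
    have "norm (v - \<tau> * q ^ (p + i)) \<le> norm v + norm \<tau> * norm q ^ (p + i)"
      using norm_triangle_ineq4[of v "\<tau> * q ^ (p + i)"] by (simp add: norm_mult norm_power)
    also have "\<dots> \<le> 1 + norm \<tau> * norm q ^ i"
      using assms q_lt_1 by (intro add_mono mult_left_mono power_decreasing) auto
    finally show ?thesis .
  qed
  then have "norm (\<Prod>i<m. v - \<tau> * q ^ (p + i)) \<le> exp (norm \<tau> / (1 - norm q))" for m
    by (intro norm_prod_le_exp) auto
  then show ?thesis by (auto simp: bounded_iff)
qed

lemma bounded_minus_1_power: "bounded (range (\<lambda>m. (-1 :: complex) ^ f m))"
  by (auto simp: bounded_iff norm_power intro!: exI[of _ 1])

text \<open>For \<open>v = Y * \<tau>\<close> this is the limit, as one parameter tends to infinity,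
  of the nonterminating 6-phi-5 sum with base \<open>\<tau> * q ^ (2 * p)\<close> and parameters
  \<open>q ^ Suc p\<close> and \<open>q ^ p / Y\<close>, normalised to the value 1.\<close>

lemma vwp_sums:
  assumes v: "norm v \<le> 1" and nz: "\<And>m. qpoch q v m \<noteq> 0"
  shows "(\<lambda>m. vwp_coeff \<tau> v p m * (\<Prod>i<m. v - \<tau> * q ^ (p + i)) / qpoch q q m) sums 1"
proof (induction p)
  case 0
  \<comment> \<open>An antidifference of the summand: in \<open>1 - \<tau> * q ^ (2 * m) = (1 - v *
    q ^ m) + q ^ m * (v - \<tau> * q ^ m)\<close> the first part produces \<open>K m\<close> and the
    second \<open>- K (Suc m)\<close>.\<close>
  define K where "K m = (-1) ^ m * q ^ (m choose 2) * (\<Prod>i<m. v - \<tau> * q ^ i) / qpoch q v m" for m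
  have K: "K = (\<lambda>m. q ^ (m choose 2) * ((-1) ^ m * (\<Prod>i<m. v - \<tau> * q ^ i) * (1 / qpoch q v m)))"
    by (simp add: K_def fun_eq_iff)
  have "K \<longlonglongrightarrow> 0"
    unfolding K using bounded_prod_linear[OF v, of \<tau> 0]
    by (intro q_choose_2_tendsto_0 bounded_range_mult bounded_minus_1_power bounded_inverse_qpoch nz) simp
  from telescope_sums'[OF this] have "(\<lambda>m. K m - K (Suc m)) sums 1" by (simp add: K_def numeral_2_eq_2)
  moreover have "vwp_coeff \<tau> v 0 m * (\<Prod>i<m. v - \<tau> * q ^ (0 + i)) / qpoch q q m = K m - K (Suc m)" for m
  proof -
    have "1 - v * q ^ m \<noteq> 0" using nz[of "Suc m"] by (auto simp: qpoch_Suc)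
    define Z where "Z = (-1) ^ m * q ^ (m choose 2) * (\<Prod>i<m. v - \<tau> * q ^ i) / qpoch q v (Suc m)"
    have "K m = Z * (1 - v * q ^ m)" using \<open>1 - v * q ^ m \<noteq> 0\<close> by (simp add: K_def Z_def qpoch_Suc)
    moreover have "K (Suc m) = - (q ^ m * (v - \<tau> * q ^ m)) * Z"
      by (simp add: K_def Z_def choose_2_Suc power_add)
    moreover have "1 - \<tau> * q ^ (2 * m) = (1 - v * q ^ m) + q ^ m * (v - \<tau> * q ^ m)"
      by (simp add: right_diff_distrib mult_2 power_add)
    moreover have "vwp_coeff \<tau> v 0 m * (\<Prod>i<m. v - \<tau> * q ^ (0 + i)) / qpoch q q m = (1 - \<tau> * q ^ (2 * m)) * Z"
      by (simp add: vwp_coeff_def Z_def)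
    ultimately show ?thesis by (simp only:) (simp add: algebra_simps)
  qed
  ultimately show ?case by simp
next
  case (Suc p)
  define T where "T p m = vwp_coeff \<tau> v p m * (\<Prod>i<m. v - \<tau> * q ^ (p + i)) / qpoch q q m" for p m
  \<comment> \<open>\<open>- H\<close> is the WZ certificate: \<open>T (Suc p) m - T p (Suc m)\<close> is a difference in \<open>m\<close>, and \<open>H 0\<close>
    makes up for the missing term \<open>T p 0\<close>.\<close>
  define H where "H m = (-1) ^ m * q ^ (m choose 2) * qpoch q (\<tau> * q ^ (p + m)) (Suc p) *
    qpoch q q (Suc (p + m)) * (\<Prod>i<m. v - \<tau> * q ^ (Suc p + i)) / (qpoch q q (Suc p) * qpoch q q m * qpoch q v (Suc (p + m)))" for m
  have H_alt: "H = (\<lambda>m. q ^ (m choose 2) * ((-1) ^ m * qpoch q (\<tau> * q ^ (p + m)) (Suc p) *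
    qpoch q q (Suc (p + m)) * (\<Prod>i<m. v - \<tau> * q ^ (Suc p + i)) * (1 / qpoch q q (Suc p)) * (1 / qpoch q q m) * (1 / qpoch q v (Suc (p + m)))))"
    by (simp add: H_def fun_eq_iff)
  have bd: "bounded (range (\<lambda>m. \<tau> * q ^ (p + m)))"
  proof -
    have "norm (\<tau> * q ^ (p + m)) \<le> norm \<tau> * 1" for m
      unfolding norm_mult norm_power using q_lt_1 by (intro mult_left_mono power_le_one) auto
    then show ?thesis by (auto simp: bounded_iff)
  qed
  have bq: "bounded (range (\<lambda>m. qpoch q q (Suc (p + m))))"
    by (rule bounded_qpoch) simp
  have "H \<longlonglongrightarrow> 0"
    unfolding H_alt
    by (intro q_choose_2_tendsto_0 bounded_range_mult bounded_minus_1_power bounded_prod_linear[OF v] bounded_qpoch[OF bd] bq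
        bounded_inverse_qpoch bounded_range_comp[OF bounded_inverse_qpoch[OF nz]]) auto
  from telescope_sums'[OF this] have H_sums: "(\<lambda>m. H m - H (Suc m)) sums H 0" by simp
  have diff: "T (Suc p) m = T p (Suc m) + (H m - H (Suc m))" for m
  proof -
    define a where "a = q ^ p"
    define X where "X = q ^ m"
    define P where "P = (\<Prod>i<m. v - \<tau> * q ^ (Suc p + i))"
    define R where "R = qpoch q (\<tau> * q ^ (Suc (p + m))) p"
    define s where "s = (-1) ^ m * q ^ (m choose 2)"
    \<comment> \<open>All four terms are multiples of \<open>Z\<close>, and what remains is a
      polynomial identity in \<open>a\<close>, \<open>X\<close>, \<open>q\<close>, \<open>v\<close>,
      \<open>\<tau>\<close>.\<close>
    define Z where "Z = s * R * qpoch q q (Suc (p + m)) * P / (qpoch q q (Suc p) * qpoch q q (Suc m) * qpoch q v (Suc (Suc (p + m))))"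
    have nzs: "1 - q * q ^ m \<noteq> 0" "1 - q * q ^ p \<noteq> 0" "1 - v * q ^ Suc (p + m) \<noteq> 0"
      using q_power_eq_1[of "Suc m"] q_power_eq_1[of "Suc p"] nz[of "Suc (Suc (p + m))"] by (auto simp: qpoch_Suc)
    have e1: "1 / qpoch q q m = (1 - q * X) / qpoch q q (Suc m)" using nzs by (simp add: qpoch_Suc X_def)
    have e2: "1 / qpoch q q p = (1 - q * a) / qpoch q q (Suc p)" using nzs by (simp add: qpoch_Suc a_def)
    have e3: "1 / qpoch q v (Suc (p + m)) = (1 - v * (a * q * X)) / qpoch q v (Suc (Suc (p + m)))"
    proof -
      have e: "v * (a * q * X) = v * q ^ Suc (p + m)" by (simp add: a_def X_def power_add ac_simps)
      show ?thesis unfolding e qpoch_Suc[of q v "Suc (p + m)"] using nzs(3) by simp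
    qed
    have T1: "T (Suc p) m = Z * ((1 - \<tau> * (a * X * q)^2) * (1 - \<tau> * a^2 * q * X) * (1 - q * X))"
    proof -
      have "T (Suc p) m = (1 - \<tau> * (a * X * q)^2) * (R * (1 - \<tau> * a^2 * q * X)) * qpoch q q (Suc (p + m)) * s * P *
         (1 / qpoch q q (Suc p)) * (1 / qpoch q q m) * (1 / qpoch q v (Suc (Suc (p + m))))"
        unfolding T_def vwp_coeff_def s_def P_def R_def a_def X_def
        by (simp add: qpoch_Suc power_add power_mult ac_simps power2_eq_square)
      then show ?thesis unfolding e1 Z_def by simp
    qed
    have T2: "T p (Suc m) = Z * ((1 - \<tau> * (a * X * q)^2) * (1 - q * a) * (- X * (v - \<tau> * a)))"
    proof -
      have "(\<Prod>i<Suc m. v - \<tau> * q ^ (p + i)) = (v - \<tau> * a) * P"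
        unfolding prod.lessThan_Suc_shift P_def a_def by simp
      then have "T p (Suc m) = (1 - \<tau> * (a * X * q)^2) * R * qpoch q q (Suc (p + m)) * (- X * s) * ((v - \<tau> * a) * P) *
         (1 / qpoch q q p) * (1 / qpoch q q (Suc m)) * (1 / qpoch q v (Suc (Suc (p + m))))"
        unfolding T_def vwp_coeff_def s_def R_def choose_2_Suc
        by (simp add: power_add power_mult ac_simps power2_eq_square X_def a_def)
      then show ?thesis unfolding e2 Z_def by simp
    qed
    have H1: "H m = Z * ((1 - \<tau> * a * X) * (1 - q * X) * (1 - v * (a * q * X)))"
    proof -
      have "qpoch q (\<tau> * q ^ (p + m)) (Suc p) = (1 - \<tau> * a * X) * R"
        unfolding qpoch_Suc_left R_def a_def X_def by (simp add: power_add ac_simps)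
      then have "H m = s * ((1 - \<tau> * a * X) * R) * qpoch q q (Suc (p + m)) * P * (1 / qpoch q q (Suc p)) * (1 / qpoch q q m) * (1 / qpoch q v (Suc (p + m)))"
        unfolding H_def s_def P_def by simp
      then show ?thesis unfolding e1 e3 Z_def by simp
    qed
    have H2: "H (Suc m) = Z * (- X * (1 - \<tau> * a^2 * q * X) * (1 - a * X * q^2) * (v - \<tau> * a * q * X))"
    proof -
      have "qpoch q (\<tau> * q ^ (p + Suc m)) (Suc p) = R * (1 - \<tau> * a^2 * q * X)"
        unfolding qpoch_Suc R_def a_def X_def by (simp add: power_add ac_simps power2_eq_square)
      moreover have "qpoch q q (Suc (p + Suc m)) = qpoch q q (Suc (p + m)) * (1 - a * X * q^2)"
        using qpoch_Suc[of q q "Suc (p + m)"] by (simp add: power_add ac_simps power2_eq_square a_def X_def)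
      moreover have "(\<Prod>i<Suc m. v - \<tau> * q ^ (Suc p + i)) = P * (v - \<tau> * a * q * X)"
        by (simp add: P_def a_def X_def power_add ac_simps)
      ultimately have "H (Suc m) = - X * s * (R * (1 - \<tau> * a^2 * q * X)) * (qpoch q q (Suc (p + m)) * (1 - a * X * q^2)) * (P * (v - \<tau> * a * q * X)) /
         (qpoch q q (Suc p) * qpoch q q (Suc m) * qpoch q v (Suc (Suc (p + m))))"
        unfolding H_def s_def choose_2_Suc by (simp add: power_add X_def ac_simps)
      then show ?thesis unfolding Z_def by simp
    qed
    show ?thesis unfolding T1 T2 H1 H2 by algebra
  qed
  have "T p sums 1" using Suc unfolding T_def .
  then have "(\<lambda>m. T p (Suc m)) sums (1 - T p 0)" by (simp add: sums_Suc_iff)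
  moreover have "T p 0 = H 0"
    using binomial_eq_0[of 0 2]
    by (simp add: T_def H_def vwp_coeff_def qpoch_Suc[of q "\<tau> * q ^ p" p] mult_2 power_add)
  ultimately have "T (Suc p) sums (1 - H 0 + H 0)" unfolding diff[abs_def] using H_sums by (intro sums_add) auto
  then show ?case unfolding T_def by simp
qed

end

section \<open>Exchanging the summations\<close>

lemma summable_on_power_mi_size:
  fixes \<rho> :: real
  assumes "0 \<le> \<rho>" "\<rho> < 1"
  shows "(\<lambda>j. \<rho> ^ mi_size n j) summable_on multi_indices n"
proof (rule nonneg_bdd_above_summable_on)
  show "bdd_above (sum (\<lambda>j. \<rho> ^ mi_size n j) ` {F. F \<subseteq> multi_indices n \<and> finite F})"
  proof (rule bdd_aboveI2)
    fix F assume F: "F \<in> {F. F \<subseteq> multi_indices n \<and> finite F}"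
    define N where "N = Max (insert 0 ((\<lambda>(j, r). j r) ` (F \<times> {1..n})))"
    have N: "j r \<le> N" if "j \<in> F" "r \<in> {1..n}" for j r
      unfolding N_def by (rule Max_ge) (use F that in \<open>auto intro!: image_eqI[of _ _ "(j, r)"]\<close>)
    have "sum (\<lambda>j. \<rho> ^ mi_size n j) F \<le> sum (\<lambda>j. \<rho> ^ mi_size n j) (\<Pi>\<^sub>E r\<in>{1..n}. {..N})"
    proof (rule sum_mono2)
      show "F \<subseteq> (\<Pi>\<^sub>E r\<in>{1..n}. {..N})"
      proof
        fix j assume "j \<in> F"
        then show "j \<in> (\<Pi>\<^sub>E r\<in>{1..n}. {..N})" using F N by (auto simp: multi_indices_def PiE_def)
      qed
    qed (use assms in \<open>auto intro: finite_PiE\<close>)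
    also have "\<dots> = (\<Sum>j\<in>(\<Pi>\<^sub>E r\<in>{1..n}. {..N}). \<Prod>r\<in>{1..n}. \<rho> ^ j r)"
      by (simp add: mi_size_def power_sum)
    also have "\<dots> = (\<Prod>r\<in>{1..n}. \<Sum>i\<le>N. \<rho> ^ i)"
      by (rule prod_sum_PiE [symmetric]) auto
    also have "\<dots> \<le> (\<Prod>r\<in>{1..n}. 1 / (1 - \<rho>))"
    proof (rule prod_mono)
      have "(\<Sum>i\<le>N. \<rho> ^ i) \<le> (\<Sum>i. \<rho> ^ i)"
        using assms by (intro sum_le_suminf summable_geometric) auto
      also have "\<dots> = 1 / (1 - \<rho>)" using assms by (intro suminf_geometric) auto
      finally show "0 \<le> (\<Sum>i\<le>N. \<rho> ^ i) \<and> (\<Sum>i\<le>N. \<rho> ^ i) \<le> 1 / (1 - \<rho>)"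
        using assms by (auto intro: sum_nonneg)
    qed
    finally show "sum (\<lambda>j. \<rho> ^ mi_size n j) F \<le> (\<Prod>r\<in>{1..n}. 1 / (1 - \<rho>))" .
  qed
qed (use assms in auto)

lemma bounded_range_diff:
  fixes f g :: "'a \<Rightarrow> complex"
  assumes "bounded (range f)" "bounded (range g)"
  shows "bounded (range (\<lambda>t. f t - g t))"
  by (rule bounded_subset[OF bounded_minus[OF assms]]) auto

context q_base
begin

lemma bounded_q_power: "bounded (range (\<lambda>t. q ^ f t))"
  using q_lt_1 by (auto simp: bounded_iff norm_power intro!: exI[of _ 1] power_le_one)

text \<open>Uniform in both multi-indices, as the exchange of summations requires. Shifting the
  parameters along with the points helps: in the numerator the powers \<open>q ^ i s\<close> cancel,
  so that only \<open>q ^ i r\<close> remains.\<close>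

lemma bounded_wt_shift:
  assumes x: "generic x"
  shows "bounded (range (\<lambda>t. wt (\<lambda>r. x r * q ^ fst t r) (\<lambda>s. a s * q ^ fst t s) (snd t)))"
proof -
  have shift: "bounded (range (\<lambda>t. 1 / qpoch q (w * (x r * q ^ fst t r) / (x s * q ^ fst t s)) (m t)))"
    if "(r \<in> {1..n}) \<and> s \<in> {1..n}" "r \<noteq> s" "w = 1 \<or> w = q" for r s w and m :: "(nat \<Rightarrow> nat) \<times> (nat \<Rightarrow> nat) \<Rightarrow> nat"
  proof -
    have nz: "w * (x r / x s) \<noteq> 0" using generic_ratio(1)[OF x, of r s] that by auto
    have neq: "w * (x r / x s) * q ^ i \<noteq> q ^ j" for i j
      using generic_ratio(2)[OF x, of r s i j] generic_ratio(2)[OF x, of r s "Suc i" j] that by (auto simp: ac_simps)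
    show ?thesis
      using bounded_range_comp[OF bounded_inverse_qpoch_shift[OF nz neq], of "\<lambda>t. (fst t r, fst t s, m t)"]
      by (simp add: mult.assoc)
  qed
  \<comment> \<open>The ratio \<open>U\<close> of two shifted points is unbounded, but
    \<open>1 / (1 - U)\<close> is bounded; hence each Vandermonde factor is rewritten with
    \<open>U / (1 - U) = 1 / (1 - U) - 1\<close>. The power of \<open>q\<close> in the weight
    provides the \<open>q ^ snd t s\<close> that absorbs the negative power in that factor.\<close>
  have eq: "wt (\<lambda>r. x r * q ^ fst t r) (\<lambda>s. a s * q ^ fst t s) (snd t) =
    (\<Prod>(r, s)\<in>index_pairs n. q ^ snd t s * (1 / qpoch q (1 * (x r * q ^ fst t r) / (x s * q ^ fst t s)) 1)
        - q ^ snd t r * (1 / qpoch q (1 * (x r * q ^ fst t r) / (x s * q ^ fst t s)) 1 - 1)) *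
    (\<Prod>r=1..n. \<Prod>s=1..n. qpoch q (a s * x r / x s * q ^ fst t r) (snd t r) *
       (1 / (qpoch q (q * (x r * q ^ fst t r) / (x s * q ^ fst t s)) (snd t r))))" for t
  proof -
    have "vdm (\<lambda>r. x r * q ^ fst t r) (snd t) * q ^ (\<Sum>r=1..n. (r - 1) * snd t r) =
      (\<Prod>(r, s)\<in>index_pairs n. (1 - x r * q ^ fst t r * q ^ snd t r / (x s * q ^ fst t s * q ^ snd t s)) / (1 - x r * q ^ fst t r / (x s * q ^ fst t s)) * q ^ snd t s)"
      unfolding vdm_def sum_pairs_snd [symmetric] power_sum case_prod_unfold prod.distrib ..
    also have "\<dots> = (\<Prod>(r, s)\<in>index_pairs n. q ^ snd t s * (1 / qpoch q (1 * (x r * q ^ fst t r) / (x s * q ^ fst t s)) 1)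
        - q ^ snd t r * (1 / qpoch q (1 * (x r * q ^ fst t r) / (x s * q ^ fst t s)) 1 - 1))"
    proof (rule prod.cong[OF refl])
      fix p assume p: "p \<in> index_pairs n"
      obtain r s where rs: "p = (r, s)" by (cases p)
      have "(r, s) \<in> index_pairs n" using p rs by simp
      then have i: "r \<in> {1..n}" "s \<in> {1..n}" "r \<noteq> s" using index_pairsD by blast+
      define U where "U = x r * q ^ fst t r / (x s * q ^ fst t s)"
      have U1: "1 - U \<noteq> 0" unfolding U_def by (rule generic_shift_nz[OF x i])
      have e: "x r * q ^ fst t r * q ^ snd t r / (x s * q ^ fst t s * q ^ snd t s) = U * q ^ snd t r / q ^ snd t s"
        by (simp add: U_def)
      have "(1 - U * q ^ snd t r / q ^ snd t s) / (1 - U) * q ^ snd t s =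
         q ^ snd t s * (1 / qpoch q U 1) - q ^ snd t r * (1 / qpoch q U 1 - 1)"
      proof -
        have 1: "qpoch q U 1 = 1 - U" by (simp add: qpoch_def One_nat_def)
        have 2: "1 / (1 - U) - 1 = U / (1 - U)" using U1 by (simp add: field_simps)
        have 3: "(1 - U * q ^ snd t r / q ^ snd t s) * q ^ snd t s = q ^ snd t s - U * q ^ snd t r"
          by (simp add: left_diff_distrib)
        have "(1 - U * q ^ snd t r / q ^ snd t s) / (1 - U) * q ^ snd t s = (q ^ snd t s - U * q ^ snd t r) / (1 - U)"
          unfolding 3 [symmetric] by simp
        then show ?thesis unfolding 1 2 by (simp add: diff_divide_distrib ac_simps)
      qed
      then show "(case p of (r, s) \<Rightarrow> (1 - x r * q ^ fst t r * q ^ snd t r / (x s * q ^ fst t s * q ^ snd t s)) / (1 - x r * q ^ fst t r / (x s * q ^ fst t s)) * q ^ snd t s) =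
        (case p of (r, s) \<Rightarrow> q ^ snd t s * (1 / qpoch q (1 * (x r * q ^ fst t r) / (x s * q ^ fst t s)) 1)
        - q ^ snd t r * (1 / qpoch q (1 * (x r * q ^ fst t r) / (x s * q ^ fst t s)) 1 - 1))"
        unfolding rs prod.case e mult_1 U_def [symmetric] .
    qed
    finally have v: "vdm (\<lambda>r. x r * q ^ fst t r) (snd t) * q ^ (\<Sum>r=1..n. (r - 1) * snd t r) = \<dots>" .
    have w: "(\<Prod>r=1..n. \<Prod>s=1..n. qpoch q (a s * q ^ fst t s * (x r * q ^ fst t r) / (x s * q ^ fst t s)) (snd t r) /
         qpoch q (q * (x r * q ^ fst t r) / (x s * q ^ fst t s)) (snd t r)) =
       (\<Prod>r=1..n. \<Prod>s=1..n. qpoch q (a s * x r / x s * q ^ fst t r) (snd t r) *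
       (1 / (qpoch q (q * (x r * q ^ fst t r) / (x s * q ^ fst t s)) (snd t r))))"
      by (intro prod.cong refl) (simp add: ac_simps)
    show ?thesis
      unfolding wt_eq_vdm[OF generic_shift[OF x]] v [symmetric] w [symmetric] by (simp only: ac_simps)
  qed
  have num: "bounded (range (\<lambda>t. a s * x r / x s * q ^ fst t r))" for r s
    by (intro bounded_range_mult bounded_q_power) simp
  have den: "bounded (range (\<lambda>t. 1 / (qpoch q (q * (x r * q ^ fst t r) / (x s * q ^ fst t s)) (snd t r))))"
    if rs: "r \<in> {1..n}" "s \<in> {1..n}" for r s
  proof (cases "r = s")
    case True
    have e: "(\<lambda>t. 1 / (qpoch q (q * (x r * q ^ fst t r) / (x s * q ^ fst t s)) (snd t r))) = (\<lambda>t. 1 / qpoch q q (snd t r))"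
      using generic_nz[OF x rs(1)] True by (simp add: fun_eq_iff)
    show ?thesis unfolding e using bounded_range_comp[OF bounded_inverse_qpoch[of q], of "\<lambda>t. snd t r"] by simp
  qed (use rs shift in auto)
  show ?thesis unfolding eq case_prod_unfold
    by (intro bounded_range_mult bounded_range_prod bounded_range_diff bounded_q_power bounded_qpoch num den shift)
       (use index_pairsD in \<open>auto simp: finite_index_pairs\<close>)
qed

lemma bounded_vwp_coeff:
  assumes nz: "\<And>m. qpoch q v m \<noteq> 0"
  shows "bounded (range (\<lambda>t. vwp_coeff \<tau> v (f t) (g t)))"
proof -
  have \<tau>: "bounded (range (\<lambda>t. \<tau> * q ^ h t))" for h :: "'a \<Rightarrow> nat"
    by (intro bounded_range_mult bounded_q_power) simp
  have 1: "bounded (range (\<lambda>t. 1 - \<tau> * q ^ h t))" for h :: "'a \<Rightarrow> nat"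
    by (intro bounded_range_diff \<tau>) simp
  have 2: "bounded (range (\<lambda>t. qpoch q q (h t)))" for h :: "'a \<Rightarrow> nat"
    by (rule bounded_qpoch) simp
  have "(\<lambda>t. vwp_coeff \<tau> v (f t) (g t)) = (\<lambda>t. (1 - \<tau> * q ^ (2 * (f t + g t))) * qpoch q (\<tau> * q ^ (f t + g t)) (f t) *
     qpoch q q (f t + g t) * (1 / qpoch q q (f t)) *
     ((-1) ^ g t * q ^ (g t choose 2)) * (1 / qpoch q v (Suc (f t + g t))))"
    by (simp add: vwp_coeff_def)
  then show ?thesis
    by (simp only:) (intro bounded_range_mult 1 2 bounded_qpoch \<tau> bounded_minus_1_power bounded_q_power
      bounded_range_comp[OF bounded_inverse_qpoch[OF qpoch_q_nz]] bounded_range_comp[OF bounded_inverse_qpoch[OF nz]])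
qed


lemma prod_linear_eq:
  assumes "Y \<noteq> 0"
  shows "(\<Prod>i<m. Y * \<tau> - \<tau> * q ^ (p + i)) = (Y * \<tau>) ^ m * qpoch q (q ^ p / Y) m"
proof -
  have "(\<Prod>i<m. Y * \<tau> - \<tau> * q ^ (p + i)) = (\<Prod>i<m. Y * \<tau> * (1 - q ^ p / Y * q ^ i))"
    by (rule prod.cong) (use assms in \<open>auto simp: field_simps power_add\<close>)
  then show ?thesis by (simp add: qpoch_def prod.distrib)
qed

text \<open>Summability comes from elsewhere; the level sums only identify the value.\<close>

lemma has_sum_over_levels:
  assumes sm: "f summable_on multi_indices n" and s: "(\<lambda>l. \<Sum>m\<in>level l. f m) sums (S :: complex)"
  shows "(f has_sum S) (multi_indices n)"
proof -
  obtain S' where S': "(f has_sum S') (multi_indices n)" using sm by (auto simp: summable_on_def)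
  have "((\<lambda>(l, m). f m) has_sum S') (Sigma UNIV level) \<longleftrightarrow> (f has_sum S') (multi_indices n)"
    by (rule has_sum_reindex_bij_witness[where i = "\<lambda>m. (mi_size n m, m)" and j = snd]) (auto simp: level_def)
  then have "((\<lambda>(l, m). f m) has_sum S') (Sigma UNIV level)" using S' by simp
  then have "((\<lambda>l. \<Sum>m\<in>level l. f m) has_sum S') UNIV"
    by (rule has_sum_SigmaD) (simp add: finite_level)
  then have "(\<lambda>l. \<Sum>m\<in>level l. f m) sums S'" by (rule has_sum_imp_sums)
  then have "S' = S" using s sums_unique2 by blast
  then show ?thesis using S' by simp
qed

text \<open>In the application \<open>S\<close> contains everything that depends on
  \<open>b\<close>, \<open>c\<close>, \<open>\<beta>\<close>; only its boundedness matters. The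
  double family \<open>f\<close> is summed in two ways: over \<open>m\<close> for fixed
  \<open>i\<close>, and over all pairs with \<open>i + m = k\<close>.\<close>

lemma expansion_has_sum:
  fixes x y :: "nat \<Rightarrow> complex"
  assumes x: "generic x" and y: "\<And>r. r \<in> {1..n} \<Longrightarrow> y r \<noteq> 0"
  defines "Y \<equiv> \<Prod>r=1..n. y r"
  assumes v: "norm (Y * \<tau>) < 1" and nzv: "\<And>m. qpoch q (Y * \<tau>) m \<noteq> 0"
    and S: "bounded (range S)"
  shows "\<exists>T. ((\<lambda>i. wt x (\<lambda>s. 1 / y s) i * (Y * \<tau>) ^ mi_size n i * qpoch q q (mi_size n i) * S i) has_sum T) (multi_indices n) \<and>
    ((\<lambda>k. wt x (\<lambda>s. 1 / y s) k * ((1 - \<tau> * q ^ (2 * mi_size n k)) * qpoch q q (mi_size n k) / qpoch q (Y * \<tau>) (Suc (mi_size n k))) *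
      (- (Y * \<tau>)) ^ mi_size n k * q ^ (mi_size n k choose 2) *
      (\<Sum>i\<in>multi_indices_le n k. wt x (qinv k) i * q ^ mi_size n i * qpoch q (\<tau> * q ^ mi_size n k) (mi_size n i) * S i))
     has_sum T) (multi_indices n)"
proof -
  define a where "a s = 1 / y s" for s
  define w where "w i m = wt (\<lambda>r. x r * q ^ i r) (\<lambda>s. a s * q ^ i s) m" for i m
  define L where "L i = wt x a i * (Y * \<tau>) ^ mi_size n i * qpoch q q (mi_size n i) * S i" for i
  define f where "f = (\<lambda>(i, m). L i * (w i m * vwp_coeff \<tau> (Y * \<tau>) (mi_size n i) (mi_size n m) * (Y * \<tau>) ^ mi_size n m))"
  have Y: "Y \<noteq> 0" unfolding Y_def using y by auto
  have bw: "bounded (range (\<lambda>t. w (fst t) (snd t)))" unfolding w_def by (rule bounded_wt_shift[OF x])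
  have bw0: "bounded (range (wt x a))"
    using bounded_range_comp[OF bw, of "\<lambda>i. (\<lambda>_. 0, i)"] by (simp add: w_def)
  define g where "g t = wt x a (fst t) * qpoch q q (mi_size n (fst t)) * S (fst t) * (w (fst t) (snd t) * vwp_coeff \<tau> (Y * \<tau>) (mi_size n (fst t)) (mi_size n (snd t)))" for t
  have "bounded (range g)" unfolding g_def
    by (intro bounded_range_mult bounded_range_comp[OF bw0] bounded_range_comp[OF S] bw bounded_vwp_coeff[OF nzv] bounded_qpoch) simp
  then obtain C where C: "\<And>t. norm (g t) \<le> C" by (auto simp: bounded_iff)
  define \<rho> where "\<rho> = norm (Y * \<tau>)"
  have \<rho>: "0 \<le> \<rho>" "\<rho> < 1" using v by (auto simp: \<rho>_def)
  \<comment> \<open>The two geometric powers carry all the decay that is used; \<open>g\<close> is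
    the uniformly bounded rest.\<close>
  have f_eq: "f t = g t * (Y * \<tau>) ^ mi_size n (fst t) * (Y * \<tau>) ^ mi_size n (snd t)" for t
    by (cases t) (simp add: f_def g_def L_def)
  have sum2: "(\<lambda>(i, m). \<rho> ^ mi_size n i * \<rho> ^ mi_size n m) summable_on (multi_indices n \<times> multi_indices n)"
  proof -
    have s1: "(\<lambda>j. \<rho> ^ mi_size n j) summable_on multi_indices n" by (rule summable_on_power_mi_size[OF \<rho>])
    have "(\<lambda>t. norm ((\<lambda>(i, m). \<rho> ^ mi_size n i * \<rho> ^ mi_size n m) t)) summable_on (multi_indices n \<times> multi_indices n)"
      unfolding Infinite_Sum.abs_summable_on_Sigma_iff
    proof (intro conjI ballI)
      fix i
      show "(\<lambda>m. norm (case (i, m) of (i, m) \<Rightarrow> \<rho> ^ mi_size n i * \<rho> ^ mi_size n m)) summable_on multi_indices n"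
        using s1 \<rho> by (simp add: abs_mult summable_on_cmult_right)
    next
      have "(\<Sum>\<^sub>\<infinity>m\<in>multi_indices n. norm (case (i, m) of (i, m) \<Rightarrow> \<rho> ^ mi_size n i * \<rho> ^ mi_size n m)) =
        \<rho> ^ mi_size n i * (\<Sum>\<^sub>\<infinity>m\<in>multi_indices n. \<rho> ^ mi_size n m)" for i
        using \<rho> by (simp add: abs_mult infsum_cmult_right')
      moreover have "0 \<le> (\<Sum>\<^sub>\<infinity>m\<in>multi_indices n. \<rho> ^ mi_size n m)" using \<rho> by (intro infsum_nonneg) auto
      ultimately show "(\<lambda>i. norm (\<Sum>\<^sub>\<infinity>m\<in>multi_indices n. norm (case (i, m) of (i, m) \<Rightarrow> \<rho> ^ mi_size n i * \<rho> ^ mi_size n m))) summable_on multi_indices n"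
        using s1 \<rho> by (simp add: abs_mult summable_on_cmult_left)
    qed
    then show ?thesis by (rule abs_summable_summable)
  qed
  have sf: "(\<lambda>t. norm (f t)) summable_on (multi_indices n \<times> multi_indices n)"
  proof (rule Infinite_Sum.abs_summable_on_comparison_test)
    show "(\<lambda>t. norm (C * (case t of (i, m) \<Rightarrow> \<rho> ^ mi_size n i * \<rho> ^ mi_size n m))) summable_on (multi_indices n \<times> multi_indices n)"
    proof -
      have "0 \<le> C" using C norm_ge_zero order_trans by blast
      then have "norm (C * (case t of (i, m) \<Rightarrow> \<rho> ^ mi_size n i * \<rho> ^ mi_size n m)) = C * (case t of (i, m) \<Rightarrow> \<rho> ^ mi_size n i * \<rho> ^ mi_size n m)" for t
        using \<rho> by (cases t) (simp add: abs_mult)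
      then show ?thesis using summable_on_cmult_right[OF sum2, of C] by simp
    qed
    fix t
    have C0: "0 \<le> C" using C norm_ge_zero order_trans by blast
    have "norm (f t) = norm (g t) * (\<rho> ^ mi_size n (fst t) * \<rho> ^ mi_size n (snd t))"
      unfolding f_eq by (simp add: norm_mult norm_power \<rho>_def mult.assoc)
    also have "\<dots> \<le> C * (\<rho> ^ mi_size n (fst t) * \<rho> ^ mi_size n (snd t))"
      by (rule mult_right_mono[OF C]) (use \<rho> in auto)
    finally have "norm (f t) \<le> C * (\<rho> ^ mi_size n (fst t) * \<rho> ^ mi_size n (snd t))" .
    then show "norm (f t) \<le> norm (C * (case t of (i, m) \<Rightarrow> \<rho> ^ mi_size n i * \<rho> ^ mi_size n m))"
      using C0 \<rho> by (cases t) (simp add: abs_mult)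
  qed
  then obtain T where T: "(f has_sum T) (multi_indices n \<times> multi_indices n)"
    using abs_summable_summable by (auto simp: summable_on_def)
  have inner: "((\<lambda>m. f (i, m)) has_sum L i) (multi_indices n)" if i: "i \<in> multi_indices n" for i
  proof (rule has_sum_over_levels)
    have "(\<lambda>m. norm (f (i, m))) summable_on multi_indices n"
      using sf i unfolding Infinite_Sum.abs_summable_on_Sigma_iff by blast
    then show "(\<lambda>m. f (i, m)) summable_on multi_indices n" by (rule abs_summable_summable)
    define p where "p = mi_size n i"
    \<comment> \<open>By \<open>sum_wt_level\<close> only this product of the shifted parameters
      survives on each level, so the sum over \<open>m\<close> depends on \<open>i\<close> only
      through \<open>p\<close> and becomes the series of \<open>vwp_sums\<close>.\<close>
    have "(\<Prod>s=1..n. a s * q ^ i s) = q ^ p / Y"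
      by (simp add: a_def Y_def p_def prod.distrib mi_size_def power_sum prod_dividef)
    then have lev: "(\<Sum>m\<in>level l. w i m) = qpoch q (q ^ p / Y) l / qpoch q q l" for l
      unfolding w_def sum_wt_level[OF generic_shift[OF x]] by simp
    have "(\<Sum>m\<in>level l. f (i, m)) = L i * (vwp_coeff \<tau> (Y * \<tau>) p l * (\<Prod>j<l. Y * \<tau> - \<tau> * q ^ (p + j)) / qpoch q q l)" for l
    proof -
      have "(\<Sum>m\<in>level l. f (i, m)) = (\<Sum>m\<in>level l. w i m * (L i * (vwp_coeff \<tau> (Y * \<tau>) p l * (Y * \<tau>) ^ l)))"
        by (intro sum.cong refl) (simp add: f_def level_def p_def)
      also have "\<dots> = L i * (vwp_coeff \<tau> (Y * \<tau>) p l * (\<Prod>j<l. Y * \<tau> - \<tau> * q ^ (p + j)) / qpoch q q l)"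
        unfolding sum_distrib_right [symmetric] lev prod_linear_eq[OF Y] by (simp add: ac_simps)
      finally show ?thesis .
    qed
    moreover have "(\<lambda>l. L i * (vwp_coeff \<tau> (Y * \<tau>) p l * (\<Prod>j<l. Y * \<tau> - \<tau> * q ^ (p + j)) / qpoch q q l)) sums (L i * 1)"
      by (intro sums_mult vwp_sums nzv) (use v in auto)
    ultimately show "(\<lambda>l. \<Sum>m\<in>level l. f (i, m)) sums L i" by simp
  qed
  have LT: "(L has_sum T) (multi_indices n)"
    by (rule has_sum_SigmaD[OF T]) (rule inner)
  define R where "R k = (\<Sum>i\<in>multi_indices_le n k. f (i, \<lambda>r\<in>{1..n}. k r - i r))" for k
  have "((\<lambda>(k, i). f (i, \<lambda>r\<in>{1..n}. k r - i r)) has_sum T) (Sigma (multi_indices n) (multi_indices_le n)) \<longleftrightarrow> (f has_sum T) (multi_indices n \<times> multi_indices n)"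
  proof (rule has_sum_reindex_bij_witness[where j = "\<lambda>(k, i). (i, \<lambda>r\<in>{1..n}. k r - i r)" and i = "\<lambda>(i, m). (\<lambda>r\<in>{1..n}. i r + m r, i)"])
    fix t assume "t \<in> Sigma (multi_indices n) (multi_indices_le n)"
    then obtain k i where t: "t = (k, i)" "k \<in> multi_indices n" "i \<in> multi_indices n" "\<And>r. r \<in> {1..n} \<Longrightarrow> i r \<le> k r"
      by (auto simp: multi_indices_le_iff)
    have "(\<lambda>r\<in>{1..n}. i r + (\<lambda>r\<in>{1..n}. k r - i r) r) = k"
      using t(2,4) by (auto simp: fun_eq_iff multi_indices_def PiE_def extensional_def)
    then show "(case case t of (k, i) \<Rightarrow> (i, \<lambda>r\<in>{1..n}. k r - i r) of (i, m) \<Rightarrow> (\<lambda>r\<in>{1..n}. i r + m r, i)) = t"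
      using t(1) by simp
    show "(case t of (k, i) \<Rightarrow> (i, \<lambda>r\<in>{1..n}. k r - i r)) \<in> multi_indices n \<times> multi_indices n"
      using t by (auto simp: multi_indices_def)
  next
    fix t assume "t \<in> multi_indices n \<times> multi_indices n"
    then obtain i m where t: "t = (i, m)" "m \<in> multi_indices n" "i \<in> multi_indices n" by auto
    have "(\<lambda>r\<in>{1..n}. (\<lambda>r\<in>{1..n}. i r + m r) r - i r) = m"
      using t(2) by (auto simp: fun_eq_iff multi_indices_def PiE_def extensional_def)
    then show "(case case t of (i, m) \<Rightarrow> (\<lambda>r\<in>{1..n}. i r + m r, i) of (k, i) \<Rightarrow> (i, \<lambda>r\<in>{1..n}. k r - i r)) = t"
      using t(1) by simp
    show "(case t of (i, m) \<Rightarrow> (\<lambda>r\<in>{1..n}. i r + m r, i)) \<in> Sigma (multi_indices n) (multi_indices_le n)"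
      using t by (auto simp: multi_indices_le_iff) (auto simp: multi_indices_def)
  qed auto
  then have "((\<lambda>(k, i). f (i, \<lambda>r\<in>{1..n}. k r - i r)) has_sum T) (Sigma (multi_indices n) (multi_indices_le n))"
    using T by simp
  then have RT: "(R has_sum T) (multi_indices n)"
    by (rule has_sum_SigmaD) (simp add: R_def finite_multi_indices_le)
  have R_eq: "R k = wt x a k * ((1 - \<tau> * q ^ (2 * mi_size n k)) * qpoch q q (mi_size n k) / qpoch q (Y * \<tau>) (Suc (mi_size n k))) *
      (- (Y * \<tau>)) ^ mi_size n k * q ^ (mi_size n k choose 2) *
      (\<Sum>i\<in>multi_indices_le n k. wt x (qinv k) i * q ^ mi_size n i * qpoch q (\<tau> * q ^ mi_size n k) (mi_size n i) * S i)" for k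
    unfolding R_def sum_distrib_left
  proof (intro sum.cong refl)
    fix i assume i: "i \<in> multi_indices_le n k"
    define m where "m = (\<lambda>r\<in>{1..n}. k r - i r)"
    define N where "N = mi_size n k"
    define p where "p = mi_size n i"
    define M where "M = mi_size n m"
    have k: "k r = i r + m r" if "r \<in> {1..n}" for r using i that by (simp add: m_def multi_indices_le_iff)
    have N: "N = p + M" unfolding N_def p_def M_def mi_size_def sum.distrib [symmetric] by (rule sum.cong) (use k in auto)
    have c1: "wt x a (\<lambda>r. i r + m r) = wt x a k" by (rule wt_cong) (use k in auto)
    have c2: "wt x (qinv (\<lambda>r. i r + m r)) i = wt x (qinv k) i" by (rule wt_cong) (use k in \<open>auto simp: qinv_def\<close>)
    \<comment> \<open>The correction factor of \<open>wt_mult\<close>. Dividing by it changes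
      \<open>M choose 2\<close> into \<open>N choose 2\<close>, because
      \<open>Suc M choose 2 = M + (M choose 2)\<close> and likewise for \<open>N\<close>; the
      difference \<open>N - M\<close> leaves \<open>q ^ p\<close>.\<close>
    define E where "E = (-1) ^ p * q ^ (Suc M choose 2) / q ^ (Suc N choose 2)"
    have W: "wt x a i * w i m * E = wt x a k * wt x (qinv k) i"
      using wt_mult[OF x, of a i m] unfolding c1 c2 w_def E_def N p_def M_def by simp
    have E0: "E \<noteq> 0" by (simp add: E_def)
    have W': "wt x a i * w i m = wt x a k * wt x (qinv k) i / E" using W E0 by (simp add: field_simps)
    have "f (i, m) = (wt x a i * w i m) * vwp_coeff \<tau> (Y * \<tau>) p M * qpoch q q p * ((Y * \<tau>) ^ p * (Y * \<tau>) ^ M) * S i"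
      by (simp add: f_def L_def p_def M_def)
    also have "\<dots> = wt x a k * wt x (qinv k) i * (1 - \<tau> * q ^ (2 * N)) * qpoch q (\<tau> * q ^ N) p * qpoch q q N *
      ((-1) ^ M * q ^ (M choose 2) / E) / qpoch q (Y * \<tau>) (Suc N) * (Y * \<tau>) ^ N * S i"
      unfolding W' vwp_coeff_def N [symmetric] power_add [symmetric] by simp
    also have "(-1) ^ M * q ^ (M choose 2) / E = (-1) ^ N * q ^ (N choose 2) * q ^ p"
    proof -
      show ?thesis unfolding E_def choose_2_Suc by (cases "even p") (simp_all add: N power_add)
    qed
    finally show "f (i, \<lambda>r\<in>{1..n}. k r - i r) = wt x a k * ((1 - \<tau> * q ^ (2 * mi_size n k)) * qpoch q q (mi_size n k) / qpoch q (Y * \<tau>) (Suc (mi_size n k))) *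
      (- (Y * \<tau>)) ^ mi_size n k * q ^ (mi_size n k choose 2) *
      (wt x (qinv k) i * q ^ mi_size n i * qpoch q (\<tau> * q ^ mi_size n k) (mi_size n i) * S i)"
      unfolding m_def [symmetric] N_def [symmetric] p_def [symmetric] power_minus[of "Y * \<tau>"] by (simp add: ac_simps)
  qed
  show ?thesis using LT RT unfolding L_def[abs_def] R_eq[abs_def] a_def[abs_def] by blast
qed

section \<open>Matching the summands of the theorem\<close>

text \<open>The numerator outside the inner sum divided by the denominator inside leaves the last
  \<open>k - j\<close> factors. Up to monomials these are the factors of the node polynomial for
  \<open>k - j\<close>, in reverse order.\<close>

lemma node_poly_factor:
  assumes "x \<noteq> 0" "\<beta> \<noteq> 0" "j \<le> k" "qpoch q (A * q / q ^ k / (\<beta> * x)) j \<noteq> 0"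
  shows "(\<beta> * x) ^ k * q ^ (k choose 2) * (qpoch q (A * q / q ^ k / (\<beta> * x)) k / qpoch q (A * q / q ^ k / (\<beta> * x)) j) =
    (-1) ^ (k - j) * (\<Prod>i<k - j. A - \<beta> * x * q ^ i) * ((\<beta> * x) ^ j * q ^ ((j choose 2) + (k - j) * j))"
proof -
  define m where "m = k - j"
  have k: "k = j + m" using assms(3) by (simp add: m_def)
  define u where "u = \<beta> * x"
  have u: "u \<noteq> 0" using assms by (simp add: u_def)
  have rev: "u ^ m * q ^ (m choose 2) * qpoch q (A * q / q ^ m / u) m = (-1) ^ m * (\<Prod>i<m. A - u * q ^ i)"
  proof (induction m)
    case (Suc m)
    have "qpoch q (A * q / q ^ Suc m / u) (Suc m) = (1 - A / q ^ m / u) * qpoch q (A * q / q ^ m / u) m"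
      by (simp add: qpoch_Suc_left ac_simps)
    then have "u ^ Suc m * q ^ (Suc m choose 2) * qpoch q (A * q / q ^ Suc m / u) (Suc m) =
      (u * q ^ m * (1 - A / q ^ m / u)) * (u ^ m * q ^ (m choose 2) * qpoch q (A * q / q ^ m / u) m)"
      unfolding choose_2_Suc by (simp add: power_add)
    also have "u * q ^ m * (1 - A / q ^ m / u) = - (A - u * q ^ m)" using u by (simp add: field_simps)
    finally show ?case unfolding Suc prod.lessThan_Suc power_Suc by (simp only: mult_minus_left mult_minus_right mult_1_left ac_simps)
  qed (simp add: numeral_2_eq_2)
  have "qpoch q (A * q / q ^ k / u) k = qpoch q (A * q / q ^ k / u) j * qpoch q (A * q / q ^ m / u) m"
  proof -
    have "A * q / q ^ k / u * q ^ j = A * q / q ^ m / u" by (simp add: k power_add)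
    then show ?thesis by (subst (2) k) (simp only: qpoch_add)
  qed
  then have "qpoch q (A * q / q ^ k / u) k / qpoch q (A * q / q ^ k / u) j = qpoch q (A * q / q ^ m / u) m"
    using assms(4) by (simp add: u_def)
  moreover have "u ^ k * q ^ (k choose 2) = u ^ j * q ^ ((j choose 2) + m * j) * (u ^ m * q ^ (m choose 2))"
    unfolding k choose_2_add by (simp add: power_add ac_simps)
  ultimately have "u ^ k * q ^ (k choose 2) * (qpoch q (A * q / q ^ k / u) k / qpoch q (A * q / q ^ k / u) j) =
     u ^ j * q ^ ((j choose 2) + m * j) * (u ^ m * q ^ (m choose 2) * qpoch q (A * q / q ^ m / u) m)" by simp
  then show ?thesis unfolding rev unfolding u_def m_def by (simp add: ac_simps)
qed


lemma vdm_powi: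
  "(\<Prod>(r, s)\<in>index_pairs n. (1 - q powi (int (k r) - int (k s)) * x r / x s) / (1 - x r / x s)) = vdm x k"
  unfolding vdm_def by (intro prod.cong refl) (auto simp: power_int_diff ac_simps)

lemma lhs_term:
  assumes x: "generic x"
  shows "(\<Prod>(r, s)\<in>index_pairs n. (1 - q powi (int (j r) - int (j s)) * x r / x s) / (1 - x r / x s))
      * (\<Prod>r=1..n. \<Prod>s=1..n. qpoch q (x r / (x s * y s)) (j r) / qpoch q (q * x r / x s) (j r))
      * v ^ mi_size n j
      * q ^ (\<Sum>r=1..n. (r - 1) * j r)
      * (qpoch q q (mi_size n j) * qpoch q c (mi_size n j) / qpoch q (b * c) (mi_size n j))
      * (\<Prod>r=1..n. 1 / qpoch q (\<beta> * x r) (j r)) =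
    wt x (\<lambda>s. 1 / y s) j * v ^ mi_size n j * qpoch q q (mi_size n j) *
      (qpoch q c (mi_size n j) / qpoch q (b * c) (mi_size n j) / node_qpoch x \<beta> j)"
proof -
  have "(\<Prod>r=1..n. \<Prod>s=1..n. qpoch q (x r / (x s * y s)) (j r) / qpoch q (q * x r / x s) (j r)) =
    (\<Prod>r=1..n. \<Prod>s=1..n. qpoch q (1 / y s * x r / x s) (j r) / qpoch q (q * x r / x s) (j r))"
    by (intro prod.cong refl) (simp add: ac_simps)
  moreover have "(\<Prod>r=1..n. 1 / qpoch q (\<beta> * x r) (j r)) = 1 / node_qpoch x \<beta> j"
    by (simp add: node_qpoch_def prod_dividef)
  ultimately show ?thesis unfolding vdm_powi wt_eq_vdm[OF x] by simp
qed

text \<open>Part of the outer prefactor is moved into the inner sum, where it combines with the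
  denominators to the node polynomial at \<open>A = \<tau> * q ^ N\<close>; the remaining factors
  are the weight at the dual points.\<close>

lemma rhs_inner:
  fixes j k :: "nat \<Rightarrow> nat" and x :: "nat \<Rightarrow> complex"
  assumes x: "generic x" and \<beta>: "\<beta> \<noteq> 0" and j: "j \<in> multi_indices_le n k"
    and nz: "\<And>r. r \<in> {1..n} \<Longrightarrow> qpoch q (\<tau> * q powi (1 - int (k r) + int (mi_size n k)) / (\<beta> * x r)) (j r) \<noteq> 0"
  defines "N \<equiv> mi_size n k" and "l \<equiv> mi_size n j"
  shows "\<beta> ^ N * q ^ (\<Sum>r=1..n. (k r choose 2)) * (\<Prod>r=1..n. qpoch q (q powi (1 + int N - int (k r)) * \<tau> / (\<beta> * x r)) (k r)) * (\<Prod>r=1..n. x r ^ k r) *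
      ((\<Prod>(r, s)\<in>index_pairs n.
                (1 - q powi (int (k s) - int (k r) + int (j r) - int (j s)) * x s / x r)
                / (1 - q powi (int (k s) - int (k r)) * x s / x r))
          * q powi (int N * int l - (\<Sum>r=1..n. int (k r) * int (j r))
                    - int (elem_sym2 n j) + (\<Sum>r=1..n. int r * int (j r)))
          * (\<Prod>r=1..n. \<Prod>s=1..n.
                qpoch q (q powi (- int (k r)) * x s / x r) (j r)
                / qpoch q (q powi (1 + int (k s) - int (k r)) * x s / x r) (j r))
          * (\<Prod>r=1..n.
                x r powi (- int (j r))
                / qpoch q (\<tau> * q powi (1 - int (k r) + int N) / (\<beta> * x r)) (j r))
          * (c / \<beta>) ^ l
          * (qpoch q (\<tau> * q ^ N) l * qpoch q b l
              / qpoch q (b * c) l)) =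
    (-1) ^ N * (wt (dual x k) (qinv k) j * node_poly x \<beta> (\<lambda>s. k s - j s) (\<tau> * q ^ N) *
      ((-1) ^ l * q ^ (N * l) / q ^ (l choose 2) * c ^ l *
       qpoch q (\<tau> * q ^ N) l * qpoch q b l / qpoch q (b * c) l))"
proof -
  have jk: "j r \<le> k r" if "r \<in> {1..n}" for r using j that by (auto simp: multi_indices_le_iff)
  have xnz: "x r \<noteq> 0" if "r \<in> {1..n}" for r using generic_nz[OF x that] .
  define A where "A = \<tau> * q ^ N"
  define g where "g r = A * q / q ^ k r / (\<beta> * x r)" for r
  have g1: "q powi (1 + int N - int (k r)) * \<tau> / (\<beta> * x r) = g r" for r
    by (simp add: g_def A_def power_int_diff power_int_add ac_simps)
  have g2: "\<tau> * q powi (1 - int (k r) + int N) / (\<beta> * x r) = g r" for r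
    by (simp add: g_def A_def power_int_diff power_int_add ac_simps)
  have gnz: "qpoch q (g r) (j r) \<noteq> 0" if "r \<in> {1..n}" for r
    using nz[OF that] unfolding N_def [symmetric] g2 .
  have V: "(\<Prod>(r, s)\<in>index_pairs n.
                (1 - q powi (int (k s) - int (k r) + int (j r) - int (j s)) * x s / x r)
                / (1 - q powi (int (k s) - int (k r)) * x s / x r)) = vdm (dual x k) j"
    unfolding vdm_def
  proof (intro prod.cong refl)
    fix p assume "p \<in> index_pairs n"
    obtain r s where p: "p = (r, s)" by (cases p)
    have e1: "q powi (int (k s) - int (k r) + int (j r) - int (j s)) * x s / x r = dual x k r * q ^ j r / (dual x k s * q ^ j s)"
      by (simp add: power_int_diff power_int_add dual_def ac_simps)
    have e2: "q powi (int (k s) - int (k r)) * x s / x r = dual x k r / dual x k s"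
      by (simp add: power_int_diff power_int_add dual_def ac_simps)
    show "(case p of (r, s) \<Rightarrow> (1 - q powi (int (k s) - int (k r) + int (j r) - int (j s)) * x s / x r)
                / (1 - q powi (int (k s) - int (k r)) * x s / x r)) =
       (case p of (r, s) \<Rightarrow> (1 - dual x k r * q ^ j r / (dual x k s * q ^ j s)) / (1 - dual x k r / dual x k s))"
      unfolding p prod.case e1 e2 ..
  qed
  have Q: "(\<Prod>r=1..n. \<Prod>s=1..n. qpoch q (q powi (- int (k r)) * x s / x r) (j r)
                / qpoch q (q powi (1 + int (k s) - int (k r)) * x s / x r) (j r)) =
     (\<Prod>r=1..n. \<Prod>s=1..n. qpoch q (qinv k s * dual x k r / dual x k s) (j r) / qpoch q (q * dual x k r / dual x k s) (j r))"
  proof (intro prod.cong refl)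
    fix r s
    have e1: "q powi (- int (k r)) * x s / x r = qinv k s * dual x k r / dual x k s"
      by (simp add: power_int_minus dual_def qinv_def field_simps)
    have e2: "q powi (1 + int (k s) - int (k r)) * x s / x r = q * dual x k r / dual x k s"
      by (simp add: power_int_diff power_int_add dual_def ac_simps)
    show "qpoch q (q powi (- int (k r)) * x s / x r) (j r)
                / qpoch q (q powi (1 + int (k s) - int (k r)) * x s / x r) (j r) =
       qpoch q (qinv k s * dual x k r / dual x k s) (j r) / qpoch q (q * dual x k r / dual x k s) (j r)"
      unfolding e1 e2 ..
  qed
  define QQ where "QQ = (\<Prod>r=1..n. \<Prod>s=1..n. qpoch q (qinv k s * dual x k r / dual x k s) (j r) / qpoch q (q * dual x k r / dual x k s) (j r))"
  define e where "e = (\<Sum>r=1..n. (j r choose 2) + (k r - j r) * j r)"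
  define X where "X = (\<Prod>r=1..n. x r ^ j r)"
  have X0: "X \<noteq> 0" unfolding X_def using xnz by auto
  have P: "\<beta> ^ N * q ^ (\<Sum>r=1..n. (k r choose 2)) * (\<Prod>r=1..n. qpoch q (g r) (k r)) * (\<Prod>r=1..n. x r ^ k r) *
     (\<Prod>r=1..n. x r powi (- int (j r)) / qpoch q (g r) (j r)) =
     (-1) ^ N * (-1) ^ l * node_poly x \<beta> (\<lambda>s. k s - j s) A * (\<beta> ^ l * q ^ e)"
  proof -
    have "\<beta> ^ N * q ^ (\<Sum>r=1..n. (k r choose 2)) * (\<Prod>r=1..n. qpoch q (g r) (k r)) * (\<Prod>r=1..n. x r ^ k r) *
     (\<Prod>r=1..n. x r powi (- int (j r)) / qpoch q (g r) (j r)) =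
     (\<Prod>r=1..n. (\<beta> * x r) ^ k r * q ^ (k r choose 2) * (qpoch q (g r) (k r) / qpoch q (g r) (j r)) * inverse (x r ^ j r))"
      unfolding N_def mi_size_def power_sum prod.distrib [symmetric]
      by (intro prod.cong refl) (simp add: power_int_minus power_mult_distrib divide_inverse ac_simps)
    also have "\<dots> = (\<Prod>r=1..n. (-1) ^ (k r - j r) * (\<Prod>i<k r - j r. A - \<beta> * x r * q ^ i) * (\<beta> ^ j r * q ^ ((j r choose 2) + (k r - j r) * j r)))"
    proof (intro prod.cong refl)
      fix r assume r: "r \<in> {1..n}"
      show "(\<beta> * x r) ^ k r * q ^ (k r choose 2) * (qpoch q (g r) (k r) / qpoch q (g r) (j r)) * inverse (x r ^ j r) =
        (-1) ^ (k r - j r) * (\<Prod>i<k r - j r. A - \<beta> * x r * q ^ i) * (\<beta> ^ j r * q ^ ((j r choose 2) + (k r - j r) * j r))"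
        unfolding g_def node_poly_factor[OF xnz[OF r] \<beta> jk[OF r] gnz[OF r, unfolded g_def]]
        using xnz[OF r] by (simp add: power_mult_distrib)
    qed
    also have "\<dots> = (-1) ^ (\<Sum>r=1..n. k r - j r) * node_poly x \<beta> (\<lambda>s. k s - j s) A * (\<beta> ^ l * q ^ e)"
      unfolding prod.distrib node_poly_def l_def mi_size_def e_def power_sum ..
    also have "(-1 :: complex) ^ (\<Sum>r=1..n. k r - j r) = (-1) ^ N * (-1) ^ l"
    proof -
      have "N = (\<Sum>r=1..n. k r - j r) + l" unfolding N_def l_def using mi_size_diff[of j k, OF jk] by (simp add: mi_size_def)
      then show ?thesis by (cases "even l") (simp_all add: power_add)
    qed
    finally show ?thesis .
  qed
  \<comment> \<open>\<open>e\<close> collects the exponents from \<open>node_poly_factor\<close>.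
    The terms \<open>k r * j r\<close> cancel by
    \<open>j r * j r = 2 * (j r choose 2) + j r\<close>, and \<open>mi_size_choose_2\<close> turns
    \<open>elem_sym2\<close> into \<open>l choose 2\<close>.\<close>
  have ex: "q ^ e * q powi (int N * int l - (\<Sum>r=1..n. int (k r) * int (j r)) - int (elem_sym2 n j) + (\<Sum>r=1..n. int r * int (j r))) =
    q ^ (N * l) / q ^ (l choose 2) * q ^ (\<Sum>r=1..n. (r - 1) * j r)"
  proof -
    have 1: "(\<Sum>r=1..n. int (k r) * int (j r)) = int (\<Sum>r=1..n. k r * j r)" "(\<Sum>r=1..n. int r * int (j r)) = int (\<Sum>r=1..n. r * j r)" by simp_all
    have "(\<Sum>r=1..n. r * j r) = (\<Sum>r=1..n. (r - 1) * j r + j r)"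
      by (intro sum.cong refl) (auto simp: algebra_simps One_nat_def intro: mult_eq_if)
    then have 2: "(\<Sum>r=1..n. r * j r) = (\<Sum>r=1..n. (r - 1) * j r) + l" by (simp add: sum.distrib l_def mi_size_def)
    have c2: "m * m = 2 * (m choose 2) + m" for m :: nat by (induction m) (auto simp: choose_2_Suc)
    have "k r * j r + (j r choose 2) = (j r choose 2) + (k r - j r) * j r + (2 * (j r choose 2) + j r)" if "r \<in> {1..n}" for r
    proof -
      have "k r * j r = (k r - j r) * j r + j r * j r" using jk[OF that] by (simp flip: add_mult_distrib)
      then show ?thesis using c2[of "j r"] by simp
    qed
    then have "(\<Sum>r=1..n. k r * j r + (j r choose 2)) = (\<Sum>r=1..n. (j r choose 2) + (k r - j r) * j r + (2 * (j r choose 2) + j r))"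
      by (intro sum.cong refl)
    then have 3: "(\<Sum>r=1..n. k r * j r) + (\<Sum>r=1..n. j r choose 2) = e + (2 * (\<Sum>r=1..n. j r choose 2) + l)"
      by (simp only: sum.distrib e_def l_def mi_size_def sum_distrib_left)
    have 4: "l choose 2 = (\<Sum>r=1..n. j r choose 2) + elem_sym2 n j" unfolding l_def by (rule mi_size_choose_2)
    have "int N * int l - int (\<Sum>r=1..n. k r * j r) - int (elem_sym2 n j) + int (\<Sum>r=1..n. r * j r) + int e =
       int (N * l + (\<Sum>r=1..n. (r - 1) * j r)) - int (l choose 2)"
      using 2 3 4 by simp
    then have "q powi (int e + (int N * int l - int (\<Sum>r=1..n. k r * j r) - int (elem_sym2 n j) + int (\<Sum>r=1..n. r * j r))) =
       q powi (int (N * l + (\<Sum>r=1..n. (r - 1) * j r)) - int (l choose 2))" by (simp only: add.commute)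
    also have "\<dots> = q ^ (N * l + (\<Sum>r=1..n. (r - 1) * j r)) / q ^ (l choose 2)"
      by (simp only: power_int_diff[OF disjI1[OF q_nz]] power_int_of_nat)
    finally show ?thesis unfolding 1 by (simp add: power_int_add power_add)
  qed
  have W: "wt (dual x k) (qinv k) j = vdm (dual x k) j * QQ * q ^ (\<Sum>r=1..n. (r - 1) * j r)"
    unfolding QQ_def by (rule wt_eq_vdm[OF generic_dual[OF x]])
  have cb: "(c / \<beta>) ^ l * \<beta> ^ l = c ^ l" using \<beta> by (simp add: power_divide)
  define E where "E = q powi (int N * int l - (\<Sum>r=1..n. int (k r) * int (j r)) - int (elem_sym2 n j) + (\<Sum>r=1..n. int r * int (j r)))"
  define PP where "PP = \<beta> ^ N * q ^ (\<Sum>r=1..n. (k r choose 2)) * (\<Prod>r=1..n. qpoch q (g r) (k r)) * (\<Prod>r=1..n. x r ^ k r)"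
  define GG where "GG = (\<Prod>r=1..n. x r powi (- int (j r)) / qpoch q (g r) (j r))"
  define BB where "BB = qpoch q (\<tau> * q ^ N) l * qpoch q b l / qpoch q (b * c) l"
  have "PP * (vdm (dual x k) j * E * QQ * GG * (c / \<beta>) ^ l * BB) = (PP * GG) * (vdm (dual x k) j * E * QQ * (c / \<beta>) ^ l * BB)"
    by (simp only: ac_simps)
  also have "\<dots> = (-1) ^ N * (-1) ^ l * node_poly x \<beta> (\<lambda>s. k s - j s) A * ((c / \<beta>) ^ l * \<beta> ^ l) * (q ^ e * E) * vdm (dual x k) j * QQ * BB"
    unfolding PP_def GG_def P by (simp only: ac_simps)
  also have "\<dots> = (-1) ^ N * (wt (dual x k) (qinv k) j * node_poly x \<beta> (\<lambda>s. k s - j s) A * ((-1) ^ l * q ^ (N * l) / q ^ (l choose 2) * c ^ l * BB))"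
    unfolding cb ex[folded E_def] W by (simp add: ac_simps)
  finally show ?thesis
    unfolding V Q g1 g2 PP_def GG_def E_def QQ_def BB_def A_def by (simp only: mult.assoc times_divide_eq_right)
qed

end

text \<open>A common \<open>has_sum\<close> value expresses unordered convergence of both multiple
  series together with their equality.\<close>

theorem theorem8p1:
  fixes q \<tau> \<beta> b c :: complex
    and n :: nat
    and x y :: "nat \<Rightarrow> complex"
  assumes q: "0 < norm q" "norm q < 1"
    and n: "n \<ge> 1"
    and conv: "norm ((\<Prod>r=1..n. y r) * \<tau>) < 1"
    and x_nz: "\<And>r. r \<in> {1..n} \<Longrightarrow> x r \<noteq> 0"
    and y_nz: "\<And>r. r \<in> {1..n} \<Longrightarrow> y r \<noteq> 0"
    and beta_nz: "\<beta> \<noteq> 0"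
    and den1: "\<And>r s. (r, s) \<in> index_pairs n \<Longrightarrow> 1 - x r / x s \<noteq> 0"
    and den2: "\<And>r s m. r \<in> {1..n} \<Longrightarrow> s \<in> {1..n} \<Longrightarrow> qpoch q (q * x r / x s) m \<noteq> 0"
    and den3: "\<And>m. qpoch q (b * c) m \<noteq> 0"
    and den4: "\<And>r m. r \<in> {1..n} \<Longrightarrow> qpoch q (\<beta> * x r) m \<noteq> 0"
    and den5: "\<And>m. qpoch q ((\<Prod>r=1..n. y r) * \<tau>) (m + 1) \<noteq> 0"
    and den6: "\<And>k r s. k \<in> multi_indices n \<Longrightarrow> (r, s) \<in> index_pairs n \<Longrightarrow>
                 1 - q powi (int (k s) - int (k r)) * x s / x r \<noteq> 0"
    and den7: "\<And>k j r s. k \<in> multi_indices n \<Longrightarrow> j \<in> multi_indices_le n k \<Longrightarrow>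
                 r \<in> {1..n} \<Longrightarrow> s \<in> {1..n} \<Longrightarrow>
                 qpoch q (q powi (1 + int (k s) - int (k r)) * x s / x r) (j r) \<noteq> 0"
    and den8: "\<And>k j r. k \<in> multi_indices n \<Longrightarrow> j \<in> multi_indices_le n k \<Longrightarrow> r \<in> {1..n} \<Longrightarrow>
                 qpoch q (\<tau> * q powi (1 - int (k r) + int (mi_size n k)) / (\<beta> * x r)) (j r) \<noteq> 0"
  shows "\<exists>S :: complex.
    ((\<lambda>j.
        (\<Prod>(r, s)\<in>index_pairs n.
            (1 - q powi (int (j r) - int (j s)) * x r / x s) / (1 - x r / x s))
      * (\<Prod>r=1..n. \<Prod>s=1..n.
            qpoch q (x r / (x s * y s)) (j r) / qpoch q (q * x r / x s) (j r))
      * ((\<Prod>r=1..n. y r) * \<tau>) ^ mi_size n j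
      * q ^ (\<Sum>r=1..n. (r - 1) * j r)
      * (qpoch q q (mi_size n j) * qpoch q c (mi_size n j) / qpoch q (b * c) (mi_size n j))
      * (\<Prod>r=1..n. 1 / qpoch q (\<beta> * x r) (j r)))
     has_sum S) (multi_indices n)
  \<and> ((\<lambda>k.
        (\<Prod>(r, s)\<in>index_pairs n.
            (1 - q powi (int (k r) - int (k s)) * x r / x s) / (1 - x r / x s))
      * (\<Prod>r=1..n. \<Prod>s=1..n.
            qpoch q (x r / (x s * y s)) (k r) / qpoch q (q * x r / x s) (k r))
      * ((1 - \<tau> * q ^ (2 * mi_size n k)) * qpoch q q (mi_size n k)
          / qpoch q ((\<Prod>r=1..n. y r) * \<tau>) (mi_size n k + 1))
      * ((\<Prod>r=1..n. y r) * \<beta> * \<tau>) ^ mi_size n k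
      * q ^ ((\<Sum>r=1..n. (r - 1) * k r) + (mi_size n k choose 2) + (\<Sum>r=1..n. (k r choose 2)))
      * (\<Prod>r=1..n.
            qpoch q (q powi (1 + int (mi_size n k) - int (k r)) * \<tau> / (\<beta> * x r)) (k r)
            / qpoch q (\<beta> * x r) (k r))
      * (\<Prod>r=1..n. x r ^ k r)
      * (\<Sum>j\<in>multi_indices_le n k.
            (\<Prod>(r, s)\<in>index_pairs n.
                (1 - q powi (int (k s) - int (k r) + int (j r) - int (j s)) * x s / x r)
                / (1 - q powi (int (k s) - int (k r)) * x s / x r))
          * q powi (int (mi_size n k) * int (mi_size n j) - (\<Sum>r=1..n. int (k r) * int (j r))
                    - int (elem_sym2 n j) + (\<Sum>r=1..n. int r * int (j r)))
          * (\<Prod>r=1..n. \<Prod>s=1..n.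
                qpoch q (q powi (- int (k r)) * x s / x r) (j r)
                / qpoch q (q powi (1 + int (k s) - int (k r)) * x s / x r) (j r))
          * (\<Prod>r=1..n.
                x r powi (- int (j r))
                / qpoch q (\<tau> * q powi (1 - int (k r) + int (mi_size n k)) / (\<beta> * x r)) (j r))
          * (c / \<beta>) ^ mi_size n j
          * (qpoch q (\<tau> * q ^ mi_size n k) (mi_size n j) * qpoch q b (mi_size n j)
              / qpoch q (b * c) (mi_size n j))))
     has_sum S) (multi_indices n)"
proof -
  interpret q_base q n by standard (use q in auto)
  define Y where "Y = (\<Prod>r=1..n. y r)"
  \<comment> \<open>Letting \<open>k r\<close> and \<open>k s\<close> in \<open>den6\<close> take
    arbitrary values \<open>i\<close> and \<open>j\<close> excludes every coincidence
    \<open>x r * q ^ i = x s * q ^ j\<close>.\<close>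
  have gen: "generic x"
  proof -
    have lt: "x r * q ^ i \<noteq> x s * q ^ j" if rs: "(r, s) \<in> index_pairs n" for r s i j
    proof
      assume e: "x r * q ^ i = x s * q ^ j"
      have "r \<in> {1..n}" "s \<in> {1..n}" "r \<noteq> s" using index_pairsD[OF rs] by blast+
      define k where "k = (\<lambda>t\<in>{1..n}. if t = r then i else j)"
      have k: "k \<in> multi_indices n" "k r = i" "k s = j"
        using \<open>r \<in> {1..n}\<close> \<open>s \<in> {1..n}\<close> \<open>r \<noteq> s\<close> by (auto simp: k_def multi_indices_def)
      have "1 - q powi (int j - int i) * x s / x r \<noteq> 0" using den6[OF k(1) rs] k by simp
      moreover have "q powi (int j - int i) * x s / x r = (x s * q ^ j) / (x r * q ^ i)"
        by (simp add: power_int_diff ac_simps)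
      ultimately show False using e x_nz[OF \<open>r \<in> {1..n}\<close>] x_nz[OF \<open>s \<in> {1..n}\<close>] by simp
    qed
    have "x r * q ^ i \<noteq> x s * q ^ j" if "r \<in> {1..n}" "s \<in> {1..n}" "r \<noteq> s" for r s i j
    proof (cases "r < s")
      case True
      then show ?thesis using lt[of r s i j] that by (simp add: index_pairs_def)
    next
      case False
      then show ?thesis using lt[of s r j i] that by (auto simp: index_pairs_def)
    qed
    then show ?thesis using x_nz by (simp add: generic_def)
  qed
  have nzv: "qpoch q (Y * \<tau>) m \<noteq> 0" for m
    by (cases m) (use den5[folded Suc_eq_plus1] in \<open>auto simp: Y_def\<close>)
  have nzB: "node_qpoch x \<beta> j \<noteq> 0" for j
    using den4 by (auto simp: node_qpoch_def)
  define S where "S i = qpoch q c (mi_size n i) / qpoch q (b * c) (mi_size n i) / node_qpoch x \<beta> i" for i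
  have conv': "norm (Y * \<tau>) < 1" using conv by (simp add: Y_def)
  have bS: "bounded (range S)"
  proof -
    have "S = (\<lambda>i. qpoch q c (mi_size n i) * (1 / qpoch q (b * c) (mi_size n i)) * (\<Prod>r=1..n. 1 / qpoch q (\<beta> * x r) (i r)))"
      by (simp add: S_def node_qpoch_def fun_eq_iff prod_dividef)
    then show ?thesis
      by (simp only:) (intro bounded_range_mult bounded_range_prod bounded_qpoch
        bounded_range_comp[OF bounded_inverse_qpoch[OF den3]] bounded_range_comp[OF bounded_inverse_qpoch[OF den4]], auto)
  qed
  obtain T where
    T1: "((\<lambda>i. wt x (\<lambda>s. 1 / y s) i * (Y * \<tau>) ^ mi_size n i * qpoch q q (mi_size n i) * S i) has_sum T) (multi_indices n)" and
    T2: "((\<lambda>k. wt x (\<lambda>s. 1 / y s) k * ((1 - \<tau> * q ^ (2 * mi_size n k)) * qpoch q q (mi_size n k) / qpoch q (Y * \<tau>) (Suc (mi_size n k))) *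
      (- (Y * \<tau>)) ^ mi_size n k * q ^ (mi_size n k choose 2) *
      (\<Sum>i\<in>multi_indices_le n k. wt x (qinv k) i * q ^ mi_size n i * qpoch q (\<tau> * q ^ mi_size n k) (mi_size n i) * S i))
     has_sum T) (multi_indices n)"
    using expansion_has_sum[where x = x and y = y and \<tau> = \<tau> and S = S, folded Y_def,
      OF gen y_nz conv' nzv bS] by blast
  show ?thesis
    unfolding Y_def [symmetric]
  proof (intro exI[of _ T] conjI)
    show "((\<lambda>j.
        (\<Prod>(r, s)\<in>index_pairs n.
            (1 - q powi (int (j r) - int (j s)) * x r / x s) / (1 - x r / x s))
      * (\<Prod>r=1..n. \<Prod>s=1..n.
            qpoch q (x r / (x s * y s)) (j r) / qpoch q (q * x r / x s) (j r))
      * (Y * \<tau>) ^ mi_size n j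
      * q ^ (\<Sum>r=1..n. (r - 1) * j r)
      * (qpoch q q (mi_size n j) * qpoch q c (mi_size n j) / qpoch q (b * c) (mi_size n j))
      * (\<Prod>r=1..n. 1 / qpoch q (\<beta> * x r) (j r))) has_sum T) (multi_indices n)"
      unfolding lhs_term[OF gen] using T1 by (simp only: S_def)
  next
    show "((\<lambda>k.
        (\<Prod>(r, s)\<in>index_pairs n.
            (1 - q powi (int (k r) - int (k s)) * x r / x s) / (1 - x r / x s))
      * (\<Prod>r=1..n. \<Prod>s=1..n.
            qpoch q (x r / (x s * y s)) (k r) / qpoch q (q * x r / x s) (k r))
      * ((1 - \<tau> * q ^ (2 * mi_size n k)) * qpoch q q (mi_size n k)
          / qpoch q (Y * \<tau>) (mi_size n k + 1))
      * (Y * \<beta> * \<tau>) ^ mi_size n k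
      * q ^ ((\<Sum>r=1..n. (r - 1) * k r) + (mi_size n k choose 2) + (\<Sum>r=1..n. (k r choose 2)))
      * (\<Prod>r=1..n.
            qpoch q (q powi (1 + int (mi_size n k) - int (k r)) * \<tau> / (\<beta> * x r)) (k r)
            / qpoch q (\<beta> * x r) (k r))
      * (\<Prod>r=1..n. x r ^ k r)
      * (\<Sum>j\<in>multi_indices_le n k.
            (\<Prod>(r, s)\<in>index_pairs n.
                (1 - q powi (int (k s) - int (k r) + int (j r) - int (j s)) * x s / x r)
                / (1 - q powi (int (k s) - int (k r)) * x s / x r))
          * q powi (int (mi_size n k) * int (mi_size n j) - (\<Sum>r=1..n. int (k r) * int (j r))
                    - int (elem_sym2 n j) + (\<Sum>r=1..n. int r * int (j r)))
          * (\<Prod>r=1..n. \<Prod>s=1..n.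
                qpoch q (q powi (- int (k r)) * x s / x r) (j r)
                / qpoch q (q powi (1 + int (k s) - int (k r)) * x s / x r) (j r))
          * (\<Prod>r=1..n.
                x r powi (- int (j r))
                / qpoch q (\<tau> * q powi (1 - int (k r) + int (mi_size n k)) / (\<beta> * x r)) (j r))
          * (c / \<beta>) ^ mi_size n j
          * (qpoch q (\<tau> * q ^ mi_size n k) (mi_size n j) * qpoch q b (mi_size n j)
              / qpoch q (b * c) (mi_size n j)))) has_sum T) (multi_indices n)"
    proof (rule has_sum_cong[THEN iffD2, OF _ T2])
      fix k assume k: "k \<in> multi_indices n"
      define N where "N = mi_size n k"
      define inner where "inner j =
            (\<Prod>(r, s)\<in>index_pairs n.
                (1 - q powi (int (k s) - int (k r) + int (j r) - int (j s)) * x s / x r)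
                / (1 - q powi (int (k s) - int (k r)) * x s / x r))
          * q powi (int (N) * int (mi_size n j) - (\<Sum>r=1..n. int (k r) * int (j r))
                    - int (elem_sym2 n j) + (\<Sum>r=1..n. int r * int (j r)))
          * (\<Prod>r=1..n. \<Prod>s=1..n.
                qpoch q (q powi (- int (k r)) * x s / x r) (j r)
                / qpoch q (q powi (1 + int (k s) - int (k r)) * x s / x r) (j r))
          * (\<Prod>r=1..n.
                x r powi (- int (j r))
                / qpoch q (\<tau> * q powi (1 - int (k r) + int (N)) / (\<beta> * x r)) (j r))
          * (c / \<beta>) ^ mi_size n j
          * (qpoch q (\<tau> * q ^ N) (mi_size n j) * qpoch q b (mi_size n j)
              / qpoch q (b * c) (mi_size n j))" for j
      \<comment> \<open>The factors \<open>\<beta> ^ N\<close> and \<open>(-1) ^ N\<close> account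
        for the difference between \<open>(Y * \<beta> * \<tau>) ^ N\<close> in the theorem and
        \<open>(- (Y * \<tau>)) ^ N\<close> in the expansion.\<close>
      have pre: "\<beta> ^ N * q ^ (\<Sum>r=1..n. (k r choose 2)) * (\<Prod>r=1..n. qpoch q (q powi (1 + int N - int (k r)) * \<tau> / (\<beta> * x r)) (k r)) * (\<Prod>r=1..n. x r ^ k r) *
         (\<Sum>j\<in>multi_indices_le n k. inner j) =
         (-1) ^ N * (node_qpoch x \<beta> k * (\<Sum>i\<in>multi_indices_le n k. wt x (qinv k) i * q ^ mi_size n i * qpoch q (\<tau> * q ^ N) (mi_size n i) * S i))"
      proof -
        have "\<beta> ^ N * q ^ (\<Sum>r=1..n. (k r choose 2)) * (\<Prod>r=1..n. qpoch q (q powi (1 + int N - int (k r)) * \<tau> / (\<beta> * x r)) (k r)) * (\<Prod>r=1..n. x r ^ k r) *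
          inner j = (-1) ^ N * (wt (dual x k) (qinv k) j * node_poly x \<beta> (\<lambda>s. k s - j s) (\<tau> * q ^ N) *
            ((-1) ^ mi_size n j * q ^ (mi_size n k * mi_size n j) / q ^ (mi_size n j choose 2) * c ^ mi_size n j *
           qpoch q (\<tau> * q ^ N) (mi_size n j) * qpoch q b (mi_size n j) / qpoch q (b * c) (mi_size n j)))"
          if "j \<in> multi_indices_le n k" for j
          unfolding inner_def N_def by (rule rhs_inner[OF gen beta_nz that den8[OF k that]])
        then have "\<beta> ^ N * q ^ (\<Sum>r=1..n. (k r choose 2)) * (\<Prod>r=1..n. qpoch q (q powi (1 + int N - int (k r)) * \<tau> / (\<beta> * x r)) (k r)) * (\<Prod>r=1..n. x r ^ k r) *
         (\<Sum>j\<in>multi_indices_le n k. inner j) = (-1) ^ N * (\<Sum>j\<in>multi_indices_le n k. wt (dual x k) (qinv k) j * node_poly x \<beta> (\<lambda>s. k s - j s) (\<tau> * q ^ N) *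
            ((-1) ^ mi_size n j * q ^ (mi_size n k * mi_size n j) / q ^ (mi_size n j choose 2) * c ^ mi_size n j *
           qpoch q (\<tau> * q ^ N) (mi_size n j) * qpoch q b (mi_size n j) / qpoch q (b * c) (mi_size n j)))"
          unfolding sum_distrib_left by (intro sum.cong refl)
        also have "\<dots> = (-1) ^ N * (node_qpoch x \<beta> k * (\<Sum>i\<in>multi_indices_le n k. wt x (qinv k) i / node_qpoch x \<beta> i * q ^ mi_size n i *
            qpoch q (\<tau> * q ^ N) (mi_size n i) * (qpoch q c (mi_size n i) / qpoch q (b * c) (mi_size n i))))"
          unfolding transformation_3phi2[OF gen beta_nz nzB den3] ..
        finally show ?thesis by (simp add: S_def ac_simps)
      qed
      define V where "V = vdm x k"
      define Q where "Q = (\<Prod>r=1..n. \<Prod>s=1..n. qpoch q (x r / (x s * y s)) (k r) / qpoch q (q * x r / x s) (k r))"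
      define e where "e = q ^ (\<Sum>r=1..n. (r - 1) * k r)"
      define f where "f = (1 - \<tau> * q ^ (2 * N)) * qpoch q q N / qpoch q (Y * \<tau>) (N + 1)"
      define G where "G = (\<Prod>r=1..n. qpoch q (q powi (1 + int N - int (k r)) * \<tau> / (\<beta> * x r)) (k r))"
      define X where "X = (\<Prod>r=1..n. x r ^ k r)"
      define h where "h = q ^ (\<Sum>r=1..n. (k r choose 2))"
      define I where "I = (\<Sum>j\<in>multi_indices_le n k. inner j)"
      define Z where "Z = (\<Sum>i\<in>multi_indices_le n k. wt x (qinv k) i * q ^ mi_size n i * qpoch q (\<tau> * q ^ N) (mi_size n i) * S i)"
      have W: "wt x (\<lambda>s. 1 / y s) k = V * Q * e"
        unfolding wt_eq_vdm[OF gen] V_def Q_def e_def by (simp add: ac_simps)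
      have B: "(\<Prod>r=1..n. qpoch q (q powi (1 + int N - int (k r)) * \<tau> / (\<beta> * x r)) (k r) / qpoch q (\<beta> * x r) (k r)) = G / node_qpoch x \<beta> k"
        by (simp add: G_def node_qpoch_def prod_dividef)
      have "V * Q * f * (Y * \<beta> * \<tau>) ^ N * (e * q ^ (N choose 2) * h) * (G / node_qpoch x \<beta> k) * X * I =
         V * Q * e * f * (Y * \<tau>) ^ N * q ^ (N choose 2) * (\<beta> ^ N * h * G * X * I) / node_qpoch x \<beta> k"
        by (simp add: power_mult_distrib ac_simps)
      also have "\<dots> = V * Q * e * f * ((-1) ^ N * (Y * \<tau>) ^ N) * q ^ (N choose 2) * Z"
        unfolding pre[folded h_def G_def X_def I_def Z_def] using nzB[of k] by simp
      also have "(-1) ^ N * (Y * \<tau>) ^ N = (- (Y * \<tau>)) ^ N" by (rule power_minus [symmetric])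
      finally show "
        (\<Prod>(r, s)\<in>index_pairs n.
            (1 - q powi (int (k r) - int (k s)) * x r / x s) / (1 - x r / x s))
      * (\<Prod>r=1..n. \<Prod>s=1..n.
            qpoch q (x r / (x s * y s)) (k r) / qpoch q (q * x r / x s) (k r))
      * ((1 - \<tau> * q ^ (2 * mi_size n k)) * qpoch q q (mi_size n k)
          / qpoch q (Y * \<tau>) (mi_size n k + 1))
      * (Y * \<beta> * \<tau>) ^ mi_size n k
      * q ^ ((\<Sum>r=1..n. (r - 1) * k r) + (mi_size n k choose 2) + (\<Sum>r=1..n. (k r choose 2)))
      * (\<Prod>r=1..n.
            qpoch q (q powi (1 + int (mi_size n k) - int (k r)) * \<tau> / (\<beta> * x r)) (k r)
            / qpoch q (\<beta> * x r) (k r))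
      * (\<Prod>r=1..n. x r ^ k r)
      * (\<Sum>j\<in>multi_indices_le n k.
            (\<Prod>(r, s)\<in>index_pairs n.
                (1 - q powi (int (k s) - int (k r) + int (j r) - int (j s)) * x s / x r)
                / (1 - q powi (int (k s) - int (k r)) * x s / x r))
          * q powi (int (mi_size n k) * int (mi_size n j) - (\<Sum>r=1..n. int (k r) * int (j r))
                    - int (elem_sym2 n j) + (\<Sum>r=1..n. int r * int (j r)))
          * (\<Prod>r=1..n. \<Prod>s=1..n.
                qpoch q (q powi (- int (k r)) * x s / x r) (j r)
                / qpoch q (q powi (1 + int (k s) - int (k r)) * x s / x r) (j r))
          * (\<Prod>r=1..n.
                x r powi (- int (j r))
                / qpoch q (\<tau> * q powi (1 - int (k r) + int (mi_size n k)) / (\<beta> * x r)) (j r))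
          * (c / \<beta>) ^ mi_size n j
          * (qpoch q (\<tau> * q ^ mi_size n k) (mi_size n j) * qpoch q b (mi_size n j)
              / qpoch q (b * c) (mi_size n j))) = wt x (\<lambda>s. 1 / y s) k * ((1 - \<tau> * q ^ (2 * mi_size n k)) * qpoch q q (mi_size n k) / qpoch q (Y * \<tau>) (Suc (mi_size n k))) *
      (- (Y * \<tau>)) ^ mi_size n k * q ^ (mi_size n k choose 2) *
      (\<Sum>i\<in>multi_indices_le n k. wt x (qinv k) i * q ^ mi_size n i * qpoch q (\<tau> * q ^ mi_size n k) (mi_size n i) * S i)"
        unfolding N_def [symmetric] inner_def [symmetric] vdm_powi power_add B W
          V_def Q_def e_def f_def h_def X_def I_def Z_def Suc_eq_plus1 .
    qed
  qed
qed

end
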